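(* Let $(X,\Sigma,\mathfrak m)$ be a $\sigma$-finite measure space, $\mathbb B$ a separable Banach space, and $\mathbf E$ a Banach $\mathbb B$-bundle over $X$. Then $\mathbf E$ is a reflexive bundle (i.e. $\mathbf E(x)$ is reflexive for $\mathfrak m$-a.e. $x\in X$) if and only if $\Gamma_p(\mathbf E)$ is a reflexive Banach space for every (or, equivalently, for some) $p\in(1,\infty)$.
   Context: All Banach spaces are real. Banach bundles: given a measurable space $(X,\Sigma)$ and a Banach space $\mathbb B$, a multivalued map $\mathbf E$ from $X$ to $\mathbb B$ (a map from $X$ to the power set of $\mathbb B$) is weakly measurable if $\{x\in X:\mathbf E(x)\cap U\neq\varnothing\}\in\Sigma$ for every open set $U\subseteq\mathbb B$. A Banach $\mathbb B$-bundle over $X$ is a weakly measurable multivalued map $\mathbf E$ such that $\mathbf E(x)$ is a closed linear subspace of $\mathbb B$ for every $x\in X$; $\mathbf E(x)$ carries the norm of $\mathbb B$. Sections: a map $v:X\to\mathbb B$ is strongly measurable if $x\mapsto\langle\omega,v(x)\rangle$ is measurable for every $\omega\in\mathbb B'$ (the continuous dual) and there is an $\mathfrak m$-null set $N\in\Sigma$ such that $v(X\setminus N)$ is separable. A section of $\mathbf E$ is a strongly measurable map $v:X\to\mathbb B$ with $v(x)\in\mathbf E(x)$ for every $x\in X$. For $p\in(1,\infty)$, $\Gamma_p(\mathbf E)$ is the space of equivalence classes, up to $\mathfrak m$-a.e. equality, of sections $v$ of $\mathbf E$ with $\|v(\cdot)\|_{\mathbb B}\in L^p(\mathfrak m)$.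 With pointwise operations and the norm $\|v\|_{\Gamma_p(\mathbf E)}=\big(\int\|v(x)\|_{\mathbb B}^p\,d\mathfrak m(x)\big)^{1/p}$ it is a Banach space. *)

theory Defs
  imports "HOL-Analysis.Analysis"
begin

section \<open>Real normed spaces with an explicit carrier, duals and reflexivity\<close>

text \<open>
  The fibres of a bundle vary with the base point and the section space consists of equivalence
  classes, so neither can be a type of class \<open>real_normed_vector\<close>. Normed spaces are therefore
  records with an explicit carrier.
\<close>

record 'a normed_space =
  points :: "'a set"
  nadd :: "'a \<Rightarrow> 'a \<Rightarrow> 'a"
  nscale :: "real \<Rightarrow> 'a \<Rightarrow> 'a"
  nnorm :: "'a \<Rightarrow> real"

definition subspace_space :: "'b::real_normed_vector set \<Rightarrow> 'b normed_space" where
  "subspace_space S = \<lparr>points = S, nadd = (+), nscale = (*\<^sub>R), nnorm = norm\<rparr>"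

definition continuous_functionals :: "'a normed_space \<Rightarrow> ('a \<Rightarrow> real) set" where
  "continuous_functionals V = {f \<in> extensional (points V).
     (\<forall>x\<in>points V. \<forall>y\<in>points V. f (nadd V x y) = f x + f y) \<and>
     (\<forall>c. \<forall>x\<in>points V. f (nscale V c x) = c * f x) \<and>
     (\<exists>C. \<forall>x\<in>points V. \<bar>f x\<bar> \<le> C * nnorm V x)}"

text \<open>
  Functionals are represented by functions that are \<open>undefined\<close> off the carrier (\<open>extensional\<close>),
  so that two functionals agreeing on the space are equal.
\<close>

definition dual :: "'a normed_space \<Rightarrow> ('a \<Rightarrow> real) normed_space" where
  "dual V = \<lparr>points = continuous_functionals V,
     nadd = (\<lambda>f g. restrict (\<lambda>x. f x + g x) (points V)),
     nscale = (\<lambda>c f. restrict (\<lambda>x. c * f x) (points V)),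
     nnorm = (\<lambda>f. SUP x\<in>{x \<in> points V. nnorm V x \<le> 1}. \<bar>f x\<bar>)\<rparr>"

definition bidual_embedding :: "'a normed_space \<Rightarrow> 'a \<Rightarrow> ('a \<Rightarrow> real) \<Rightarrow> real" where
  "bidual_embedding V x = restrict (\<lambda>f. f x) (points (dual V))"

text \<open>
  Completeness is not a separate requirement: the bidual is complete, so a normed space with
  surjective canonical embedding is automatically a Banach space.
\<close>

definition reflexive :: "'a normed_space \<Rightarrow> bool" where
  "reflexive V \<longleftrightarrow> bidual_embedding V ` points V = points (dual (dual V))"


section \<open>Banach bundles and their sections\<close>

text \<open>
  The underlying set of the base is \<open>space M\<close>; values of maps outside \<open>space M\<close> are irrelevant.
\<close>

definition weakly_measurable :: "'a measure \<Rightarrow> ('a \<Rightarrow> 'b::topological_space set) \<Rightarrow> bool" where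
  "weakly_measurable M E \<longleftrightarrow> (\<forall>U. open U \<longrightarrow> {x \<in> space M. E x \<inter> U \<noteq> {}} \<in> sets M)"

definition banach_bundle :: "'a measure \<Rightarrow> ('a \<Rightarrow> 'b::banach set) \<Rightarrow> bool" where
  "banach_bundle M E \<longleftrightarrow> weakly_measurable M E \<and>
     (\<forall>x\<in>space M. closed (E x) \<and> subspace (E x))"

definition reflexive_bundle :: "'a measure \<Rightarrow> ('a \<Rightarrow> 'b::banach set) \<Rightarrow> bool" where
  "reflexive_bundle M E \<longleftrightarrow> (AE x in M. reflexive (subspace_space (E x)))"

definition strongly_measurable :: "'a measure \<Rightarrow> ('a \<Rightarrow> 'b::real_normed_vector) \<Rightarrow> bool" where
  "strongly_measurable M v \<longleftrightarrow>
     (\<forall>\<omega>::'b \<Rightarrow>\<^sub>L real. (\<lambda>x. blinfun_apply \<omega> (v x)) \<in> borel_measurable M) \<and>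
     (\<exists>N\<in>null_sets M. separable_space (top_of_set (v ` (space M - N))))"

definition sections :: "'a measure \<Rightarrow> ('a \<Rightarrow> 'b::banach set) \<Rightarrow> ('a \<Rightarrow> 'b) set" where
  "sections M E = {v. strongly_measurable M v \<and> (\<forall>x\<in>space M. v x \<in> E x)}"

definition Lp_sections :: "'a measure \<Rightarrow> ('a \<Rightarrow> 'b::banach set) \<Rightarrow> real \<Rightarrow> ('a \<Rightarrow> 'b) set" where
  "Lp_sections M E p = {v \<in> sections M E. integrable M (\<lambda>x. norm (v x) powr p)}"

definition ae_rel :: "'a measure \<Rightarrow> ('a \<Rightarrow> 'b::banach set) \<Rightarrow> real \<Rightarrow> (('a \<Rightarrow> 'b) \<times> ('a \<Rightarrow> 'b)) set" where
  "ae_rel M E p = {(u, v). u \<in> Lp_sections M E p \<and> v \<in> Lp_sections M E p \<and> (AE x in M. u x = v x)}"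

text \<open>
  Operations on classes are those induced from representatives: a union over all representatives
  of the class of the result, and the common value of the norm.
\<close>

definition section_space ::
    "'a measure \<Rightarrow> ('a \<Rightarrow> 'b::banach set) \<Rightarrow> real \<Rightarrow> ('a \<Rightarrow> 'b) set normed_space" where
  "section_space M E p =
    \<lparr>points = Lp_sections M E p // ae_rel M E p,
     nadd = (\<lambda>U V. \<Union>u\<in>U. \<Union>v\<in>V. ae_rel M E p `` {\<lambda>x. u x + v x}),
     nscale = (\<lambda>c U. \<Union>u\<in>U. ae_rel M E p `` {\<lambda>x. c *\<^sub>R u x}),
     nnorm = (\<lambda>U. the_elem ((\<lambda>u. (\<integral>x. norm (u x) powr p \<partial>M) powr (1 / p)) ` U))\<rparr>"

end

theory Submission
  imports Defs "HOL-Library.Function_Algebras"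
begin

text \<open>
  Every space is encoded as a seminorm on a whole real vector space: a subspace is pulled back along a linear projection,
  the section space along the map taking a function to the class of its projection to the \<open>p\<close>-integrable sections.

  By James, a complete space is nonreflexive if and only if it contains a bounded sequence \<open>w\<close> and \<open>\<theta> > 0\<close> such that
  convex combinations of \<open>w 0, \<dots>, w (n - 1)\<close> and of \<open>w n, w (n + 1), \<dots>\<close> always have distance at least \<open>\<theta>\<close>.

  Suppose almost every fibre is reflexive and the section space contains such a sequence. Convex blocks of it converge
  almost everywhere when tested against a norming sequence of functionals, hence converge weakly in almost every fibre to
  a section \<open>v\<close>. A functional on the section space acts on each section through a density; the densities of the differences
  between the blocks and \<open>v\<close> tend to \<open>0\<close> almost everywhere, and since \<open>p > 1\<close> they are uniformly integrable. So the blocks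
  converge weakly to \<open>v\<close>, which the James condition forbids.

  Conversely, a James sequence in the fibre over \<open>x\<close> can be chosen from a dense sequence of measurable sections, which makes
  the set of nonreflexive fibres the projection of a Suslin scheme. If it is not null, a measurable choice of indices on
  a set of positive measure produces a James sequence in the section space.
\<close>

section \<open>Hahn--Banach separation for seminorms\<close>

text \<open>The obstacle is duality. The dual of the section space is not identified with a space of
  sections of dual fibres, which would bring in weak-star measurability. James's criterion speaks
  only of norms of vectors, so both implications can stay among sections: one sequence works against
  all convex weights at once, and a pointwise lower bound on a set of finite positive measure
  integrates to a lower bound for the \<open>p\<close>-norm. A bounded functional \<open>F\<close>
  enters only through the scalar set functions sending \<open>A\<close> to
  \<open>F (cut A u)\<close>. Their densities are defined almost everywhere, with no bound at a
  single point, so their convergence to 0 needs glueing: where a density stays large for infinitely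
  many indices, Mazur's lemma in the fibre makes averages of the sections small there, and countably
  many averages cover the set. Testing weak convergence in a fibre on countably many functionals is
  enough because, in a reflexive space, the functionals along which a bounded sequence converges
  form a closed subspace of the dual, and such a subspace is everything once it separates
  points.\<close>

instantiation "fun" :: (type, scaleR) scaleR
begin

definition scaleR_fun_def: "c *\<^sub>R f = (\<lambda>x. c *\<^sub>R f x)"

instance ..

end

lemma scaleR_fun_apply [simp]: "(c *\<^sub>R f) x = c *\<^sub>R f x"
  by (simp add: scaleR_fun_def)

text \<open>Functionals and sections thereby become vectors, so that \<open>linear\<close>,
  \<open>subspace\<close> and \<open>convex\<close> apply to them directly.\<close>

instance "fun" :: (type, real_vector) real_vector
  by standard (auto simp: fun_eq_iff scaleR_add_right scaleR_add_left)

lemma sum_fun_apply [simp]: "(\<Sum>i\<in>I. f i) x = (\<Sum>i\<in>I. f i x)"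
  by (induction I rule: infinite_finite_induct) auto

text \<open>The projection comes from an algebraic complement, without continuity or measurability;
  it turns linear data given on a subspace into data on the whole type.\<close>

lemma linear_projection_onto:
  fixes S :: "'v::real_vector set"
  assumes "subspace S"
  obtains P where "linear P" "range P = S" "\<And>x. x \<in> S \<Longrightarrow> P x = x"
proof -
  obtain P where "range P \<subseteq> S" "linear P" "\<forall>v\<in>S. P v = v"
    using linear_exists_left_inverse_on[OF linear_ident assms] by auto
  moreover have "S \<subseteq> range P" using calculation(3) by (metis rangeI subsetI)
  ultimately show ?thesis using that[of P] by blast
qed

definition sublinear :: "('v::real_vector \<Rightarrow> real) \<Rightarrow> bool" where
  "sublinear p \<longleftrightarrow> (\<forall>x y. p (x + y) \<le> p x + p y) \<and> (\<forall>c x. 0 < c \<longrightarrow> p (c *\<^sub>R x) = c * p x)"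

lemma sublinear_zero: "sublinear p \<Longrightarrow> p 0 = 0"
proof -
  assume p: "sublinear p"
  have "p (2 *\<^sub>R 0) = 2 * p 0"
    using p unfolding sublinear_def by (simp del: scaleR_zero_right)
  then show ?thesis by simp
qed

lemma sublinear_neg_le: "sublinear p \<Longrightarrow> - p (- x) \<le> p x"
proof -
  assume p: "sublinear p"
  then have "p (x + - x) \<le> p x + p (- x)" unfolding sublinear_def by blast
  then show ?thesis using sublinear_zero[OF p] by simp
qed

text \<open>Take for \<open>q z\<close> the infimum of \<open>p (z + t *\<^sub>R a) - t * e\<close>
  over \<open>t \<ge> 0\<close> and \<open>a \<in> A\<close>; the bound \<open>e \<le> p a\<close>
  keeps it finite. A linear function below \<open>q\<close> is at least \<open>e\<close> on
  \<open>A\<close>, so Hahn-Banach separation reduces to plain domination.\<close>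

lemma sublinear_reduce:
  fixes p :: "'v::real_vector \<Rightarrow> real"
  assumes p: "sublinear p" and A: "convex A" "a \<in> A" and e: "\<And>a. a \<in> A \<Longrightarrow> e \<le> p a"
  obtains q where "sublinear q" "\<And>x. q x \<le> p x" "\<And>a. a \<in> A \<Longrightarrow> q (- a) \<le> - e"
proof -
  define T where "T z = {p (z + t *\<^sub>R a) - t * e | t a. 0 \<le> t \<and> a \<in> A}" for z
  have lb: "- p (- z) \<le> r" if "r \<in> T z" for z r
  proof -
    from that obtain t a where ta: "0 \<le> t" "a \<in> A" and r: "r = p (z + t *\<^sub>R a) - t * e"
      by (auto simp: T_def)
    have "p (t *\<^sub>R a) \<le> p (z + t *\<^sub>R a) + p (- z)"
    proof -
      have "p ((z + t *\<^sub>R a) + - z) \<le> p (z + t *\<^sub>R a) + p (- z)"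
        using p unfolding sublinear_def by blast
      then show ?thesis by simp
    qed
    moreover have "t * e \<le> p (t *\<^sub>R a)"
    proof (cases "t = 0")
      case True
      then show ?thesis using sublinear_zero[OF p] by simp
    next
      case False
      then have "p (t *\<^sub>R a) = t * p a"
        using ta p by (auto simp: sublinear_def)
      then show ?thesis using e[OF ta(2)] ta(1) by (simp add: mult_left_mono)
    qed
    ultimately show ?thesis using r by simp
  qed
  have bdd: "bdd_below (T z)" for z using lb by (meson bdd_belowI)
  have mem: "p (z + t *\<^sub>R a) - t * e \<in> T z" if "0 \<le> t" "a \<in> A" for z t a
    using that by (auto simp: T_def)
  have ne: "T z \<noteq> {}" for z using mem[of 0 a z] A(2) by auto
  define q where "q z = Inf (T z)" for z
  have q_le: "q z \<le> p (z + t *\<^sub>R a) - t * e" if "0 \<le> t" "a \<in> A" for z t a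
    unfolding q_def by (rule cInf_lower[OF mem[OF that] bdd])
  have add: "q (x + y) \<le> r + s" if "r \<in> T x" "s \<in> T y" for x y r s
  proof -
    from that obtain t a u b where ta: "0 \<le> t" "a \<in> A" and r: "r = p (x + t *\<^sub>R a) - t * e"
      and ub: "0 \<le> u" "b \<in> A" and s: "s = p (y + u *\<^sub>R b) - u * e"
      by (auto simp: T_def)
    \<comment> \<open>Convexity merges the two perturbations into one multiple of a single point of
      \<open>A\<close>; this gives subadditivity.\<close>
    obtain c where c: "c \<in> A" "t *\<^sub>R a + u *\<^sub>R b = (t + u) *\<^sub>R c"
    proof (cases "t + u = 0")
      case True
      then show ?thesis using that[of a] ta ub by (simp add: add_nonneg_eq_0_iff)
    next
      case False
      then have "(t / (t + u)) *\<^sub>R a + (u / (t + u)) *\<^sub>R b \<in> A"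
        using ta ub by (intro convexD[OF A(1)]) (auto simp: add_divide_distrib[symmetric])
      moreover have "t *\<^sub>R a + u *\<^sub>R b = (t + u) *\<^sub>R ((t / (t + u)) *\<^sub>R a + (u / (t + u)) *\<^sub>R b)"
        using False by (simp only: scaleR_add_right scaleR_scaleR) simp
      ultimately show ?thesis using that by blast
    qed
    have "q (x + y) \<le> p ((x + y) + (t + u) *\<^sub>R c) - (t + u) * e"
      using q_le[of "t + u" c "x + y"] c ta ub by simp
    also have "(x + y) + (t + u) *\<^sub>R c = (x + t *\<^sub>R a) + (y + u *\<^sub>R b)"
      by (simp only: c(2)[symmetric] ac_simps)
    also have "p \<dots> \<le> p (x + t *\<^sub>R a) + p (y + u *\<^sub>R b)"
      using p by (auto simp: sublinear_def)
    finally show ?thesis by (simp add: r s algebra_simps)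
  qed
  have "q (x + y) \<le> q x + q y" for x y
  proof -
    have "q (x + y) - s \<le> q x" if "s \<in> T y" for s
      unfolding q_def[of x] using add[OF _ that] by (intro cInf_greatest[OF ne]) (auto simp: algebra_simps)
    then have "q (x + y) - q x \<le> q y"
      unfolding q_def[of y] by (intro cInf_greatest[OF ne]) (auto simp: algebra_simps)
    then show ?thesis by simp
  qed
  moreover have "q (c *\<^sub>R x) = c * q x" if c: "0 < c" for c x
  proof -
    have *: "q (c *\<^sub>R x) \<le> c * q x" if c: "0 < c" for c x
    proof -
      have "q (c *\<^sub>R x) / c \<le> r" if "r \<in> T x" for r
      proof -
        from that obtain t a where ta: "0 \<le> t" "a \<in> A" and r: "r = p (x + t *\<^sub>R a) - t * e"
          by (auto simp: T_def)
        have "q (c *\<^sub>R x) \<le> p (c *\<^sub>R x + (c * t) *\<^sub>R a) - (c * t) * e"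
          using q_le[of "c * t" a] ta c by simp
        also have "c *\<^sub>R x + (c * t) *\<^sub>R a = c *\<^sub>R (x + t *\<^sub>R a)"
          by (simp add: algebra_simps)
        also have "p \<dots> = c * p (x + t *\<^sub>R a)"
          using p c by (auto simp: sublinear_def)
        finally show ?thesis using c by (simp add: r field_simps)
      qed
      then have "q (c *\<^sub>R x) / c \<le> q x"
        unfolding q_def[of x] by (intro cInf_greatest[OF ne])
      then show ?thesis using c by (simp add: field_simps)
    qed
    have "q ((1 / c) *\<^sub>R (c *\<^sub>R x)) \<le> (1 / c) * q (c *\<^sub>R x)"
      using c by (intro *) auto
    then have "c * q x \<le> q (c *\<^sub>R x)" using c by (simp add: field_simps)
    with *[OF c, of x] show ?thesis by simp
  qed
  ultimately have "sublinear q" by (auto simp: sublinear_def)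
  moreover have "q z \<le> p z" for z using q_le[of 0 a z] A(2) by simp
  moreover have "q (- a) \<le> - e" if "a \<in> A" for a
    using q_le[of 1 a "- a"] that sublinear_zero[OF p] by simp
  ultimately show ?thesis using that by blast
qed

text \<open>Reducing \<open>p\<close> along the single point \<open>x\<close> with
  \<open>e = p x\<close> gives a function below \<open>p\<close> whose value at \<open>- x\<close>
  is at most \<open>- p x\<close>. Minimality transfers this to \<open>p\<close>, and an odd
  sublinear function is linear.\<close>

lemma minimal_sublinear_is_linear:
  fixes p :: "'v::real_vector \<Rightarrow> real"
  assumes p: "sublinear p" and min: "\<And>q. sublinear q \<Longrightarrow> (\<And>x. q x \<le> p x) \<Longrightarrow> q = p"
  shows "linear p"
proof -
  have neg: "p (- x) = - p x" for x
  proof -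
    obtain q where q: "sublinear q" "\<And>x. q x \<le> p x" "q (- x) \<le> - p x"
      using sublinear_reduce[OF p, of "{x}" x "p x"] by auto
    then show ?thesis using min[OF q(1,2)] sublinear_neg_le[OF p, of "- x"] by force
  qed
  have sub: "p (x + y) \<le> p x + p y" for x y
    using p by (auto simp: sublinear_def)
  have "p (x + y) = p x + p y" for x y
    using sub[of x y] sub[of "- x" "- y"] neg[of x] neg[of y] neg[of "x + y"] by simp
  moreover have "p (c *\<^sub>R x) = c *\<^sub>R p x" for c x
  proof (cases c "0::real" rule: linorder_cases)
    case less
    then have "p ((- c) *\<^sub>R x) = (- c) * p x"
      using p unfolding sublinear_def by (simp del: scaleR_minus_left)
    then show ?thesis using neg[of "c *\<^sub>R x"] by simp
  qed (use p sublinear_zero[OF p] in \<open>auto simp: sublinear_def\<close>)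
  ultimately show ?thesis by (intro linearI) auto
qed

text \<open>This feeds Zorn's lemma. Of any two members of the chain one lies below the other, so
  the infimum is subadditive; \<open>- p (- x)\<close> bounds all members from below.\<close>

lemma sublinear_Inf_chain:
  fixes p :: "'v::real_vector \<Rightarrow> real"
  assumes p: "sublinear p" and ne: "C \<noteq> {}"
    and C: "\<And>q. q \<in> C \<Longrightarrow> sublinear q \<and> q \<le> p"
    and ch: "\<And>q r. q \<in> C \<Longrightarrow> r \<in> C \<Longrightarrow> q \<le> r \<or> r \<le> q"
  shows "sublinear (\<lambda>x. INF q\<in>C. q x)" and "q \<in> C \<Longrightarrow> (INF q\<in>C. q x) \<le> q x"
proof -
  have bdd: "bdd_below ((\<lambda>q. q x) ` C)" for x
  proof (rule bdd_belowI2)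
    fix q assume "q \<in> C"
    then have "- q (- x) \<le> q x" "q (- x) \<le> p (- x)"
      using C sublinear_neg_le[of q x] by (auto simp: le_fun_def)
    then show "- p (- x) \<le> q x" by simp
  qed
  then show low: "q \<in> C \<Longrightarrow> (INF q\<in>C. q x) \<le> q x" for q x
    by (rule cINF_lower)
  have "(INF q\<in>C. q (x + y)) \<le> (INF q\<in>C. q x) + (INF q\<in>C. q y)" for x y
  proof -
    have *: "(INF q\<in>C. q (x + y)) \<le> q x + r y" if "q \<in> C" "r \<in> C" for q r
    proof -
      obtain s where s: "s \<in> C" "s \<le> q" "s \<le> r" using ch[OF \<open>q \<in> C\<close> \<open>r \<in> C\<close>] \<open>q \<in> C\<close> \<open>r \<in> C\<close> by blast
      have "(INF q\<in>C. q (x + y)) \<le> s (x + y)" using s(1) by (rule low)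
      also have "\<dots> \<le> s x + s y" using C[OF s(1)] by (auto simp: sublinear_def)
      also have "\<dots> \<le> q x + r y" using s by (auto simp: le_fun_def intro!: add_mono)
      finally show ?thesis .
    qed
    have "(INF q\<in>C. q (x + y)) - q x \<le> (INF q\<in>C. q y)" if "q \<in> C" for q
      using *[OF that] by (intro cINF_greatest[OF ne]) (auto simp: algebra_simps)
    then have "(INF q\<in>C. q (x + y)) - (INF q\<in>C. q y) \<le> (INF q\<in>C. q x)"
      by (intro cINF_greatest[OF ne]) (auto simp: algebra_simps)
    then show ?thesis by simp
  qed
  moreover have "(INF q\<in>C. q (c *\<^sub>R x)) = c * (INF q\<in>C. q x)" if c: "0 < c" for c x
  proof -
    have "q (c *\<^sub>R x) = c * q x" if "q \<in> C" for q using C[OF that] c by (auto simp: sublinear_def)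
    then have eq: "(INF q\<in>C. q (c *\<^sub>R x)) = (INF q\<in>C. c * q x)" by simp
    have 1: "c * (INF q\<in>C. q x) \<le> (INF q\<in>C. c * q x)"
      using c by (intro cINF_greatest[OF ne] mult_left_mono low) auto
    have "bdd_below ((\<lambda>q. c * q x) ` C)"
      using c low by (intro bdd_belowI2[of _ "c * (INF q\<in>C. q x)"]) auto
    then have "(INF q\<in>C. c * q x) / c \<le> (INF q\<in>C. q x)"
      using c cINF_lower[of "\<lambda>q. c * q x" C]
      by (intro cINF_greatest[OF ne]) (auto simp: field_simps)
    then show ?thesis using 1 c eq by (simp add: field_simps)
  qed
  ultimately show "sublinear (\<lambda>x. INF q\<in>C. q x)" by (auto simp: sublinear_def)
qed

lemma ex_linear_le_sublinear:
  fixes p :: "'v::real_vector \<Rightarrow> real"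
  assumes p: "sublinear p"
  obtains f where "linear f" "\<And>x. f x \<le> p x"
proof -
  let ?A = "{q. sublinear q \<and> q \<le> p}"
  have "\<exists>m\<in>?A. \<forall>a\<in>?A. a \<le> m \<longrightarrow> a = m"
  proof (rule predicate_Zorn)
    show "partial_order_on ?A (relation_of (\<lambda>x y. y \<le> x) ?A)"
      by (rule partial_order_on_relation_ofI) auto
    fix C assume "C \<in> Chains (relation_of (\<lambda>x y. y \<le> x) ?A)"
    then have C: "\<And>q. q \<in> C \<Longrightarrow> sublinear q \<and> q \<le> p"
      and ch: "\<And>q r. q \<in> C \<Longrightarrow> r \<in> C \<Longrightarrow> q \<le> r \<or> r \<le> q"
      by (auto simp: Chains_def relation_of_def)
    show "\<exists>u\<in>?A. \<forall>a\<in>C. u \<le> a"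
    proof (cases "C = {}")
      case True
      then show ?thesis using p by auto
    next
      case False
      note * = sublinear_Inf_chain[OF p False C ch]
      from False obtain q where "q \<in> C" by auto
      then have "(\<lambda>x. INF q\<in>C. q x) \<le> q" "q \<le> p"
        using *(2) C by (auto intro!: le_funI)
      then have "(\<lambda>x. INF q\<in>C. q x) \<le> p" by (rule order_trans)
      then show ?thesis using * by (intro bexI[of _ "\<lambda>x. INF q\<in>C. q x"]) (auto simp: le_fun_def)
    qed
  qed
  then obtain m where m: "sublinear m" "m \<le> p" and min: "\<And>a. sublinear a \<Longrightarrow> a \<le> p \<Longrightarrow> a \<le> m \<Longrightarrow> a = m"
    by auto
  have "linear m"
    using m(2) by (intro minimal_sublinear_is_linear[OF m(1)] min) (auto simp: le_fun_def intro: order_trans)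
  then show ?thesis using m(2) that by (auto simp: le_fun_def)
qed

definition seminorm :: "('v::real_vector \<Rightarrow> real) \<Rightarrow> bool" where
  "seminorm Q \<longleftrightarrow> (\<forall>x y. Q (x + y) \<le> Q x + Q y) \<and> (\<forall>c x. Q (c *\<^sub>R x) = \<bar>c\<bar> * Q x)"

lemma seminorm_add: "seminorm Q \<Longrightarrow> Q (x + y) \<le> Q x + Q y"
  and seminorm_scale: "seminorm Q \<Longrightarrow> Q (c *\<^sub>R x) = \<bar>c\<bar> * Q x"
  by (auto simp: seminorm_def)

lemma seminorm_zero: "seminorm Q \<Longrightarrow> Q 0 = 0"
  using seminorm_scale[of Q 0 0] by simp

lemma seminorm_uminus: "seminorm Q \<Longrightarrow> Q (- x) = Q x"
  using seminorm_scale[of Q "-1" x] by simp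

lemma seminorm_diff_commute: "seminorm Q \<Longrightarrow> Q (x - y) = Q (y - x)"
  using seminorm_uminus[of Q "x - y"] by simp

lemma seminorm_diff: "seminorm Q \<Longrightarrow> Q (x - y) \<le> Q x + Q y"
  using seminorm_add[of Q x "- y"] seminorm_uminus[of Q y] by simp

lemma seminorm_triangle: "seminorm Q \<Longrightarrow> Q (x - z) \<le> Q (x - y) + Q (y - z)"
  using seminorm_add[of Q "x - y" "y - z"] by simp

lemma seminorm_nonneg: "seminorm Q \<Longrightarrow> 0 \<le> Q x"
  using seminorm_diff[of Q x x] by (simp add: seminorm_zero)

lemma seminorm_sublinear: "seminorm Q \<Longrightarrow> sublinear Q"
  by (auto simp: seminorm_def sublinear_def)

lemma seminorm_sum:
  assumes "seminorm Q" shows "Q (\<Sum>i\<in>I. x i) \<le> (\<Sum>i\<in>I. Q (x i))"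
proof (induction I rule: infinite_finite_induct)
  case (insert i I)
  then show ?case using seminorm_add[OF assms, of "x i" "\<Sum>i\<in>I. x i"] by simp
qed (auto simp: seminorm_zero[OF assms])

lemma seminorm_norm_comp: "linear P \<Longrightarrow> seminorm (\<lambda>x. norm (P x))"
  by (auto simp: seminorm_def linear_add linear_scale norm_triangle_ineq)

lemma seminorm_norm: "seminorm norm"
  by (auto simp: seminorm_def norm_triangle_ineq)

lemma abs_le_if_le_seminorm:
  assumes "seminorm Q" "linear f" "\<And>x. f x \<le> Q x"
  shows "\<bar>f x\<bar> \<le> Q x"
  using assms(3)[of x] assms(3)[of "- x"] linear_neg[OF assms(2)] seminorm_uminus[OF assms(1)]
  by (simp add: abs_le_iff)

text \<open>Reduce \<open>Q\<close> along \<open>A\<close> and take a linear function below the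
  result. The functional has dual norm at most 1 and keeps the sharp constant \<open>e\<close>; for
  singletons it is a norming functional.\<close>

theorem seminorm_separation:
  fixes Q :: "'v::real_vector \<Rightarrow> real"
  assumes Q: "seminorm Q" and A: "convex A" and e: "\<And>a. a \<in> A \<Longrightarrow> e \<le> Q a"
  obtains f where "linear f" "\<And>x. \<bar>f x\<bar> \<le> Q x" "\<And>a. a \<in> A \<Longrightarrow> e \<le> f a"
proof -
  obtain q where q: "sublinear q" "\<And>x. q x \<le> Q x" "\<And>a. a \<in> A \<Longrightarrow> q (- a) \<le> - e"
  proof (cases "A = {}")
    case True
    then show ?thesis using that[of Q] seminorm_sublinear[OF Q] by auto
  next
    case False
    then obtain a where "a \<in> A" by blast
    then show ?thesis by (rule sublinear_reduce[OF seminorm_sublinear[OF Q] A _ e, OF _ _ that])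
  qed
  obtain f where f: "linear f" "\<And>x. f x \<le> q x" using ex_linear_le_sublinear[OF q(1)] by blast
  have "f x \<le> Q x" for x using f(2)[of x] q(2)[of x] by linarith
  then have "\<bar>f x\<bar> \<le> Q x" for x using abs_le_if_le_seminorm[OF Q f(1)] by blast
  moreover have "e \<le> f a" if "a \<in> A" for a
    using f(2)[of "- a"] q(3)[OF that] linear_neg[OF f(1), of a] by simp
  ultimately show ?thesis using that f(1) by blast
qed

section \<open>Reflexivity and James sequences\<close>

definition bounded_functionals :: "('v::real_vector \<Rightarrow> real) \<Rightarrow> ('v \<Rightarrow> real) set" where
  "bounded_functionals Q = {f. linear f \<and> (\<exists>K\<ge>0. \<forall>x. \<bar>f x\<bar> \<le> K * Q x)}"

text \<open>An element of the bidual of norm at most \<open>C\<close>. It is linear on all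
  functions, since an algebraic extension always exists, but bounds are imposed on bounded
  functionals only.\<close>

definition bidual_element :: "('v::real_vector \<Rightarrow> real) \<Rightarrow> real \<Rightarrow> (('v \<Rightarrow> real) \<Rightarrow> real) \<Rightarrow> bool" where
  "bidual_element Q C \<phi> \<longleftrightarrow> linear \<phi> \<and>
     (\<forall>f K. linear f \<longrightarrow> 0 \<le> K \<longrightarrow> (\<forall>x. \<bar>f x\<bar> \<le> K * Q x) \<longrightarrow> \<bar>\<phi> f\<bar> \<le> C * K)"

definition reflexive_seminorm :: "('v::real_vector \<Rightarrow> real) \<Rightarrow> bool" where
  "reflexive_seminorm Q \<longleftrightarrow>
     (\<forall>\<phi> C. bidual_element Q C \<phi> \<longrightarrow> (\<exists>x. \<forall>f\<in>bounded_functionals Q. \<phi> f = f x))"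

lemma linear_fun_add: "linear f \<Longrightarrow> linear g \<Longrightarrow> linear (f + g :: 'v::real_vector \<Rightarrow> real)"
  and linear_fun_scale: "linear f \<Longrightarrow> linear (c *\<^sub>R f :: 'v \<Rightarrow> real)"
  and linear_fun_zero: "linear (0 :: 'v \<Rightarrow> real)"
  by (auto intro!: linearI simp: linear_add linear_scale algebra_simps)

lemma bounded_functionalsI:
  "linear f \<Longrightarrow> (\<And>x. \<bar>f x\<bar> \<le> K * Q x) \<Longrightarrow> 0 \<le> K \<Longrightarrow> f \<in> bounded_functionals Q"
  by (auto simp: bounded_functionals_def)

lemma bounded_functional_bound_add:
  assumes "\<And>x. \<bar>f x\<bar> \<le> K * Q x" "\<And>x. \<bar>g x\<bar> \<le> L * Q x"
  shows "\<bar>(f + g) x\<bar> \<le> (K + L) * (Q x :: real)"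
  using assms(1)[of x] assms(2)[of x] abs_triangle_ineq[of "f x" "g x"] by (simp add: algebra_simps)

lemma subspace_bounded_functionals: "subspace (bounded_functionals Q)"
proof (intro subspaceI)
  show "0 \<in> bounded_functionals Q"
    by (rule bounded_functionalsI[of _ 0]) (auto simp: linear_fun_zero)
  fix f g assume f: "f \<in> bounded_functionals Q" and g: "g \<in> bounded_functionals Q"
  obtain K L where fg: "linear f" "0 \<le> K" "\<And>x. \<bar>f x\<bar> \<le> K * Q x" "linear g" "0 \<le> L" "\<And>x. \<bar>g x\<bar> \<le> L * Q x"
    using f g by (auto simp: bounded_functionals_def)
  show "f + g \<in> bounded_functionals Q"
    using fg by (intro bounded_functionalsI[of _ "K + L"] linear_fun_add bounded_functional_bound_add) auto
next
  fix c f assume "f \<in> bounded_functionals Q"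
  then obtain K where f: "linear f" "0 \<le> K" "\<And>x. \<bar>f x\<bar> \<le> K * Q x"
    by (auto simp: bounded_functionals_def)
  have "\<bar>(c *\<^sub>R f) x\<bar> \<le> (\<bar>c\<bar> * K) * Q x" for x
    using mult_left_mono[OF f(3)[of x], of "\<bar>c\<bar>"] by (simp add: abs_mult mult.assoc)
  then show "c *\<^sub>R f \<in> bounded_functionals Q"
    using f by (intro bounded_functionalsI[of _ "\<bar>c\<bar> * K"] linear_fun_scale) auto
qed

lemma bounded_functional_null:
  assumes "f \<in> bounded_functionals Q" "Q x = 0" shows "f x = 0"
  using assms by (auto simp: bounded_functionals_def dest: spec[of _ x])

section \<open>Convex combinations of tails, and James sequences\<close>

definition tail_combinations :: "(nat \<Rightarrow> 'v::real_vector) \<Rightarrow> nat \<Rightarrow> 'v set" where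
  "tail_combinations w n =
     {\<Sum>k=n..<m. a k *\<^sub>R w k | a m. (\<forall>k. 0 \<le> a k) \<and> sum a {n..<m} = (1::real)}"

lemma tail_combinationsE:
  assumes "b \<in> tail_combinations w n"
  obtains a m where "\<And>k. 0 \<le> a k" "sum a {n..<m} = 1" "b = (\<Sum>k=n..<m. a k *\<^sub>R w k)"
  using assms by (auto simp: tail_combinations_def)

text \<open>Padding by zeros brings two combinations to a common index interval; the new weights do
  not depend on the vectors.\<close>

lemma tail_combinations_extend:
  fixes a :: "nat \<Rightarrow> real"
  assumes "\<And>k. 0 \<le> a k" "sum a {n..<m} = 1" "n' \<le> n" "m \<le> m'"
  shows "\<exists>a'. (\<forall>k. 0 \<le> a' k) \<and> (\<forall>k. a' k \<noteq> 0 \<longrightarrow> n \<le> k \<and> k < m) \<and> sum a' {n'..<m'} = (1::real) \<and>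
    (\<forall>w. (\<Sum>k=n'..<m'. a' k *\<^sub>R w k) = (\<Sum>k=n..<m. a k *\<^sub>R (w k :: 'v::real_vector)))"
proof (intro exI conjI allI)
  let ?a = "\<lambda>k. if k \<in> {n..<m} then a k else 0"
  show "0 \<le> ?a k" for k using assms(1) by simp
  show "?a k \<noteq> 0 \<longrightarrow> n \<le> k \<and> k < m" for k by auto
  have sub: "{n..<m} \<subseteq> {n'..<m'}" using assms by auto
  show "sum ?a {n'..<m'} = 1"
    using sum.mono_neutral_right[OF finite_atLeastLessThan sub, of ?a] assms(2)
    by (simp add: DiffD2 del: atLeastLessThan_iff)
  show "(\<Sum>k=n'..<m'. ?a k *\<^sub>R w k) = (\<Sum>k=n..<m. a k *\<^sub>R w k)" for w :: "nat \<Rightarrow> 'v"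
    using sum.mono_neutral_right[OF finite_atLeastLessThan sub, of "\<lambda>k. ?a k *\<^sub>R w k"]
    by (simp add: DiffD2 del: atLeastLessThan_iff)
qed

lemma tail_combinations_antimono:
  assumes "n' \<le> n" shows "tail_combinations w n \<subseteq> tail_combinations w n'"
proof
  fix b assume "b \<in> tail_combinations w n"
  then obtain a m where a: "\<And>k. 0 \<le> a k" "sum a {n..<m} = 1" "b = (\<Sum>k=n..<m. a k *\<^sub>R w k)"
    by (blast elim: tail_combinationsE)
  obtain a' where "\<forall>k. 0 \<le> a' k" "sum a' {n'..<m} = 1" "\<forall>w. (\<Sum>k=n'..<m. a' k *\<^sub>R w k) = (\<Sum>k=n..<m. a k *\<^sub>R (w k :: 'a))"
    using tail_combinations_extend[where 'v='a, OF a(1,2) assms order_refl] by blast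
  then show "b \<in> tail_combinations w n'"
    unfolding tail_combinations_def a(3) by (intro CollectI exI[of _ a'] exI[of _ m]) auto
qed

lemma mem_tail_combinations: "n \<le> k \<Longrightarrow> w k \<in> tail_combinations w n"
  unfolding tail_combinations_def
  by (rule CollectI, rule exI[of _ "\<lambda>j. if j = k then 1 else 0"], rule exI[of _ "Suc k"])
    (simp add: if_distrib[of "\<lambda>a. a *\<^sub>R _"] cong: if_cong)

lemma convex_tail_combinations: "convex (tail_combinations w n)"
proof (rule convexI)
  fix x y and u v :: real
  assume x: "x \<in> tail_combinations w n" and y: "y \<in> tail_combinations w n"
    and uv: "0 \<le> u" "0 \<le> v" "u + v = 1"
  obtain a m where a: "\<And>k. 0 \<le> a k" "sum a {n..<m} = 1" "x = (\<Sum>k=n..<m. a k *\<^sub>R w k)"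
    using x by (blast elim: tail_combinationsE)
  obtain b l where b: "\<And>k. 0 \<le> b k" "sum b {n..<l} = 1" "y = (\<Sum>k=n..<l. b k *\<^sub>R w k)"
    using y by (blast elim: tail_combinationsE)
  let ?m = "max m l"
  obtain a' where a': "\<forall>k. 0 \<le> a' k" "sum a' {n..<?m} = 1" "\<forall>w. (\<Sum>k=n..<?m. a' k *\<^sub>R w k) = (\<Sum>k=n..<m. a k *\<^sub>R (w k :: 'a))"
    using tail_combinations_extend[where 'v='a, OF a(1,2) order_refl, of ?m] by auto
  obtain b' where b': "\<forall>k. 0 \<le> b' k" "sum b' {n..<?m} = 1" "\<forall>w. (\<Sum>k=n..<?m. b' k *\<^sub>R w k) = (\<Sum>k=n..<l. b k *\<^sub>R (w k :: 'a))"
    using tail_combinations_extend[where 'v='a, OF b(1,2) order_refl, of ?m] by auto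
  have "u *\<^sub>R x + v *\<^sub>R y = (\<Sum>k=n..<?m. (u * a' k + v * b' k) *\<^sub>R w k)"
  proof -
    have "x = (\<Sum>k=n..<?m. a' k *\<^sub>R w k)" "y = (\<Sum>k=n..<?m. b' k *\<^sub>R w k)"
      using a'(3) b'(3) a(3) b(3) by auto
    then show ?thesis by (simp add: scaleR_add_left sum.distrib scaleR_right.sum)
  qed
  moreover have "sum (\<lambda>k. u * a' k + v * b' k) {n..<?m} = 1"
    using a'(2) b'(2) uv by (simp add: sum.distrib sum_distrib_left[symmetric])
  ultimately show "u *\<^sub>R x + v *\<^sub>R y \<in> tail_combinations w n"
    unfolding tail_combinations_def using a'(1) b'(1) uv
    by (intro CollectI exI[of _ "\<lambda>k. u * a' k + v * b' k"] exI[of _ ?m]) auto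
qed

text \<open>A single weight function serves both blocks: its parts below \<open>n\<close> and from
  \<open>n\<close> on are normalised separately, and \<open>n\<close> is arbitrary.\<close>

definition james_sequence :: "('v::real_vector \<Rightarrow> real) \<Rightarrow> real \<Rightarrow> (nat \<Rightarrow> 'v) \<Rightarrow> bool" where
  "james_sequence Q \<theta> w \<longleftrightarrow> (\<forall>a n m. (\<forall>k. 0 \<le> a k) \<longrightarrow> sum a {..<n} = 1 \<longrightarrow> sum a {n..<m} = (1::real) \<longrightarrow>
     \<theta> \<le> Q ((\<Sum>k<n. a k *\<^sub>R w k) - (\<Sum>k=n..<m. a k *\<^sub>R w k)))"

text \<open>A convex combination involves finitely many terms, so the split between the blocks can
  be placed behind all of them.\<close>

lemma james_sequence_dist:
  assumes J: "james_sequence Q \<theta> w" and a: "a \<in> tail_combinations w 0"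
  obtains n where "\<And>b. b \<in> tail_combinations w n \<Longrightarrow> \<theta> \<le> Q (a - b)"
proof -
  obtain c n where c: "\<And>k. 0 \<le> c k" "sum c {0..<n} = 1" "a = (\<Sum>k=0..<n. c k *\<^sub>R w k)"
    using a by (blast elim: tail_combinationsE)
  have "\<theta> \<le> Q (a - b)" if b: "b \<in> tail_combinations w n" for b
  proof -
    obtain d m where d: "\<And>k. 0 \<le> d k" "sum d {n..<m} = 1" "b = (\<Sum>k=n..<m. d k *\<^sub>R w k)"
      using b by (blast elim: tail_combinationsE)
    let ?e = "\<lambda>k. if k < n then c k else d k"
    have "(\<Sum>k<n. ?e k *\<^sub>R w k) = a" "(\<Sum>k=n..<m. ?e k *\<^sub>R w k) = b" "sum ?e {..<n} = 1" "sum ?e {n..<m} = 1"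
      using c d by (auto simp: atLeast0LessThan)
    then show ?thesis
      using J[unfolded james_sequence_def, rule_format, of ?e n m] c(1) d(1) by simp
  qed
  then show ?thesis using that by blast
qed

text \<open>If some tail keeps distance \<open>\<theta> / 2\<close> from \<open>x\<close>,
  separation applies. Otherwise every tail has a combination within \<open>\<theta> / 2\<close> of
  \<open>x\<close>, and two of these, the second taken behind the support of the first, are closer
  than \<open>\<theta>\<close>.\<close>

lemma james_sequence_separation:
  assumes Q: "seminorm Q" and J: "james_sequence Q \<theta> w" and \<theta>: "0 < \<theta>"
  obtains f n where "linear f" "\<And>z. \<bar>f z\<bar> \<le> Q z" "\<And>b. b \<in> tail_combinations w n \<Longrightarrow> f b \<le> f x - \<theta> / 2"
proof (cases "\<exists>n. \<forall>b\<in>tail_combinations w n. \<theta> / 2 \<le> Q (x - b)")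
  case True
  then obtain n where n: "\<And>b. b \<in> tail_combinations w n \<Longrightarrow> \<theta> / 2 \<le> Q (x - b)" by blast
  have "convex ((\<lambda>b. x - b) ` tail_combinations w n)"
    using convex_translation[OF convex_negations[OF convex_tail_combinations[of w n]], of x]
    by (simp add: image_image)
  then obtain f where "linear f" "\<And>z. \<bar>f z\<bar> \<le> Q z"
    and f: "\<And>a. a \<in> (\<lambda>b. x - b) ` tail_combinations w n \<Longrightarrow> \<theta> / 2 \<le> f a"
    using n by (elim seminorm_separation[OF Q, where e = "\<theta> / 2"]) auto
  moreover have "f b \<le> f x - \<theta> / 2" if "b \<in> tail_combinations w n" for b
    using f[of "x - b"] that linear_diff[OF \<open>linear f\<close>] by simp
  ultimately show ?thesis using that by blast
next
  case False
  then have ex: "\<exists>b\<in>tail_combinations w n. Q (x - b) < \<theta> / 2" for n by (auto simp: not_le)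
  obtain a where a: "a \<in> tail_combinations w 0" "Q (x - a) < \<theta> / 2" using ex by blast
  obtain n where n: "\<And>b. b \<in> tail_combinations w n \<Longrightarrow> \<theta> \<le> Q (a - b)"
    using james_sequence_dist[OF J a(1)] by blast
  obtain b where b: "b \<in> tail_combinations w n" "Q (x - b) < \<theta> / 2" using ex by blast
  have "Q (a - b) \<le> Q (x - a) + Q (x - b)"
    using seminorm_triangle[OF Q, of a b x] seminorm_diff_commute[OF Q, of a x] by simp
  then show ?thesis using n[OF b(1)] a(2) b(2) by simp
qed

text \<open>A Banach-limit functional \<open>\<phi>\<close>, dominated by the limit superior of
  \<open>f (w k)\<close>, lies in the bidual. If it were evaluation at \<open>x\<close>, the
  functional \<open>f\<close> separating \<open>x\<close> from a tail would give
  \<open>f x = \<phi> f \<le> f x - \<theta> / 2\<close>.\<close>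

lemma james_sequence_imp_not_reflexive:
  assumes Q: "seminorm Q" and J: "james_sequence Q \<theta> w" and \<theta>: "0 < \<theta>" and R: "\<And>k. Q (w k) \<le> R"
  shows "\<not> reflexive_seminorm Q"
proof
  assume refl: "reflexive_seminorm Q"
  let ?D = "bounded_functionals Q"
  obtain P where P: "linear P" "range P = ?D" "\<And>f. f \<in> ?D \<Longrightarrow> P f = f"
    using linear_projection_onto[OF subspace_bounded_functionals] by blast
  have R0: "0 \<le> R" using R[of 0] seminorm_nonneg[OF Q, of "w 0"] by simp
  \<comment> \<open>The infimum of \<open>T f\<close> is the limit superior of
    \<open>f (w k)\<close>. It is under control for bounded functionals only, hence the projection
    \<open>P\<close> in the domination below.\<close>
  define T where "T f = {c. eventually (\<lambda>k. f (w k) \<le> c) sequentially}" for f :: "'a \<Rightarrow> real"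
  have bnd: "\<exists>K\<ge>0. \<forall>k. \<bar>f (w k)\<bar> \<le> K * R" if f: "f \<in> ?D" for f
  proof -
    obtain K where K: "0 \<le> K" "\<And>x. \<bar>f x\<bar> \<le> K * Q x"
      using f by (auto simp: bounded_functionals_def)
    then have "\<bar>f (w k)\<bar> \<le> K * R" for k
      using K(2)[of "w k"] mult_left_mono[OF R[of k] K(1)] by linarith
    then show ?thesis using K(1) by blast
  qed
  have ne: "T f \<noteq> {}" if f: "f \<in> ?D" for f
  proof -
    obtain K where "\<And>k. \<bar>f (w k)\<bar> \<le> K * R" using bnd[OF f] by blast
    then have "K * R \<in> T f" unfolding T_def by (auto simp: abs_le_iff intro!: always_eventually)
    then show ?thesis by blast
  qed
  have bdd: "bdd_below (T f)" if f: "f \<in> ?D" for f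
  proof -
    obtain K where K: "\<And>k. \<bar>f (w k)\<bar> \<le> K * R" using bnd[OF f] by blast
    have "- (K * R) \<le> c" if "c \<in> T f" for c
    proof -
      obtain k where "f (w k) \<le> c"
        using eventually_happens'[OF sequentially_bot] \<open>c \<in> T f\<close> unfolding T_def by blast
      then show ?thesis using K[of k] by (auto simp: abs_le_iff)
    qed
    then show ?thesis by (meson bdd_belowI)
  qed
  define p where "p f = Inf (T f)" for f
  have p_le: "p f \<le> c" if "f \<in> ?D" "c \<in> T f" for f c
    unfolding p_def by (rule cInf_lower[OF that(2) bdd[OF that(1)]])
  have add: "p (f + g) \<le> p f + p g" if f: "f \<in> ?D" and g: "g \<in> ?D" for f g
  proof -
    have *: "p (f + g) \<le> c + d" if "c \<in> T f" "d \<in> T g" for c d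
    proof (rule p_le)
      show "f + g \<in> ?D" using subspace_add[OF subspace_bounded_functionals f g] .
      show "c + d \<in> T (f + g)"
        using that unfolding T_def by (auto elim: eventually_elim2 intro: add_mono)
    qed
    have "p (f + g) - d \<le> p f" if "d \<in> T g" for d
      unfolding p_def[of f] using *[OF _ that] by (intro cInf_greatest[OF ne[OF f]]) (auto simp: algebra_simps)
    then have "p (f + g) - p f \<le> p g"
      unfolding p_def[of g] by (intro cInf_greatest[OF ne[OF g]]) (auto simp: algebra_simps)
    then show ?thesis by simp
  qed
  have scale: "p (c *\<^sub>R f) = c * p f" if f: "f \<in> ?D" and c: "0 < c" for f c
  proof -
    have *: "p (c *\<^sub>R f) \<le> c * p f" if f: "f \<in> ?D" and c: "0 < c" for f c
    proof -
      have "p (c *\<^sub>R f) / c \<le> r" if r: "r \<in> T f" for r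
      proof -
        have "p (c *\<^sub>R f) \<le> c * r"
          using r c by (intro p_le subspace_scale[OF subspace_bounded_functionals f]) (auto simp: T_def)
        then show ?thesis using c by (simp add: field_simps)
      qed
      then have "p (c *\<^sub>R f) / c \<le> p f"
        unfolding p_def[of f] by (intro cInf_greatest[OF ne[OF f]])
      then show ?thesis using c by (simp add: field_simps)
    qed
    have "p ((1 / c) *\<^sub>R (c *\<^sub>R f)) \<le> (1 / c) * p (c *\<^sub>R f)"
      using c by (intro * subspace_scale[OF subspace_bounded_functionals f]) auto
    then have "c * p f \<le> p (c *\<^sub>R f)" using c by (simp add: field_simps)
    with *[OF f c] show ?thesis by simp
  qed
  have PD: "P f \<in> ?D" for f using P(2) by blast
  have "sublinear (\<lambda>f. p (P f))"
    unfolding sublinear_def using add[OF PD PD] scale[OF PD] linear_add[OF P(1)] linear_scale[OF P(1)] by simp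
  then obtain \<phi> where \<phi>: "linear \<phi>" "\<And>f. \<phi> f \<le> p (P f)"
    using ex_linear_le_sublinear by blast
  have "bidual_element Q R \<phi>"
    unfolding bidual_element_def
  proof (intro conjI allI impI \<phi>(1))
    fix f K assume f: "linear f" "0 \<le> K" "\<forall>x. \<bar>f x\<bar> \<le> K * Q x"
    have *: "\<phi> g \<le> R * K" if g: "linear g" "\<And>x. \<bar>g x\<bar> \<le> K * Q x" for g
    proof -
      have gD: "g \<in> ?D" using g f(2) by (intro bounded_functionalsI)
      have "g (w k) \<le> R * K" for k
        using g(2)[of "w k"] mult_left_mono[OF R[of k] f(2)] by (simp add: mult.commute)
      then have "p g \<le> R * K" by (intro p_le gD) (auto simp: T_def)
      then show ?thesis using \<phi>(2)[of g] P(3)[OF gD] by simp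
    qed
    show "\<bar>\<phi> f\<bar> \<le> R * K"
      using *[of f] *[of "(-1) *\<^sub>R f"] f linear_fun_scale[OF f(1), of "-1"] linear_scale[OF \<phi>(1), of "-1" f]
      by (simp del: scaleR_minus1_left scaleR_minus_left add: abs_le_iff)
  qed
  then obtain x where x: "\<And>f. f \<in> ?D \<Longrightarrow> \<phi> f = f x"
    using refl unfolding reflexive_seminorm_def by blast
  obtain f n where f: "linear f" "\<And>z. \<bar>f z\<bar> \<le> Q z" "\<And>b. b \<in> tail_combinations w n \<Longrightarrow> f b \<le> f x - \<theta> / 2"
    using james_sequence_separation[OF Q J \<theta>] by blast
  have fD: "f \<in> ?D" using f(1,2) by (intro bounded_functionalsI[of _ 1]) auto
  have "p f \<le> f x - \<theta> / 2"
    using f(3) mem_tail_combinations[of n] by (intro p_le fD) (auto simp: T_def eventually_sequentially)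
  then show False using \<phi>(2)[of f] P(3)[OF fD] x[OF fD] \<theta> by simp
qed

text \<open>
  Finite-dimensional separation: if no point of a convex set comes close to \<open>t\<close>, a near minimiser of
  the Euclidean distance to \<open>t\<close> provides the separating coefficients.
\<close>

lemma convex_family_separation:
  fixes c :: "'s \<Rightarrow> 'i \<Rightarrow> real"
  assumes I: "finite I" and S: "S \<noteq> {}"
    and conv: "\<And>s s' u. s \<in> S \<Longrightarrow> s' \<in> S \<Longrightarrow> 0 \<le> u \<Longrightarrow> u \<le> 1 \<Longrightarrow>
      \<exists>s''\<in>S. \<forall>i\<in>I. c s'' i = (1 - u) * c s i + u * c s' i"
    and bdd: "\<And>s i. s \<in> S \<Longrightarrow> i \<in> I \<Longrightarrow> \<bar>c s i\<bar> \<le> B"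
    and \<eta>: "0 < \<eta>" and far: "\<And>s. s \<in> S \<Longrightarrow> \<exists>i\<in>I. \<eta> < \<bar>c s i - t i\<bar>"
  obtains \<alpha> e where "0 < e" "\<And>s. s \<in> S \<Longrightarrow> e \<le> (\<Sum>i\<in>I. \<alpha> i * (c s i - t i))"
proof -
  define D where "D s = (\<Sum>i\<in>I. (c s i - t i)\<^sup>2)" for s
  define d where "d = (INF s\<in>S. D s)"
  have "\<eta>\<^sup>2 \<le> D s" if s: "s \<in> S" for s
  proof -
    obtain i where i: "i \<in> I" "\<eta> < \<bar>c s i - t i\<bar>" using far[OF s] by blast
    have "\<eta>\<^sup>2 \<le> (c s i - t i)\<^sup>2" using i(2) \<eta> power_mono[of \<eta> "\<bar>c s i - t i\<bar>" 2] by simp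
    also have "\<dots> \<le> D s" unfolding D_def using I i(1) by (intro member_le_sum) auto
    finally show ?thesis .
  qed
  then have "\<eta>\<^sup>2 \<le> d" unfolding d_def using S by (intro cINF_greatest) auto
  then have d: "0 < d" using \<eta> by (meson less_le_trans zero_less_power)
  have bD: "bdd_below (D ` S)" by (rule bdd_belowI2[of _ 0]) (simp add: D_def sum_nonneg)
  have d_le: "d \<le> D s" if "s \<in> S" for s unfolding d_def using bD that by (rule cINF_lower)
  \<comment> \<open>\<open>R\<close> bounds the squared distance of two points. From
    \<open>s\<close>, which minimises \<open>D\<close> up to \<open>u\<^sup>2\<close>, a move by
    \<open>u\<close> towards \<open>s'\<close> changes \<open>D\<close> by \<open>2 * u * X\<close>
    plus at most \<open>u\<^sup>2 * R\<close>. With \<open>u * (1 + R) \<le> d\<close> this forces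
    \<open>- (d / 2) \<le> X\<close>, which loses only half of \<open>d \<le> D s\<close>.\<close>
  define R where "R = real (card I) * (2 * B)\<^sup>2"
  have R0: "0 \<le> R" by (simp add: R_def)
  define u where "u = min 1 (d / (1 + R))"
  have u: "0 < u" "u \<le> 1" using d R0 by (auto simp: u_def)
  have "u \<le> d / (1 + R)" by (simp add: u_def)
  then have ud: "u * (1 + R) \<le> d" using R0 by (simp add: pos_le_divide_eq)
  have "\<exists>s\<in>S. D s < d + u\<^sup>2"
    using cInf_lessD[of "D ` S" "d + u\<^sup>2"] S u unfolding d_def by auto
  then obtain s where s: "s \<in> S" "D s < d + u\<^sup>2" by blast
  define \<alpha> where "\<alpha> i = c s i - t i" for i
  have "d / 2 \<le> (\<Sum>i\<in>I. \<alpha> i * (c s' i - t i))" if s': "s' \<in> S" for s'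
  proof -
    define X where "X = (\<Sum>i\<in>I. \<alpha> i * (c s' i - c s i))"
    obtain s'' where s'': "s'' \<in> S" "\<And>i. i \<in> I \<Longrightarrow> c s'' i = (1 - u) * c s i + u * c s' i"
      using conv[OF s(1) s', of u] u by auto
    have R_bound: "(\<Sum>i\<in>I. (c s' i - c s i)\<^sup>2) \<le> R"
    proof -
      have "(c s' i - c s i)\<^sup>2 \<le> (2 * B)\<^sup>2" if "i \<in> I" for i
        using bdd[OF s(1) that] bdd[OF s' that] by (intro abs_le_square_iff[THEN iffD1]) auto
      then show ?thesis using sum_bounded_above[of I "\<lambda>i. (c s' i - c s i)\<^sup>2" "(2 * B)\<^sup>2"] by (simp add: R_def)
    qed
    have "d \<le> D s''" using d_le s''(1) .
    also have "D s'' = (\<Sum>i\<in>I. (\<alpha> i)\<^sup>2 + 2 * u * (\<alpha> i * (c s' i - c s i)) + u\<^sup>2 * (c s' i - c s i)\<^sup>2)"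
      unfolding D_def \<alpha>_def by (intro sum.cong refl) (simp add: s''(2), simp add: power2_eq_square algebra_simps)
    also have "\<dots> = D s + 2 * u * X + u\<^sup>2 * (\<Sum>i\<in>I. (c s' i - c s i)\<^sup>2)"
      by (simp add: sum.distrib sum_distrib_left D_def X_def \<alpha>_def)
    also have "\<dots> \<le> d + u\<^sup>2 + 2 * u * X + u\<^sup>2 * R"
      using s(2) R_bound u by (intro add_mono mult_left_mono) auto
    finally have "0 \<le> u * (u * (1 + R) + 2 * X)" by (simp add: power2_eq_square algebra_simps)
    then have "0 \<le> u * (1 + R) + 2 * X" using u by (simp add: zero_le_mult_iff)
    then have "- (d / 2) \<le> X" using ud by linarith
    moreover have "(\<Sum>i\<in>I. \<alpha> i * (c s' i - t i)) = X + D s"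
      unfolding X_def D_def \<alpha>_def sum.distrib[symmetric] by (intro sum.cong) (auto simp: power2_eq_square algebra_simps)
    ultimately show ?thesis using d_le[OF s(1)] by simp
  qed
  then show ?thesis using that[of "d / 2" \<alpha>] d by auto
qed

section \<open>Goldstine and Helly approximation in the bidual\<close>

lemma bidual_elementD:
  assumes "bidual_element Q C \<phi>" "linear f" "\<And>x. \<bar>f x\<bar> \<le> K * Q x" "0 \<le> K"
  shows "\<bar>\<phi> f\<bar> \<le> C * K"
  using assms by (auto simp: bidual_element_def)

lemma linear_bounded_on_ball:
  assumes Q: "seminorm Q" and g: "g \<in> bounded_functionals Q" and C: "0 < C"
    and le: "\<And>x. Q x \<le> C \<Longrightarrow> g x \<le> K"
  shows "\<bar>g x\<bar> \<le> K / C * Q x"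
proof (cases "Q x = 0")
  case True
  then show ?thesis using bounded_functional_null[OF g] by simp
next
  case False
  then have pos: "0 < Q x" using seminorm_nonneg[OF Q, of x] by simp
  have lin: "linear g" using g by (auto simp: bounded_functionals_def)
  have "g ((C / Q x) *\<^sub>R x) \<le> K" "g ((- C / Q x) *\<^sub>R x) \<le> K"
    using pos C by (intro le; simp add: seminorm_scale[OF Q] seminorm_uminus[OF Q])+
  then have "\<bar>C / Q x * g x\<bar> \<le> K"
    by (simp add: linear_scale[OF lin] linear_neg[OF lin] abs_le_iff)
  then show ?thesis using pos C by (simp add: abs_mult field_simps)
qed

text \<open>Otherwise finite-dimensional separation of the values on the ball from the values of
  \<open>\<phi>\<close> gives a combination \<open>g\<close> with
  \<open>g x \<le> \<phi> g - e\<close> on the \<open>C\<close>-ball. The norm of \<open>g\<close>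
  is then too small, because \<open>\<phi> g\<close> is at most \<open>C\<close> times that
  norm.\<close>

lemma goldstine:
  assumes Q: "seminorm Q" and \<phi>: "bidual_element Q C \<phi>" and C: "0 < C"
    and F: "finite F" "F \<subseteq> bounded_functionals Q" and \<eta>: "0 < \<eta>"
  obtains x where "Q x \<le> C" "\<And>f. f \<in> F \<Longrightarrow> \<bar>f x - \<phi> f\<bar> \<le> \<eta>"
proof (rule ccontr)
  note thesisI = that
  assume "\<not> thesis"
  then have far: "\<exists>f\<in>F. \<eta> < \<bar>f x - \<phi> f\<bar>" if "x \<in> {x. Q x \<le> C}" for x
    using that thesisI[of x] \<open>\<not> thesis\<close> by (force simp: not_le)
  have Fb: "\<exists>B. \<forall>x\<in>{x. Q x \<le> C}. \<bar>f x\<bar> \<le> B" if f: "f \<in> F" for f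
  proof -
    obtain K where K: "0 \<le> K" "\<And>x. \<bar>f x\<bar> \<le> K * Q x" using F(2) f by (auto simp: bounded_functionals_def)
    have "\<bar>f x\<bar> \<le> K * C" if "Q x \<le> C" for x
      using K(2)[of x] mult_left_mono[OF that K(1)] by simp
    then show ?thesis by blast
  qed
  then have "\<forall>f\<in>F. \<exists>B. \<forall>x\<in>{x. Q x \<le> C}. \<bar>f x\<bar> \<le> B" by blast
  from bchoice[OF this] obtain b where b: "\<And>f x. f \<in> F \<Longrightarrow> Q x \<le> C \<Longrightarrow> \<bar>f x\<bar> \<le> b f"
    by blast
  have linF: "linear f" if "f \<in> F" for f using F(2) that by (auto simp: bounded_functionals_def)
  obtain \<alpha> e where e: "0 < e" and sep: "\<And>x. x \<in> {x. Q x \<le> C} \<Longrightarrow> e \<le> (\<Sum>f\<in>F. \<alpha> f * (f x - \<phi> f))"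
  proof (rule convex_family_separation[OF F(1), where S = "{x. Q x \<le> C}" and c = "\<lambda>x f. f x" and t = \<phi>
        and \<eta> = \<eta> and B = "\<Sum>f\<in>F. \<bar>b f\<bar>"])
    show "{x. Q x \<le> C} \<noteq> {}" using seminorm_zero[OF Q] C by (auto intro!: exI[of _ 0])
    show "\<exists>z\<in>{x. Q x \<le> C}. \<forall>f\<in>F. f z = (1 - u) * f x + u * f y"
      if "x \<in> {x. Q x \<le> C}" "y \<in> {x. Q x \<le> C}" "0 \<le> u" "u \<le> 1" for x y u
    proof (rule bexI[of _ "(1 - u) *\<^sub>R x + u *\<^sub>R y"])
      show "\<forall>f\<in>F. f ((1 - u) *\<^sub>R x + u *\<^sub>R y) = (1 - u) * f x + u * f y"
        using linF by (simp add: linear_add linear_scale)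
      have "Q ((1 - u) *\<^sub>R x + u *\<^sub>R y) \<le> (1 - u) * Q x + u * Q y"
        using seminorm_add[OF Q, of "(1 - u) *\<^sub>R x" "u *\<^sub>R y"] that by (simp add: seminorm_scale[OF Q])
      also have "\<dots> \<le> (1 - u) * C + u * C" using that by (intro add_mono mult_left_mono) auto
      finally show "(1 - u) *\<^sub>R x + u *\<^sub>R y \<in> {x. Q x \<le> C}" by (simp add: algebra_simps)
    qed
    show "\<bar>f x\<bar> \<le> (\<Sum>f\<in>F. \<bar>b f\<bar>)" if "x \<in> {x. Q x \<le> C}" "f \<in> F" for x f
      using b[OF that(2), of x] that member_le_sum[OF that(2), of "\<lambda>f. \<bar>b f\<bar>"] F(1) by force
  qed (use far \<eta> in auto)
  define g where "g = - (\<Sum>f\<in>F. \<alpha> f *\<^sub>R f)"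
  have g: "g \<in> bounded_functionals Q"
    unfolding g_def using F(2)
    by (intro subspace_neg subspace_sum subspace_scale subspace_bounded_functionals) auto
  have \<phi>l: "linear \<phi>" using \<phi> by (simp add: bidual_element_def)
  have \<phi>g: "\<phi> g = - (\<Sum>f\<in>F. \<alpha> f * \<phi> f)"
    unfolding g_def by (simp add: linear_neg[OF \<phi>l] linear_sum[OF \<phi>l] linear_scale[OF \<phi>l])
  have gl: "g x \<le> \<phi> g - e" if "Q x \<le> C" for x
    using sep[of x] that unfolding \<phi>g by (simp add: g_def algebra_simps sum_subtractf)
  have K: "0 \<le> (\<phi> g - e) / C"
    using gl[of 0] seminorm_zero[OF Q] C g by (auto simp: bounded_functionals_def linear_0)
  have "\<bar>\<phi> g\<bar> \<le> C * ((\<phi> g - e) / C)"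
    using g by (intro bidual_elementD[OF \<phi> _ linear_bounded_on_ball[OF Q g C gl] K]) (auto simp: bounded_functionals_def)
  then show False using C e by simp
qed

text \<open>The unit ball of the dual is mapped to the coordinates \<open>\<phi> f\<close> and
  \<open>f x\<close> for \<open>x\<close> in \<open>X\<close>. If the target \<open>d\<close> and
  zeros could not be approached, separation would produce a vector \<open>z\<close> in the span of
  \<open>X\<close> with \<open>\<bar>\<phi> f - f z\<bar> < d\<close> on the whole ball, against
  \<open>dist\<close>.\<close>

lemma functional_approximation:
  fixes Q :: "'v::real_vector \<Rightarrow> real"
  assumes Q: "seminorm Q" and \<phi>: "bidual_element Q C \<phi>" and d: "0 < d"
    and dist: "\<And>x. \<exists>f. linear f \<and> (\<forall>z. \<bar>f z\<bar> \<le> Q z) \<and> d < \<bar>\<phi> f - f x\<bar>"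
    and X: "finite X" and \<eta>: "0 < \<eta>"
  obtains f where "linear f" "\<And>z. \<bar>f z\<bar> \<le> Q z" "\<bar>\<phi> f - d\<bar> \<le> \<eta>" "\<And>x. x \<in> X \<Longrightarrow> \<bar>f x\<bar> \<le> \<eta>"
proof (rule ccontr)
  note thesisI = that
  assume no: "\<not> thesis"
  let ?S = "{f. linear f \<and> (\<forall>z. \<bar>f z\<bar> \<le> Q z)}"
  \<comment> \<open>\<open>None\<close> indexes the coordinate \<open>\<phi> f\<close>, and
    \<open>Some x\<close> the coordinate \<open>f x\<close>.\<close>
  let ?I = "insert None (Some ` X)"
  let ?c = "\<lambda>f i. case i of None \<Rightarrow> \<phi> f | Some x \<Rightarrow> f x"
  let ?t = "\<lambda>i. case i of None \<Rightarrow> d | Some x \<Rightarrow> 0"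
  have \<phi>l: "linear \<phi>" using \<phi> by (simp add: bidual_element_def)
  have \<phi>C: "\<bar>\<phi> f\<bar> \<le> C" if "f \<in> ?S" for f using bidual_elementD[OF \<phi>, of f 1] that by simp
  have far: "\<exists>i\<in>?I. \<eta> < \<bar>?c f i - ?t i\<bar>" if "f \<in> ?S" for f
  proof (rule ccontr)
    assume "\<not> ?thesis"
    then have "\<bar>\<phi> f - d\<bar> \<le> \<eta>" "\<And>x. x \<in> X \<Longrightarrow> \<bar>f x\<bar> \<le> \<eta>" by (auto simp: not_less)
    then show False using no thesisI[of f] \<open>f \<in> ?S\<close> by blast
  qed
  obtain \<alpha> e where e: "0 < e" and sep: "\<And>f. f \<in> ?S \<Longrightarrow> e \<le> (\<Sum>i\<in>?I. \<alpha> i * (?c f i - ?t i))"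
  proof (rule convex_family_separation[where I = ?I and S = ?S and c = ?c and t = ?t
        and \<eta> = \<eta> and B = "\<bar>C\<bar> + (\<Sum>x\<in>X. Q x)"])
    show "?S \<noteq> {}" using seminorm_nonneg[OF Q] linear_fun_zero by (auto intro!: exI[of _ 0])
    show "\<exists>h\<in>?S. \<forall>i\<in>?I. ?c h i = (1 - u) * ?c f i + u * ?c g i"
      if "f \<in> ?S" "g \<in> ?S" "0 \<le> u" "u \<le> 1" for f g u
    proof (rule bexI[of _ "(1 - u) *\<^sub>R f + u *\<^sub>R g"])
      have "\<bar>(1 - u) * f z + u * g z\<bar> \<le> Q z" for z
      proof -
        have "\<bar>(1 - u) * f z + u * g z\<bar> \<le> (1 - u) * \<bar>f z\<bar> + u * \<bar>g z\<bar>"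
          using abs_triangle_ineq[of "(1 - u) * f z" "u * g z"] that by (simp add: abs_mult)
        also have "\<dots> \<le> (1 - u) * Q z + u * Q z"
          using that by (intro add_mono mult_left_mono) auto
        finally show ?thesis by (simp add: algebra_simps)
      qed
      then show "(1 - u) *\<^sub>R f + u *\<^sub>R g \<in> ?S"
        using that by (auto intro!: linear_fun_add linear_fun_scale)
      show "\<forall>i\<in>?I. ?c ((1 - u) *\<^sub>R f + u *\<^sub>R g) i = (1 - u) * ?c f i + u * ?c g i"
        by (simp add: linear_add[OF \<phi>l] linear_scale[OF \<phi>l])
    qed
    show "\<bar>?c f i\<bar> \<le> \<bar>C\<bar> + (\<Sum>x\<in>X. Q x)" if f: "f \<in> ?S" and "i \<in> ?I" for f i
    proof -
      have "0 \<le> (\<Sum>x\<in>X. Q x)" by (intro sum_nonneg seminorm_nonneg[OF Q])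
      moreover have "\<bar>f x\<bar> \<le> (\<Sum>x\<in>X. Q x)" if "x \<in> X" for x
      proof -
        have "\<bar>f x\<bar> \<le> Q x" using f by simp
        also have "\<dots> \<le> (\<Sum>x\<in>X. Q x)" by (intro member_le_sum[OF that] X seminorm_nonneg[OF Q])
        finally show ?thesis .
      qed
      ultimately show ?thesis using that \<phi>C[OF f] by (auto simp: add_increasing)
    qed
  qed (use far \<eta> X in auto)
  define s where "s f = (\<Sum>x\<in>X. \<alpha> (Some x) * f x)" for f :: "'v \<Rightarrow> real"
  have sep': "e \<le> \<alpha> None * (\<phi> f - d) + s f" if "linear f" "\<And>z. \<bar>f z\<bar> \<le> Q z" for f
    using sep[of f] that X by (simp add: s_def sum.reindex)
  \<comment> \<open>The zero functional is admissible and fixes the sign of the coefficient of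
    \<open>\<phi>\<close>, by which the inequality can then be divided.\<close>
  have "e \<le> \<alpha> None * (- d)"
    using sep'[OF linear_fun_zero] seminorm_nonneg[OF Q] linear_0[OF \<phi>l] by (simp add: s_def)
  then have "0 < (- \<alpha> None) * d" using e by simp
  then have neg: "0 < - \<alpha> None" using d by (rule zero_less_mult_pos2)
  define z where "z = (1 / (- \<alpha> None)) *\<^sub>R (\<Sum>x\<in>X. \<alpha> (Some x) *\<^sub>R x)"
  have fz: "f z = s f / (- \<alpha> None)" if "linear f" for f
    unfolding z_def s_def by (simp add: linear_neg[OF that] linear_scale[OF that] linear_sum[OF that])
  have le: "\<phi> f - f z < d" if f: "linear f" "\<And>z. \<bar>f z\<bar> \<le> Q z" for f
  proof -
    have "s f = (- \<alpha> None) * f z" using fz[OF f(1)] neg by simp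
    then have "0 < (- \<alpha> None) * (d - (\<phi> f - f z))"
      using sep'[OF f] e by (simp add: algebra_simps)
    then have "0 < d - (\<phi> f - f z)" using neg by (rule zero_less_mult_pos)
    then show ?thesis by simp
  qed
  have "\<bar>\<phi> f - f z\<bar> < d" if f: "linear f" "\<And>z. \<bar>f z\<bar> \<le> Q z" for f
    using le[OF f] le[of "(-1) *\<^sub>R f"] f linear_fun_scale[OF f(1), of "-1"] linear_scale[OF \<phi>l, of "-1" f]
    by (simp del: scaleR_minus1_left scaleR_minus_left add: abs_less_iff)
  then show False using dist[of z] by force
qed

section \<open>James sequences in complete nonreflexive spaces\<close>

definition complete_seminorm :: "('v::real_vector \<Rightarrow> real) \<Rightarrow> bool" where
  "complete_seminorm Q \<longleftrightarrow> (\<forall>u::nat \<Rightarrow> 'v. (\<forall>e>0. \<exists>N. \<forall>m\<ge>N. \<forall>n\<ge>N. Q (u m - u n) < e) \<longrightarrow>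
     (\<exists>x. (\<lambda>n. Q (u n - x)) \<longlonglongrightarrow> 0))"

text \<open>The canonical image of a complete space is closed in the bidual: points approximating
  \<open>\<phi>\<close> form a Cauchy sequence, whose limit would represent
  \<open>\<phi>\<close>.\<close>

lemma bidual_element_far_from_points:
  fixes Q :: "'v::real_vector \<Rightarrow> real"
  assumes Q: "seminorm Q" and compl: "complete_seminorm Q" and \<phi>: "bidual_element Q C \<phi>"
    and no: "\<And>x. \<exists>f\<in>bounded_functionals Q. \<phi> f \<noteq> f x"
  obtains d where "0 < d" "\<And>x. \<exists>f. linear f \<and> (\<forall>z. \<bar>f z\<bar> \<le> Q z) \<and> d < \<bar>\<phi> f - f x\<bar>"
proof (rule ccontr)
  note thesisI = that
  assume no_thesis: "\<not> thesis"
  have "\<exists>x. \<forall>f. linear f \<longrightarrow> (\<forall>z. \<bar>f z\<bar> \<le> Q z) \<longrightarrow> \<bar>\<phi> f - f x\<bar> \<le> d" if d: "0 < d" for d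
  proof (rule ccontr)
    assume "\<not> ?thesis"
    then have "\<exists>f. linear f \<and> (\<forall>z. \<bar>f z\<bar> \<le> Q z) \<and> d < \<bar>\<phi> f - f x\<bar>" for x by (auto simp: not_le)
    then show False using no_thesis thesisI[OF d] by blast
  qed
  then have "\<forall>n. \<exists>x. \<forall>f. linear f \<longrightarrow> (\<forall>z. \<bar>f z\<bar> \<le> Q z) \<longrightarrow> \<bar>\<phi> f - f x\<bar> \<le> inverse (real (Suc n))"
    by simp
  from choice[OF this] obtain u where
    u: "\<And>n f. linear f \<Longrightarrow> (\<And>z. \<bar>f z\<bar> \<le> Q z) \<Longrightarrow> \<bar>\<phi> f - f (u n)\<bar> \<le> inverse (real (Suc n))"
    by blast
  have uu: "Q (u m - u n) \<le> inverse (real (Suc m)) + inverse (real (Suc n))" for m n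
  proof -
    obtain f where f: "linear f" "\<And>z. \<bar>f z\<bar> \<le> Q z" "Q (u m - u n) \<le> f (u m - u n)"
      using seminorm_separation[OF Q convex_singleton[of "u m - u n"], of "Q (u m - u n)"]
      by (metis order_refl singletonD singletonI)
    then show ?thesis
      using u[OF f(1,2), of m] u[OF f(1,2), of n] by (simp add: linear_diff[OF f(1)] abs_le_iff)
  qed
  have "\<exists>N. \<forall>m\<ge>N. \<forall>n\<ge>N. Q (u m - u n) < e" if e: "0 < e" for e
  proof -
    obtain N where N: "inverse (real (Suc N)) < e / 2" using reals_Archimedean[OF half_gt_zero[OF e]] by blast
    have "Q (u m - u n) < e" if "N \<le> m" "N \<le> n" for m n
    proof -
      have "inverse (real (Suc m)) \<le> inverse (real (Suc N))" "inverse (real (Suc n)) \<le> inverse (real (Suc N))"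
        using that by (auto intro!: le_imp_inverse_le)
      then show ?thesis using uu[of m n] N by linarith
    qed
    then show ?thesis by blast
  qed
  then obtain x where x: "(\<lambda>n. Q (u n - x)) \<longlonglongrightarrow> 0"
    using compl unfolding complete_seminorm_def by blast
  have \<phi>l: "linear \<phi>" using \<phi> by (simp add: bidual_element_def)
  have ball: "\<phi> f = f x" if f: "linear f" "\<And>z. \<bar>f z\<bar> \<le> Q z" for f
  proof -
    have "\<bar>\<phi> f - f x\<bar> \<le> inverse (real (Suc n)) + Q (u n - x)" for n
      using u[OF f, of n] f(2)[of "u n - x"] by (simp add: linear_diff[OF f(1)])
    moreover have "(\<lambda>n. inverse (real (Suc n)) + Q (u n - x)) \<longlonglongrightarrow> 0 + 0"
      by (intro tendsto_add LIMSEQ_inverse_real_of_nat x)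
    ultimately have "\<bar>\<phi> f - f x\<bar> \<le> 0"
      by (intro LIMSEQ_le_const) auto
    then show ?thesis by simp
  qed
  have "\<phi> f = f x" if fD: "f \<in> bounded_functionals Q" for f
  proof -
    obtain K where f: "linear f" and K: "0 \<le> K" "\<And>x. \<bar>f x\<bar> \<le> K * Q x"
      using fD by (auto simp: bounded_functionals_def)
    \<comment> \<open>\<open>K + 1\<close> rather than \<open>K\<close> allows for
      \<open>K = 0\<close>.\<close>
    let ?c = "1 / (K + 1)"
    have "\<bar>(?c *\<^sub>R f) z\<bar> \<le> Q z" for z
    proof -
      have "\<bar>f z\<bar> \<le> (K + 1) * Q z" using K(2)[of z] seminorm_nonneg[OF Q, of z] by (simp add: algebra_simps)
      then show ?thesis using K(1) by (simp add: field_simps abs_mult)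
    qed
    then have "\<phi> (?c *\<^sub>R f) = (?c *\<^sub>R f) x" using f by (intro ball linear_fun_scale)
    then show ?thesis using K(1) by (simp add: linear_scale[OF \<phi>l])
  qed
  then show False using no[of x] by blast
qed

text \<open>Functionals \<open>h n\<close> and vectors \<open>w n\<close> are built alternately:
  \<open>h n\<close> nearly vanishes on the earlier vectors and has \<open>\<phi> (h n)\<close> near
  \<open>d\<close>, and \<open>w n\<close> imitates \<open>\<phi>\<close> on
  \<open>h 0, ..., h n\<close>. So \<open>h n (w k)\<close> is near 0 for \<open>k < n\<close> and
  near \<open>d\<close> for \<open>k \<ge> n\<close>, and \<open>h n\<close> alone separates the two
  blocks split at \<open>n\<close>.\<close>

theorem not_reflexive_imp_james_sequence:
  fixes Q :: "'v::real_vector \<Rightarrow> real"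
  assumes Q: "seminorm Q" and compl: "complete_seminorm Q" and nr: "\<not> reflexive_seminorm Q"
  obtains w \<theta> C where "0 < \<theta>" "james_sequence Q \<theta> w" "\<And>k. Q (w k) \<le> C"
proof -
  obtain \<phi> C0 where \<phi>0: "bidual_element Q C0 \<phi>" and no: "\<And>x. \<exists>f\<in>bounded_functionals Q. \<phi> f \<noteq> f x"
    using nr unfolding reflexive_seminorm_def by blast
  define C where "C = max 1 C0"
  have C: "0 < C" by (simp add: C_def)
  have \<phi>: "bidual_element Q C \<phi>"
    unfolding bidual_element_def
  proof (intro conjI allI impI)
    show "linear \<phi>" using \<phi>0 by (simp add: bidual_element_def)
    fix f K assume f: "linear f" "0 \<le> K" "\<forall>x. \<bar>f x\<bar> \<le> K * Q x"
    then have "\<bar>\<phi> f\<bar> \<le> C0 * K" by (intro bidual_elementD[OF \<phi>0]) auto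
    also have "\<dots> \<le> C * K" using f(2) by (intro mult_right_mono) (auto simp: C_def)
    finally show "\<bar>\<phi> f\<bar> \<le> C * K" .
  qed
  obtain d where d: "0 < d" and far: "\<And>x. \<exists>f. linear f \<and> (\<forall>z. \<bar>f z\<bar> \<le> Q z) \<and> d < \<bar>\<phi> f - f x\<bar>"
    using bidual_element_far_from_points[OF Q compl \<phi> no] by blast
  \<comment> \<open>The head loses \<open>\<eta>\<close> and the tail \<open>2 * \<eta>\<close>, so
    a gap of \<open>d - 3 * \<eta> = d / 2\<close> remains.\<close>
  define \<eta> where "\<eta> = d / 6"
  have \<eta>: "0 < \<eta>" using d by (simp add: \<eta>_def)
  define P where "P g n r \<longleftrightarrow> linear (fst r) \<and> (\<forall>z. \<bar>fst r z\<bar> \<le> Q z) \<and> \<bar>\<phi> (fst r) - d\<bar> \<le> \<eta> \<and>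
      (\<forall>k<n. \<bar>fst r (snd (g k))\<bar> \<le> \<eta>) \<and> Q (snd r) \<le> C \<and> \<bar>fst r (snd r) - \<phi> (fst r)\<bar> \<le> \<eta> \<and>
      (\<forall>k<n. \<bar>fst (g k) (snd r) - \<phi> (fst (g k))\<bar> \<le> \<eta>)"
    for g :: "nat \<Rightarrow> ('v \<Rightarrow> real) \<times> 'v" and n :: nat and r
  have "\<exists>g. \<forall>n. P g n (g n)"
  proof (rule dependent_wellorder_choice)
    fix r :: "('v \<Rightarrow> real) \<times> 'v" and g h :: "nat \<Rightarrow> ('v \<Rightarrow> real) \<times> 'v" and n :: nat
    assume "\<And>k. k < n \<Longrightarrow> g k = h k"
    then show "P g n r = P h n r" by (simp add: P_def)
  next
    fix n :: nat and g :: "nat \<Rightarrow> ('v \<Rightarrow> real) \<times> 'v"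
    assume IH: "\<And>k. k < n \<Longrightarrow> P g k (g k)"
    obtain f where f: "linear f" "\<And>z. \<bar>f z\<bar> \<le> Q z" "\<bar>\<phi> f - d\<bar> \<le> \<eta>" "\<And>x. x \<in> (snd \<circ> g) ` {..<n} \<Longrightarrow> \<bar>f x\<bar> \<le> \<eta>"
      using functional_approximation[OF Q \<phi> d far, of "(snd \<circ> g) ` {..<n}" \<eta>] \<eta> by blast
    have "insert f ((fst \<circ> g) ` {..<n}) \<subseteq> bounded_functionals Q"
      using f(1,2) IH by (auto simp: P_def intro!: bounded_functionalsI[of _ 1])
    then obtain x where "Q x \<le> C" "\<And>h. h \<in> insert f ((fst \<circ> g) ` {..<n}) \<Longrightarrow> \<bar>h x - \<phi> h\<bar> \<le> \<eta>"
      using goldstine[OF Q \<phi> C, of "insert f ((fst \<circ> g) ` {..<n})" \<eta>] \<eta> by blast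
    then have "P g n (f, x)" using f by (auto simp: P_def)
    then show "\<exists>r. P g n r" by blast
  qed
  then obtain g where g: "\<And>n. P g n (g n)" by blast
  define w where "w n = snd (g n)" for n
  define h where "h n = fst (g n)" for n
  have h: "linear (h n)" "\<And>z. \<bar>h n z\<bar> \<le> Q z" "\<bar>\<phi> (h n) - d\<bar> \<le> \<eta>" for n
    using g[of n] by (auto simp: P_def h_def)
  have small: "\<bar>h n (w k)\<bar> \<le> \<eta>" if "k < n" for n k using g[of n] that by (auto simp: P_def h_def w_def)
  have large: "d - 2 * \<eta> \<le> h n (w k)" if "n \<le> k" for n k
  proof -
    have "\<bar>h n (w k) - \<phi> (h n)\<bar> \<le> \<eta>"
      using g[of k] that by (cases "n = k") (auto simp: P_def h_def w_def)
    then show ?thesis using h(3)[of n] by (auto simp: abs_le_iff)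
  qed
  have "james_sequence Q (d / 2) w"
    unfolding james_sequence_def
  proof (intro allI impI)
    fix a :: "nat \<Rightarrow> real" and n m
    assume a: "\<forall>k. 0 \<le> a k" "sum a {..<n} = 1" "sum a {n..<m} = 1"
    let ?x = "\<Sum>k<n. a k *\<^sub>R w k" and ?y = "\<Sum>k=n..<m. a k *\<^sub>R w k"
    have "h n ?x = (\<Sum>k<n. a k * h n (w k))"
      by (simp add: linear_sum[OF h(1)] linear_scale[OF h(1)])
    also have "\<dots> \<le> (\<Sum>k<n. a k * \<eta>)"
      using a small by (intro sum_mono mult_left_mono) (auto simp: abs_le_iff)
    finally have 1: "h n ?x \<le> \<eta>" using a by (simp add: sum_distrib_right[symmetric])
    have "(\<Sum>k=n..<m. a k * (d - 2 * \<eta>)) \<le> (\<Sum>k=n..<m. a k * h n (w k))"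
      using a large by (intro sum_mono mult_left_mono) auto
    also have "\<dots> = h n ?y"
      by (simp add: linear_sum[OF h(1)] linear_scale[OF h(1)])
    finally have 2: "d - 2 * \<eta> \<le> h n ?y" using a by (simp only: sum_distrib_right[symmetric] mult_1_left)
    have "d / 2 \<le> h n ?y - h n ?x" using 1 2 by (simp add: \<eta>_def)
    also have "\<dots> = - h n (?x - ?y)" by (simp add: linear_diff[OF h(1)])
    also have "\<dots> \<le> Q (?x - ?y)" using h(2)[of n "?x - ?y"] by (simp add: abs_le_iff)
    finally show "d / 2 \<le> Q (?x - ?y)" .
  qed
  moreover have "Q (w k) \<le> C" for k using g[of k] by (auto simp: P_def w_def)
  ultimately show ?thesis using that[of "d / 2" w C] d by simp
qed

section \<open>The dual norm and weak limits in reflexive spaces\<close>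

definition dual_seminorm :: "('v::real_vector \<Rightarrow> real) \<Rightarrow> ('v \<Rightarrow> real) \<Rightarrow> real" where
  "dual_seminorm Q f = (SUP x\<in>{x. Q x \<le> 1}. \<bar>f x\<bar>)"

context
  fixes Q :: "'v::real_vector \<Rightarrow> real"
  assumes Q: "seminorm Q"
begin

lemma dual_seminorm_le:
  assumes "\<And>x. \<bar>f x\<bar> \<le> K * Q x" "0 \<le> K" shows "dual_seminorm Q f \<le> K"
  unfolding dual_seminorm_def
proof (rule cSUP_least)
  show "{x. Q x \<le> 1} \<noteq> {}" using seminorm_zero[OF Q] by (auto intro!: exI[of _ 0])
  fix x assume "x \<in> {x. Q x \<le> 1}"
  then show "\<bar>f x\<bar> \<le> K" using assms(1)[of x] mult_left_mono[of "Q x" 1 K] assms(2) by simp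
qed

lemma bounded_functional_bdd_above:
  assumes f: "f \<in> bounded_functionals Q" shows "bdd_above ((\<lambda>x. \<bar>f x\<bar>) ` {x. Q x \<le> 1})"
proof -
  obtain K where K: "0 \<le> K" "\<And>x. \<bar>f x\<bar> \<le> K * Q x" using f by (auto simp: bounded_functionals_def)
  have "\<bar>f x\<bar> \<le> K" if "Q x \<le> 1" for x
    using K(2)[of x] mult_left_mono[OF that K(1)] by simp
  then show ?thesis by (intro bdd_aboveI2[of _ _ K]) simp
qed

lemma dual_seminorm_bound:
  assumes f: "f \<in> bounded_functionals Q" shows "\<bar>f x\<bar> \<le> dual_seminorm Q f * Q x"
proof -
  have "f x \<le> dual_seminorm Q f" if "Q x \<le> 1" for x
  proof -
    have "f x \<le> \<bar>f x\<bar>" by simp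
    also have "\<dots> \<le> dual_seminorm Q f"
      unfolding dual_seminorm_def using that by (intro cSUP_upper bounded_functional_bdd_above f) simp
    finally show ?thesis .
  qed
  from linear_bounded_on_ball[OF Q f zero_less_one this, of x] show ?thesis by simp
qed

lemma dual_seminorm_nonneg:
  assumes f: "f \<in> bounded_functionals Q" shows "0 \<le> dual_seminorm Q f"
proof -
  have "\<bar>f 0\<bar> \<le> dual_seminorm Q f"
    unfolding dual_seminorm_def using seminorm_zero[OF Q]
    by (intro cSUP_upper bounded_functional_bdd_above f) simp
  then show ?thesis by simp
qed

lemma dual_seminorm_add:
  assumes f: "f \<in> bounded_functionals Q" and g: "g \<in> bounded_functionals Q"
  shows "dual_seminorm Q (f + g) \<le> dual_seminorm Q f + dual_seminorm Q g"
  using dual_seminorm_nonneg[OF f] dual_seminorm_nonneg[OF g]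
  by (intro dual_seminorm_le bounded_functional_bound_add dual_seminorm_bound f g) auto

lemma dual_seminorm_scale:
  assumes f: "f \<in> bounded_functionals Q"
  shows "dual_seminorm Q (c *\<^sub>R f) = \<bar>c\<bar> * dual_seminorm Q f"
proof (rule antisym)
  have le: "dual_seminorm Q (c *\<^sub>R f) \<le> \<bar>c\<bar> * dual_seminorm Q f" if f: "f \<in> bounded_functionals Q" for c f
  proof (rule dual_seminorm_le)
    show "\<bar>(c *\<^sub>R f) x\<bar> \<le> \<bar>c\<bar> * dual_seminorm Q f * Q x" for x
      using mult_left_mono[OF dual_seminorm_bound[OF f, of x], of "\<bar>c\<bar>"] by (simp add: abs_mult mult.assoc)
    show "0 \<le> \<bar>c\<bar> * dual_seminorm Q f" using dual_seminorm_nonneg[OF f] by simp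
  qed
  then show "dual_seminorm Q (c *\<^sub>R f) \<le> \<bar>c\<bar> * dual_seminorm Q f" using f .
  have cf: "c *\<^sub>R f \<in> bounded_functionals Q"
    using f by (rule subspace_scale[OF subspace_bounded_functionals])
  show "\<bar>c\<bar> * dual_seminorm Q f \<le> dual_seminorm Q (c *\<^sub>R f)"
  proof (cases "c = 0")
    case True
    then show ?thesis using dual_seminorm_nonneg[OF cf] by simp
  next
    case False
    then show ?thesis using le[OF cf, of "1 / c"] by (simp add: field_simps)
  qed
qed

text \<open>The functionals along which the bounded sequence \<open>z\<close> converges form a
  closed subspace \<open>D0\<close> containing every \<open>g k\<close>. If \<open>D0\<close> were
  proper, Hahn-Banach in the dual would give a nonzero bidual element vanishing on
  \<open>D0\<close>; by reflexivity it is evaluation at a point killed by all \<open>g k\<close>,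
  hence of seminorm 0. The limits along all functionals then define a bidual element, and the point
  representing it is the weak limit.\<close>

lemma reflexive_seminorm_weak_limit:
  fixes z :: "nat \<Rightarrow> 'v" and g :: "nat \<Rightarrow> 'v \<Rightarrow> real"
  assumes refl: "reflexive_seminorm Q" and R: "\<And>n. Q (z n) \<le> R"
    and g: "\<And>k. g k \<in> bounded_functionals Q" and sep: "\<And>x. (\<And>k. g k x = 0) \<Longrightarrow> Q x = 0"
    and conv: "\<And>k. convergent (\<lambda>n. g k (z n))"
  obtains x where "\<And>f. f \<in> bounded_functionals Q \<Longrightarrow> (\<lambda>n. f (z n)) \<longlonglongrightarrow> f x"
proof -
  let ?D = "bounded_functionals Q" and ?N = "dual_seminorm Q"
  obtain P where P: "linear P" "range P = ?D" "\<And>f. f \<in> ?D \<Longrightarrow> P f = f"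
    using linear_projection_onto[OF subspace_bounded_functionals] by blast
  have PD: "P f \<in> ?D" for f using P(2) by blast
  define D0 where "D0 = {f \<in> ?D. convergent (\<lambda>n. f (z n))}"
  have D0: "subspace D0"
  proof (rule subspaceI)
    show "0 \<in> D0" using subspace_0[OF subspace_bounded_functionals, of Q] by (simp add: D0_def convergent_const)
    show "f + g \<in> D0" if "f \<in> D0" "g \<in> D0" for f g
      using that subspace_add[OF subspace_bounded_functionals, of f Q g] by (simp add: D0_def convergent_add)
    show "c *\<^sub>R f \<in> D0" if "f \<in> D0" for c f
      using that subspace_scale[OF subspace_bounded_functionals, of f Q c]
      by (simp add: D0_def convergent_mult convergent_const)
  qed
  have R0: "0 \<le> R" using R[of 0] seminorm_nonneg[OF Q, of "z 0"] by simp
  have "f0 \<in> D0" if f0: "f0 \<in> ?D" for f0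
  proof (rule ccontr)
    assume f0n: "f0 \<notin> D0"
    \<comment> \<open>Closedness of \<open>D0\<close>: a functional approximated by members of
      \<open>D0\<close> is Cauchy along the bounded sequence \<open>z\<close>.\<close>
    have "\<exists>\<delta>>0. \<forall>g\<in>D0. \<delta> \<le> ?N (f0 - g)"
    proof (rule ccontr)
      assume "\<not> ?thesis"
      then have close: "\<exists>g\<in>D0. ?N (f0 - g) < \<delta>" if "0 < \<delta>" for \<delta> using that by (auto simp: not_le)
      have "Cauchy (\<lambda>n. f0 (z n))"
      proof (rule metric_CauchyI)
        fix e :: real assume e: "0 < e"
        obtain h where h: "h \<in> D0" "?N (f0 - h) < e / (4 * (R + 1))" using close[of "e / (4 * (R + 1))"] e R0 by auto
        have hD: "h \<in> ?D" using h by (simp add: D0_def)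
        have fh: "f0 - h \<in> ?D" using f0 hD by (rule subspace_diff[OF subspace_bounded_functionals])
        have near: "\<bar>f0 (z n) - h (z n)\<bar> \<le> e / 4" for n
        proof -
          have "\<bar>f0 (z n) - h (z n)\<bar> \<le> ?N (f0 - h) * Q (z n)" using dual_seminorm_bound[OF fh, of "z n"] by simp
          also have "\<dots> \<le> e / (4 * (R + 1)) * (R + 1)"
            using h(2) R[of n] seminorm_nonneg[OF Q] dual_seminorm_nonneg[OF fh] R0 e by (intro mult_mono) auto
          also have "\<dots> = e / 4"
          proof -
            have "R + 1 \<noteq> 0" using R0 by simp
            then show ?thesis by (metis divide_divide_eq_left mult.commute nonzero_eq_divide_eq)
          qed
          finally show ?thesis .
        qed
        have "Cauchy (\<lambda>n. h (z n))" using h by (auto simp: D0_def intro: convergent_Cauchy)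
        then obtain M where M: "\<And>m n. M \<le> m \<Longrightarrow> M \<le> n \<Longrightarrow> dist (h (z m)) (h (z n)) < e / 2"
          using metric_CauchyD[of "\<lambda>n. h (z n)", OF _ half_gt_zero[OF e]] by blast
        have "dist (f0 (z m)) (f0 (z n)) < e" if "M \<le> m" "M \<le> n" for m n
          using M[OF that] near[of m] near[of n] unfolding dist_real_def by linarith
        then show "\<exists>M. \<forall>m\<ge>M. \<forall>n\<ge>M. dist (f0 (z m)) (f0 (z n)) < e" by blast
      qed
      then show False using f0 f0n by (simp add: D0_def Cauchy_convergent_iff)
    qed
    then obtain \<delta> where \<delta>: "0 < \<delta>" "\<And>g. g \<in> D0 \<Longrightarrow> \<delta> \<le> ?N (f0 - g)" by blast
    have NP: "seminorm (\<lambda>f. ?N (P f))"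
      by (simp add: seminorm_def linear_add[OF P(1)] linear_scale[OF P(1)] dual_seminorm_add[OF PD PD] dual_seminorm_scale[OF PD])
    have "convex ((\<lambda>g. f0 - g) ` D0)"
      using convex_translation[OF convex_negations[OF subspace_imp_convex[OF D0]], of f0] by (simp add: image_image)
    moreover have "\<delta> \<le> ?N (P a)" if a: "a \<in> (\<lambda>g. f0 - g) ` D0" for a
    proof -
      obtain g where "g \<in> D0" "a = f0 - g" using a by blast
      then show ?thesis
        using \<delta>(2) P(3)[OF subspace_diff[OF subspace_bounded_functionals f0, of g]] by (simp add: D0_def)
    qed
    ultimately obtain \<psi> where \<psi>: "linear \<psi>" "\<And>f. \<bar>\<psi> f\<bar> \<le> ?N (P f)"
      and sep\<psi>: "\<And>a. a \<in> (\<lambda>g. f0 - g) ` D0 \<Longrightarrow> \<delta> \<le> \<psi> a"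
      using seminorm_separation[OF NP, of "(\<lambda>g. f0 - g) ` D0" \<delta>] by blast
    \<comment> \<open>A functional bounded below by \<open>\<delta> > 0\<close> on a translate of a
      subspace vanishes on the subspace, since otherwise a multiple of \<open>h\<close> brings its
      value to 0.\<close>
    have \<psi>0: "\<psi> h = 0" if h: "h \<in> D0" for h
    proof (rule ccontr)
      assume nz: "\<psi> h \<noteq> 0"
      have "(\<psi> f0 / \<psi> h) *\<^sub>R h \<in> D0" using h by (rule subspace_scale[OF D0])
      then have "\<delta> \<le> \<psi> (f0 - (\<psi> f0 / \<psi> h) *\<^sub>R h)" by (intro sep\<psi>) blast
      then show False using \<delta>(1) nz by (simp add: linear_diff[OF \<psi>(1)] linear_scale[OF \<psi>(1)])
    qed
    have "f0 - 0 \<in> (\<lambda>g. f0 - g) ` D0" using subspace_0[OF D0] by (rule imageI)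
    then have \<psi>f0: "\<delta> \<le> \<psi> f0" using sep\<psi>[of f0] by simp
    have "bidual_element Q 1 \<psi>"
      unfolding bidual_element_def
    proof (intro conjI allI impI \<psi>(1))
      fix f K assume f: "linear f" "0 \<le> K" "\<forall>x. \<bar>f x\<bar> \<le> K * Q x"
      then have "f \<in> ?D" by (intro bounded_functionalsI) auto
      then show "\<bar>\<psi> f\<bar> \<le> 1 * K" using \<psi>(2)[of f] P(3)[of f] dual_seminorm_le[of f K] f by simp
    qed
    then obtain x where x: "\<And>f. f \<in> ?D \<Longrightarrow> \<psi> f = f x"
      using refl unfolding reflexive_seminorm_def by blast
    have "g k \<in> D0" for k using g conv by (simp add: D0_def)
    then have "Q x = 0" using sep[of x] x[OF g] \<psi>0 by simp
    then have "f0 x = 0" by (rule bounded_functional_null[OF f0])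
    then show False using x[OF f0] \<psi>f0 \<delta>(1) by simp
  qed
  then have conv_all: "convergent (\<lambda>n. f (z n))" if "f \<in> ?D" for f using that by (auto simp: D0_def)
  define \<phi> where "\<phi> f = lim (\<lambda>n. P f (z n))" for f
  have lim: "(\<lambda>n. P f (z n)) \<longlonglongrightarrow> \<phi> f" for f
    unfolding \<phi>_def using conv_all[OF PD] by (simp add: convergent_LIMSEQ_iff)
  have "bidual_element Q R \<phi>"
    unfolding bidual_element_def
  proof (intro conjI allI impI linearI)
    show "\<phi> (f + h) = \<phi> f + \<phi> h" for f h
      using lim[of "f + h"] tendsto_add[OF lim[of f] lim[of h]]
      by (intro LIMSEQ_unique) (simp_all add: linear_add[OF P(1)])
    show "\<phi> (c *\<^sub>R f) = c *\<^sub>R \<phi> f" for c f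
      using lim[of "c *\<^sub>R f"] tendsto_scaleR[OF tendsto_const lim[of f], of c]
      by (intro LIMSEQ_unique) (simp_all add: linear_scale[OF P(1)])
    fix f K assume f: "linear f" "0 \<le> K" "\<forall>x. \<bar>f x\<bar> \<le> K * Q x"
    then have "f \<in> ?D" by (intro bounded_functionalsI) auto
    then have "P f = f" by (rule P(3))
    moreover have "\<bar>f (z n)\<bar> \<le> R * K" for n
      using f(3)[rule_format, of "z n"] mult_left_mono[OF R[of n] f(2)] by (simp add: mult.commute)
    ultimately show "\<bar>\<phi> f\<bar> \<le> R * K"
      using tendsto_rabs[OF lim[of f]] by (intro LIMSEQ_le_const2) auto
  qed
  then obtain x where "\<And>f. f \<in> ?D \<Longrightarrow> \<phi> f = f x"
    using refl unfolding reflexive_seminorm_def by blast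
  then have "(\<lambda>n. f (z n)) \<longlonglongrightarrow> f x" if "f \<in> ?D" for f using lim[of f] P(3)[OF that] that by simp
  then show ?thesis using that by blast
qed

text \<open>\<open>T\<close> need not be injective: two vectors with the same image differ by a
  vector of seminorm 0, which bounded functionals ignore. Composition with \<open>T\<close> is
  therefore a bijection between the two duals, with inverse \<open>\<Psi>\<close>, and carries one
  form of reflexivity to the other.\<close>

lemma reflexive_iff_reflexive_seminorm:
  fixes V :: "'c normed_space" and T :: "'v \<Rightarrow> 'c"
  assumes T: "range T = points V" and add: "\<And>x y. nadd V (T x) (T y) = T (x + y)"
    and scale: "\<And>c x. nscale V c (T x) = T (c *\<^sub>R x)" and norm: "\<And>x. nnorm V (T x) = Q x"
  shows "reflexive V \<longleftrightarrow> reflexive_seminorm Q"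
proof -
  let ?D = "bounded_functionals Q" and ?cf = "continuous_functionals V"
  have ball: "(\<forall>X\<in>points V. S X) \<longleftrightarrow> (\<forall>x. S (T x))" for S unfolding T[symmetric] by blast
  have cf_iff: "f \<in> ?cf \<longleftrightarrow> f \<in> extensional (points V) \<and> f \<circ> T \<in> ?D" for f
  proof -
    have "(\<exists>C. \<forall>x. \<bar>f (T x)\<bar> \<le> C * Q x) \<longleftrightarrow> (\<exists>C\<ge>0. \<forall>x. \<bar>f (T x)\<bar> \<le> C * Q x)" (is "?L \<longleftrightarrow> _")
    proof
      assume ?L
      then obtain C where C: "\<And>x. \<bar>f (T x)\<bar> \<le> C * Q x" by blast
      have "\<bar>f (T x)\<bar> \<le> \<bar>C\<bar> * Q x" for x
        using C[of x] mult_right_mono[OF abs_ge_self seminorm_nonneg[OF Q], of C x] by linarith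
      then show "\<exists>C\<ge>0. \<forall>x. \<bar>f (T x)\<bar> \<le> C * Q x" by (intro exI[of _ "\<bar>C\<bar>"]) auto
    qed blast
    then show ?thesis
      unfolding continuous_functionals_def bounded_functionals_def ball add scale norm linear_iff
      by (auto simp: o_def)
  qed
  define \<Psi> where "\<Psi> g = restrict (\<lambda>X. g (inv T X)) (points V)" for g :: "'v \<Rightarrow> real"
  have \<Psi>T: "\<Psi> g (T x) = g x" if g: "g \<in> ?D" for g x
  proof -
    have lin: "linear g" using g by (auto simp: bounded_functionals_def)
    have "T (inv T (T x)) = T x" by (simp add: f_inv_into_f)
    then have "T (inv T (T x) - x) = T 0"
      using add[of "inv T (T x)" "(-1) *\<^sub>R x"] add[of x "(-1) *\<^sub>R x"] scale[of "-1" x] by simp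
    then have "Q (inv T (T x) - x) = 0"
      using norm[of "inv T (T x) - x"] norm[of 0] seminorm_zero[OF Q] by simp
    then have "g (inv T (T x)) = g x"
      using bounded_functional_null[OF g] by (fastforce simp: linear_diff[OF lin])
    then show ?thesis using T by (auto simp: \<Psi>_def)
  qed
  have \<Psi>_comp: "\<Psi> g \<circ> T = g" if "g \<in> ?D" for g using \<Psi>T[OF that] by (simp add: fun_eq_iff)
  have \<Psi>_cf: "\<Psi> g \<in> ?cf" if "g \<in> ?D" for g
    unfolding cf_iff \<Psi>_comp[OF that] using that by (simp add: \<Psi>_def)
  have \<Psi>_inv: "\<Psi> (f \<circ> T) = f" if f: "f \<in> ?cf" for f
  proof (rule extensionalityI[of _ "points V"])
    show "\<Psi> (f \<circ> T) \<in> extensional (points V)" by (simp add: \<Psi>_def)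
    show "f \<in> extensional (points V)" using f cf_iff by blast
    fix X assume "X \<in> points V"
    then obtain x where "X = T x" using T by blast
    then show "\<Psi> (f \<circ> T) X = f X" using \<Psi>T[of "f \<circ> T" x] f cf_iff by simp
  qed
  have pd: "points (dual V) = ?cf" by (simp add: dual_def)
  have nd: "nnorm (dual V) f = dual_seminorm Q (f \<circ> T)" for f
  proof -
    have "{X \<in> points V. nnorm V X \<le> 1} = T ` {x. Q x \<le> 1}" unfolding T[symmetric] using norm by auto
    then show ?thesis by (simp add: dual_def dual_seminorm_def image_image)
  qed
  have ad: "nadd (dual V) f g \<circ> T = (f \<circ> T) + (g \<circ> T)" and sd: "nscale (dual V) c f \<circ> T = c *\<^sub>R (f \<circ> T)" for f g c
    using T by (auto simp: dual_def fun_eq_iff)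
  have "points (dual (dual V)) = continuous_functionals (dual V)" by (simp add: dual_def)
  then have pdd: "points (dual (dual V)) = {F \<in> extensional ?cf.
     (\<forall>f\<in>?cf. \<forall>g\<in>?cf. F (nadd (dual V) f g) = F f + F g) \<and>
     (\<forall>c. \<forall>f\<in>?cf. F (nscale (dual V) c f) = c * F f) \<and>
     (\<exists>C. \<forall>f\<in>?cf. \<bar>F f\<bar> \<le> C * nnorm (dual V) f)}"
    by (simp only: continuous_functionals_def[of "dual V"] pd)
  have emb: "bidual_embedding V X = restrict (\<lambda>f. f X) ?cf" for X by (simp add: bidual_embedding_def pd)
  have bound: "\<bar>f (T x)\<bar> \<le> dual_seminorm Q (f \<circ> T) * Q x" if "f \<in> ?cf" for f x
    using dual_seminorm_bound[of "f \<circ> T" x] that cf_iff by simp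
  have nadd_cf: "nadd (dual V) f g \<in> ?cf" if "f \<in> ?cf" "g \<in> ?cf" for f g
    using that unfolding cf_iff ad by (auto simp: dual_def intro: subspace_add[OF subspace_bounded_functionals])
  have nscale_cf: "nscale (dual V) c f \<in> ?cf" if "f \<in> ?cf" for f c
    using that unfolding cf_iff sd by (auto simp: dual_def intro: subspace_scale[OF subspace_bounded_functionals])
  show ?thesis
  proof
    assume refl: "reflexive V"
    show "reflexive_seminorm Q"
      unfolding reflexive_seminorm_def
    proof (intro allI impI)
      fix \<phi> C assume \<phi>: "bidual_element Q C \<phi>"
      then have lin: "linear \<phi>" by (simp add: bidual_element_def)
      define F where "F = restrict (\<lambda>f. \<phi> (f \<circ> T)) ?cf"
      have "F \<in> points (dual (dual V))"
        unfolding pdd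
      proof (intro CollectI conjI ballI allI exI[of _ C])
        show "F \<in> extensional ?cf" by (simp add: F_def)
        show "F (nadd (dual V) f g) = F f + F g" if "f \<in> ?cf" "g \<in> ?cf" for f g
          using that nadd_cf[OF that] by (simp add: F_def ad linear_add[OF lin])
        show "F (nscale (dual V) c f) = c * F f" if "f \<in> ?cf" for c f
          using that nscale_cf[OF that] by (simp add: F_def sd linear_scale[OF lin])
        show "\<bar>F f\<bar> \<le> C * nnorm (dual V) f" if f: "f \<in> ?cf" for f
        proof -
          have fT: "f \<circ> T \<in> ?D" using f cf_iff by blast
          then have "\<bar>\<phi> (f \<circ> T)\<bar> \<le> C * dual_seminorm Q (f \<circ> T)"
            by (intro bidual_elementD[OF \<phi>] dual_seminorm_bound dual_seminorm_nonneg)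
              (auto simp: bounded_functionals_def simp del: o_apply)
          then show ?thesis using f by (simp add: F_def nd)
        qed
      qed
      then obtain X where "X \<in> points V" "F = bidual_embedding V X"
        using refl unfolding reflexive_def by blast
      moreover obtain x where "X = T x" using T \<open>X \<in> points V\<close> by blast
      ultimately have x: "F = bidual_embedding V (T x)" by simp
      have "\<phi> g = g x" if g: "g \<in> ?D" for g
      proof -
        have "\<phi> g = F (\<Psi> g)" using \<Psi>_cf[OF g] by (simp add: F_def \<Psi>_comp[OF g])
        also have "\<dots> = \<Psi> g (T x)" using \<Psi>_cf[OF g] by (simp add: x emb)
        finally show ?thesis using \<Psi>T[OF g] by simp
      qed
      then show "\<exists>x. \<forall>f\<in>?D. \<phi> f = f x" by blast
    qed
  next
    assume refl: "reflexive_seminorm Q"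
    \<comment> \<open>A bidual element of \<open>V\<close> is given on continuous functionals only;
      \<open>P\<close> extends it linearly to all functions.\<close>
    obtain P where P: "linear P" "range P = ?D" "\<And>f. f \<in> ?D \<Longrightarrow> P f = f"
      using linear_projection_onto[OF subspace_bounded_functionals] by blast
    have PD: "P f \<in> ?D" for f using P(2) by blast
    show "reflexive V"
      unfolding reflexive_def
    proof (intro equalityI subsetI)
      fix F assume "F \<in> bidual_embedding V ` points V"
      then obtain X where X: "X \<in> points V" "F = bidual_embedding V X" by blast
      moreover obtain x where "X = T x" using T X(1) by blast
      ultimately have F: "F = restrict (\<lambda>f. f (T x)) ?cf" by (simp add: emb)
      show "F \<in> points (dual (dual V))"
        unfolding pdd
      proof (intro CollectI conjI ballI allI exI[of _ "Q x"])
        show "F \<in> extensional ?cf" by (simp add: F)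
        show "F (nadd (dual V) f g) = F f + F g" if "f \<in> ?cf" "g \<in> ?cf" for f g
          using that nadd_cf[OF that] fun_cong[OF ad, of f g x] by (simp add: F)
        show "F (nscale (dual V) c f) = c * F f" if "f \<in> ?cf" for c f
          using that nscale_cf[OF that] fun_cong[OF sd, of c f x] by (simp add: F)
        show "\<bar>F f\<bar> \<le> Q x * nnorm (dual V) f" if f: "f \<in> ?cf" for f
          using bound[OF f, of x] f by (simp add: F nd mult.commute)
      qed
    next
      fix F assume "F \<in> points (dual (dual V))"
      then have F: "F \<in> extensional ?cf" "\<And>f g. f \<in> ?cf \<Longrightarrow> g \<in> ?cf \<Longrightarrow> F (nadd (dual V) f g) = F f + F g"
          "\<And>c f. f \<in> ?cf \<Longrightarrow> F (nscale (dual V) c f) = c * F f"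
        and "\<exists>C. \<forall>f\<in>?cf. \<bar>F f\<bar> \<le> C * nnorm (dual V) f"
        unfolding pdd by auto
      then obtain C where C: "\<And>f. f \<in> ?cf \<Longrightarrow> \<bar>F f\<bar> \<le> C * nnorm (dual V) f" by blast
      have \<Psi>_add: "\<Psi> (f + g) = nadd (dual V) (\<Psi> f) (\<Psi> g)" if "f \<in> ?D" "g \<in> ?D" for f g
        using \<Psi>_inv[OF nadd_cf[OF \<Psi>_cf \<Psi>_cf, OF that]] by (simp add: ad \<Psi>_comp that)
      have \<Psi>_scale: "\<Psi> (c *\<^sub>R f) = nscale (dual V) c (\<Psi> f)" if "f \<in> ?D" for c f
        using \<Psi>_inv[OF nscale_cf[OF \<Psi>_cf, OF that], of c] by (simp add: sd \<Psi>_comp that)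
      define \<phi> where "\<phi> g = F (\<Psi> (P g))" for g
      have "bidual_element Q \<bar>C\<bar> \<phi>"
        unfolding bidual_element_def
      proof (intro conjI allI impI linearI)
        show "\<phi> (f + g) = \<phi> f + \<phi> g" for f g
          by (simp add: \<phi>_def linear_add[OF P(1)] \<Psi>_add[OF PD PD] F(2)[OF \<Psi>_cf[OF PD] \<Psi>_cf[OF PD]])
        show "\<phi> (c *\<^sub>R f) = c *\<^sub>R \<phi> f" for c f
          by (simp add: \<phi>_def linear_scale[OF P(1)] \<Psi>_scale[OF PD] F(3)[OF \<Psi>_cf[OF PD]])
        fix f K assume f: "linear f" "0 \<le> K" "\<forall>x. \<bar>f x\<bar> \<le> K * Q x"
        then have fD: "f \<in> ?D" by (intro bounded_functionalsI) auto
        have "\<bar>\<phi> f\<bar> \<le> C * dual_seminorm Q f"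
          using C[OF \<Psi>_cf[OF fD]] by (simp add: \<phi>_def P(3)[OF fD] nd \<Psi>_comp[OF fD])
        also have "\<dots> \<le> \<bar>C\<bar> * K"
          using dual_seminorm_le[of f K] f dual_seminorm_nonneg[OF fD] by (intro mult_mono) auto
        finally show "\<bar>\<phi> f\<bar> \<le> \<bar>C\<bar> * K" .
      qed
      then obtain x where x: "\<And>f. f \<in> ?D \<Longrightarrow> \<phi> f = f x"
        using refl unfolding reflexive_seminorm_def by blast
      have "F = bidual_embedding V (T x)"
      proof (rule extensionalityI[OF F(1)])
        show "bidual_embedding V (T x) \<in> extensional ?cf" by (simp add: emb)
        fix f assume f: "f \<in> ?cf"
        then have fT: "f \<circ> T \<in> ?D" using cf_iff by blast
        have "F f = \<phi> (f \<circ> T)" by (simp add: \<phi>_def P(3)[OF fT] \<Psi>_inv[OF f])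
        then show "F f = bidual_embedding V (T x) f" using x[OF fT] f by (simp add: emb)
      qed
      moreover have "T x \<in> points V" using T by blast
      ultimately show "F \<in> bidual_embedding V ` points V" by blast
    qed
  qed
qed

end

section \<open>The space of \<open>p\<close>-integrable sections\<close>

lemma obtain_dense_sequence:
  obtains d :: "nat \<Rightarrow> 'b::{real_normed_vector, second_countable_topology}"
  where "\<And>b e. 0 < e \<Longrightarrow> \<exists>k. norm (b - d k) < e"
proof -
  obtain D :: "'b set" where D: "countable D" "\<And>X. open X \<Longrightarrow> X \<noteq> {} \<Longrightarrow> \<exists>d\<in>D. d \<in> X"
    using countable_dense_setE by blast
  have ne: "D \<noteq> {}" using D(2)[of UNIV] by auto
  have "\<exists>k. norm (b - from_nat_into D k) < e" if e: "0 < e" for b e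
  proof -
    obtain d where "d \<in> D" "d \<in> ball b e" using D(2)[of "ball b e"] e by force
    moreover obtain k where "from_nat_into D k = d" using from_nat_into_surj[OF D(1) \<open>d \<in> D\<close>] by blast
    ultimately show ?thesis by (auto simp: dist_norm)
  qed
  then show ?thesis using that by blast
qed

text \<open>Take norming functionals at a dense sequence: having norm at most 1, a functional that
  norms \<open>d k\<close> nearly norms every \<open>b\<close> close to \<open>d k\<close>.\<close>

lemma obtain_norming_sequence:
  obtains \<omega> :: "nat \<Rightarrow> 'b::{real_normed_vector, second_countable_topology} \<Rightarrow> real"
  where "\<And>k. bounded_linear (\<omega> k)" "\<And>k b. \<bar>\<omega> k b\<bar> \<le> norm b" "\<And>b e. 0 < e \<Longrightarrow> \<exists>k. norm b - e < \<omega> k b"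
proof -
  obtain d :: "nat \<Rightarrow> 'b" where d: "\<And>b e. 0 < e \<Longrightarrow> \<exists>k. norm (b - d k) < e"
    using obtain_dense_sequence by blast
  have "\<exists>f. linear f \<and> (\<forall>b. \<bar>f b\<bar> \<le> norm b) \<and> norm c \<le> f c" for c :: 'b
    using seminorm_separation[OF seminorm_norm convex_singleton[of c], of "norm c"]
    by (metis order_refl singletonD singletonI)
  then have "\<forall>k. \<exists>f. linear f \<and> (\<forall>b. \<bar>f b\<bar> \<le> norm b) \<and> norm (d k) \<le> f (d k)" by blast
  from choice[OF this] obtain \<omega> where \<omega>: "\<And>k. linear (\<omega> k)" "\<And>k b. \<bar>\<omega> k b\<bar> \<le> norm b" "\<And>k. norm (d k) \<le> \<omega> k (d k)"
    by blast
  have "\<exists>k. norm b - e < \<omega> k b" if e: "0 < e" for b e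
  proof -
    obtain k where k: "norm (b - d k) < e / 2" using d[OF half_gt_zero[OF e]] by blast
    have "norm b \<le> norm (d k) + norm (b - d k)" using norm_triangle_ineq[of "d k" "b - d k"] by simp
    moreover have "\<omega> k (d k) \<le> \<omega> k b + norm (b - d k)"
      using \<omega>(2)[of k "b - d k"] linear_diff[OF \<omega>(1), of k b "d k"] by (simp add: abs_le_iff)
    ultimately have "norm b - e < \<omega> k b" using \<omega>(3)[of k] k by linarith
    then show ?thesis by blast
  qed
  moreover have "bounded_linear (\<omega> k)" for k
    using \<omega> by (intro bounded_linear_intro[where K=1] linear_add linear_scale) auto
  ultimately show ?thesis using that \<omega>(2) by blast
qed

lemma borel_measurable_if_norm_diff:
  fixes v :: "'a \<Rightarrow> 'b::{real_normed_vector, second_countable_topology}"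
  assumes "\<And>b. (\<lambda>x. norm (v x - b)) \<in> borel_measurable M"
  shows "v \<in> borel_measurable M"
proof (rule borel_measurableI)
  fix U :: "'b set" assume U: "open U"
  obtain d :: "nat \<Rightarrow> 'b" where d: "\<And>b e. 0 < e \<Longrightarrow> \<exists>k. norm (b - d k) < e"
    using obtain_dense_sequence by blast
  have *: "y \<in> U \<longleftrightarrow> (\<exists>k n. ball (d k) (1 / Suc n) \<subseteq> U \<and> norm (y - d k) < 1 / Suc n)" for y
  proof
    assume "y \<in> U"
    then obtain e where e: "0 < e" "ball y e \<subseteq> U" using U by (meson openE)
    obtain n where n: "inverse (real (Suc n)) < e / 2" using reals_Archimedean[of "e / 2"] e by auto
    obtain k where k: "norm (y - d k) < 1 / Suc n" using d[of "1 / Suc n" y] by auto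
    have "ball (d k) (1 / Suc n) \<subseteq> ball y e"
    proof
      fix z assume "z \<in> ball (d k) (1 / Suc n)"
      then have "norm (d k - z) < 1 / Suc n" by (simp add: dist_norm)
      then show "z \<in> ball y e"
        using norm_triangle_ineq[of "y - d k" "d k - z"] k n by (simp add: dist_norm inverse_eq_divide)
    qed
    then show "\<exists>k n. ball (d k) (1 / Suc n) \<subseteq> U \<and> norm (y - d k) < 1 / Suc n" using e k by blast
  qed (force simp: dist_norm norm_minus_commute)
  have "v -` U \<inter> space M = {x \<in> space M. \<exists>k n. ball (d k) (1 / Suc n) \<subseteq> U \<and> norm (v x - d k) < 1 / Suc n}"
    using * by blast
  also have "\<dots> \<in> sets M" using assms by measurable
  finally show "v -` U \<inter> space M \<in> sets M" .
qed

text \<open>The distance from \<open>v x\<close> to \<open>b\<close> is the countable supremum of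
  \<open>\<omega> k (v x) - \<omega> k b\<close>.\<close>

lemma borel_measurable_norming:
  fixes v :: "'a \<Rightarrow> 'b::{real_normed_vector, second_countable_topology}"
  assumes \<omega>: "\<And>k. bounded_linear (\<omega> k)" "\<And>k b. \<bar>\<omega> k b\<bar> \<le> norm b" "\<And>b e. 0 < e \<Longrightarrow> \<exists>k::nat. norm b - e < \<omega> k b"
    and meas: "\<And>k. (\<lambda>x. \<omega> k (v x)) \<in> borel_measurable M"
  shows "v \<in> borel_measurable M"
proof (rule borel_measurable_if_norm_diff)
  fix b
  have bdd: "bdd_above (range (\<lambda>k. \<omega> k c))" for c
    using \<omega>(2) by (intro bdd_aboveI2[of _ _ "norm c"]) (auto simp: abs_le_iff)
  have "norm c = (SUP k. \<omega> k c)" for c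
  proof (rule antisym)
    show "norm c \<le> (SUP k. \<omega> k c)"
    proof (rule field_le_epsilon)
      fix e :: real assume "0 < e"
      then obtain k where "norm c - e < \<omega> k c" using \<omega>(3) by blast
      also have "\<dots> \<le> (SUP k. \<omega> k c)" by (intro cSUP_upper bdd) simp
      finally show "norm c \<le> (SUP k. \<omega> k c) + e" by simp
    qed
    show "(SUP k. \<omega> k c) \<le> norm c" using \<omega>(2) by (intro cSUP_least) (auto simp: abs_le_iff)
  qed
  then have "(\<lambda>x. norm (v x - b)) = (\<lambda>x. SUP k. \<omega> k (v x) - \<omega> k b)"
    using \<omega>(1) by (simp add: bounded_linear.linear linear_diff)
  also have "\<dots> \<in> borel_measurable M"
  proof (rule borel_measurable_cSUP)
    show "bdd_above (range (\<lambda>k. \<omega> k (v x) - \<omega> k b))" for x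
      using bdd[of "v x - b"] \<omega>(1) by (simp add: bounded_linear.linear linear_diff)
  qed (use meas in auto)
  finally show "(\<lambda>x. norm (v x - b)) \<in> borel_measurable M" .
qed

text \<open>Pettis's theorem: in a separable space a norming sequence of functionals already detects
  Borel measurability, and every subset of the space is separable.\<close>

lemma strongly_measurable_iff_borel:
  fixes v :: "'a \<Rightarrow> 'b::{real_normed_vector, second_countable_topology}"
  shows "strongly_measurable M v \<longleftrightarrow> v \<in> borel_measurable M"
proof
  assume v: "strongly_measurable M v"
  obtain \<omega> :: "nat \<Rightarrow> 'b \<Rightarrow> real" where \<omega>: "\<And>k. bounded_linear (\<omega> k)" "\<And>k b. \<bar>\<omega> k b\<bar> \<le> norm b"
      "\<And>b e. 0 < e \<Longrightarrow> \<exists>k. norm b - e < \<omega> k b"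
    using obtain_norming_sequence by blast
  show "v \<in> borel_measurable M"
  proof (rule borel_measurable_norming[OF \<omega>])
    show "(\<lambda>x. \<omega> k (v x)) \<in> borel_measurable M" for k
    proof -
      have "(\<lambda>x. blinfun_apply (Blinfun (\<omega> k)) (v x)) \<in> borel_measurable M"
        using v by (simp add: strongly_measurable_def)
      then show ?thesis by (simp add: bounded_linear_Blinfun_apply \<omega>(1))
    qed
  qed
next
  assume v: "v \<in> borel_measurable M"
  have "(\<lambda>x. blinfun_apply \<omega> (v x)) \<in> borel_measurable M" for \<omega> :: "'b \<Rightarrow>\<^sub>L real"
    using measurable_compose[OF v borel_measurable_continuous_onI[of "blinfun_apply \<omega>"]]
    by (simp add: blinfun.continuous_on continuous_on_id)
  moreover have "separable_space (top_of_set (v ` (space M - {})))"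
  proof (intro second_countable_imp_separable_space second_countable_subtopology)
    obtain B :: "'b set set" where B: "countable B" "topological_basis B"
      using ex_countable_basis by blast
    show "second_countable (euclidean :: 'b topology)"
      unfolding second_countable_def
    proof (intro exI[of _ B] conjI ballI allI impI B(1))
      show "openin euclidean V" if "V \<in> B" for V
        using topological_basis_open[OF B(2) that] by simp
      show "\<exists>V\<in>B. x \<in> V \<and> V \<subseteq> U" if "openin euclidean U \<and> x \<in> U" for U x
        using topological_basisE[OF B(2), of U x] that by auto
    qed
  qed
  ultimately show "strongly_measurable M v"
    unfolding strongly_measurable_def by (intro conjI allI bexI[of _ "{}"]) auto
qed

text \<open>Convexity of the power at \<open>a / (1 - \<mu>)\<close> and \<open>b / \<mu>\<close>
  with weights \<open>1 - \<mu>\<close> and \<open>\<mu>\<close>. With \<open>\<mu>\<close> adapted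
  to the two norms, integration yields Minkowski's inequality without Hoelder's.\<close>

lemma powr_add_le:
  fixes a b \<mu> p :: real
  assumes ab: "0 \<le> a" "0 \<le> b" and \<mu>: "0 < \<mu>" "\<mu> < 1" and p: "1 \<le> p"
  shows "(a + b) powr p \<le> (1 - \<mu>) powr (1 - p) * a powr p + \<mu> powr (1 - p) * b powr p"
proof -
  have scale: "t * (c / t) powr p = t powr (1 - p) * c powr p" if "0 < t" "0 \<le> c" for t c
    using that by (simp add: powr_divide powr_diff)
  have powr_le: "c powr p \<le> t powr (1 - p) * c powr p" if "0 < t" "t < 1" for t c :: real
  proof -
    have "1 \<le> t powr (1 - p)"
      using powr_mono'[of "1 - p" 0 t] that p by simp
    then show ?thesis using mult_right_mono[of 1 "t powr (1 - p)" "c powr p"] by simp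
  qed
  consider "a = 0" | "b = 0" | "0 < a" "0 < b" using ab by linarith
  then show ?thesis
  proof cases
    case 1
    then show ?thesis using powr_le[OF \<mu>, of b] p by simp
  next
    case 2
    then show ?thesis using powr_le[of "1 - \<mu>" a] \<mu> p by simp
  next
    case 3
    have "((1 - \<mu>) *\<^sub>R (a / (1 - \<mu>)) + \<mu> *\<^sub>R (b / \<mu>)) powr p
        \<le> (1 - \<mu>) * (a / (1 - \<mu>)) powr p + \<mu> * (b / \<mu>) powr p"
      using 3 \<mu> by (intro convex_onD[OF powr_convex[OF p]]) auto
    then show ?thesis using 3 \<mu> by (simp add: scale)
  qed
qed

text \<open>The sum of the positive parts has finite integral, so it is finite almost everywhere and
  bounds every term. Applied to increments with growing weights, this gives their geometric
  decay.\<close>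

lemma AE_bounded_if_integrals_summable:
  fixes D :: "nat \<Rightarrow> 'a \<Rightarrow> real"
  assumes [measurable]: "\<And>i. D i \<in> borel_measurable M"
    and D: "\<And>i. (\<integral>\<^sup>+x. ennreal (D i x) \<partial>M) \<le> ennreal ((1/2) ^ i)"
  shows "AE x in M. \<exists>C. \<forall>i. D i x \<le> C"
proof -
  have "(\<integral>\<^sup>+x. (\<Sum>i. ennreal (D i x)) \<partial>M) = (\<Sum>i. \<integral>\<^sup>+x. ennreal (D i x) \<partial>M)"
    by (rule nn_integral_suminf) measurable
  also have "\<dots> \<le> (\<Sum>i. ennreal ((1/2) ^ i))" by (intro suminf_le D) auto
  also have "\<dots> < \<infinity>" by (subst suminf_ennreal2) (auto simp: summable_geometric)
  finally have "AE x in M. (\<Sum>i. ennreal (D i x)) \<noteq> \<infinity>"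
    by (intro nn_integral_PInf_AE) (auto simp: less_top)
  then show ?thesis
  proof eventually_elim
    case (elim x)
    have "D i x \<le> enn2real (\<Sum>i. ennreal (D i x))" for i
    proof -
      have "ennreal (D i x) \<le> (\<Sum>i. ennreal (D i x))"
        using sum_le_suminf[of "\<lambda>i. ennreal (D i x)" "{i}"] by simp
      then have "enn2real (ennreal (D i x)) \<le> enn2real (\<Sum>i. ennreal (D i x))"
        using elim by (intro enn2real_mono) (auto simp: less_top)
      then show ?thesis by (cases "0 \<le> D i x") (auto intro: order_trans[OF _ enn2real_nonneg])
    qed
    then show ?case by blast
  qed
qed

section \<open>The \<open>p\<close>-norm on sections: Minkowski, Fatou and completeness\<close>

definition p_integral :: "'a measure \<Rightarrow> real \<Rightarrow> ('a \<Rightarrow> 'b::real_normed_vector) \<Rightarrow> real" where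
  "p_integral M p v = (\<integral>x. norm (v x) powr p \<partial>M)"

definition p_norm :: "'a measure \<Rightarrow> real \<Rightarrow> ('a \<Rightarrow> 'b::real_normed_vector) \<Rightarrow> real" where
  "p_norm M p v = p_integral M p v powr (1 / p)"

locale Lp_bundle = sigma_finite_measure M for M :: "'a measure" +
  fixes E :: "'a \<Rightarrow> 'b::{banach, second_countable_topology} set" and p :: real
  assumes is_bundle: "banach_bundle M E" and p: "1 < p"
begin

abbreviation L :: "('a \<Rightarrow> 'b) set" where "L \<equiv> Lp_sections M E p"

lemma fibre_subspace: "x \<in> space M \<Longrightarrow> subspace (E x)"
  and fibre_closed: "x \<in> space M \<Longrightarrow> closed (E x)"
  using is_bundle by (auto simp: banach_bundle_def)

lemma L_iff: "v \<in> L \<longleftrightarrow> v \<in> borel_measurable M \<and> (\<forall>x\<in>space M. v x \<in> E x) \<and> integrable M (\<lambda>x. norm (v x) powr p)"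
  by (auto simp: Lp_sections_def sections_def strongly_measurable_iff_borel)

lemma L_fibre: "v \<in> L \<Longrightarrow> x \<in> space M \<Longrightarrow> v x \<in> E x"
  and L_integrable: "v \<in> L \<Longrightarrow> integrable M (\<lambda>x. norm (v x) powr p)"
  by (auto simp: L_iff)

lemma nn_integral_eq_p_integral:
  "v \<in> L \<Longrightarrow> (\<integral>\<^sup>+x. ennreal (norm (v x) powr p) \<partial>M) = ennreal (p_integral M p v)"
  unfolding p_integral_def by (intro nn_integral_eq_integral L_integrable) auto

lemma p_integral_nonneg: "0 \<le> p_integral M p v"
  by (simp add: p_integral_def)

lemma p_norm_nonneg: "0 \<le> p_norm M p v"
  by (simp add: p_norm_def)

lemma p_norm_powr: "p_norm M p v powr p = p_integral M p v"
  using p by (simp add: p_norm_def powr_powr p_integral_nonneg)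

lemma p_norm_le_iff: "0 \<le> r \<Longrightarrow> p_norm M p v \<le> r \<longleftrightarrow> p_integral M p v \<le> r powr p"
  unfolding p_norm_powr[symmetric]
  using p powr_mono2[of p "p_norm M p v" r] powr_less_mono2[of p r "p_norm M p v"] p_norm_nonneg[of v]
  by (cases "p_norm M p v \<le> r") auto

lemma L_if_nn_integral_le:
  assumes "v \<in> borel_measurable M" "\<And>x. x \<in> space M \<Longrightarrow> v x \<in> E x"
    and "(\<integral>\<^sup>+x. ennreal (norm (v x) powr p) \<partial>M) \<le> ennreal (r powr p)" "0 \<le> r"
  shows "v \<in> L" "p_norm M p v \<le> r"
proof -
  show v: "v \<in> L"
    unfolding L_iff using assms
    by (auto simp: integrable_iff_bounded intro: le_less_trans)
  show "p_norm M p v \<le> r"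
    unfolding p_norm_le_iff[OF assms(4)] using nn_integral_eq_p_integral[OF v] assms(3)
    by (simp add: p_integral_nonneg)
qed

lemma L_dominated:
  assumes u: "u \<in> L" and v: "v \<in> borel_measurable M" "\<And>x. x \<in> space M \<Longrightarrow> v x \<in> E x"
    and le: "AE x in M. norm (v x) \<le> norm (u x)"
  shows "v \<in> L" "p_norm M p v \<le> p_norm M p u"
proof -
  have "(\<integral>\<^sup>+x. ennreal (norm (v x) powr p) \<partial>M) \<le> (\<integral>\<^sup>+x. ennreal (norm (u x) powr p) \<partial>M)"
    using le p by (intro nn_integral_mono_AE) (auto elim!: eventually_mono intro!: ennreal_leI powr_mono2)
  also have "\<dots> = ennreal (p_norm M p u powr p)" using u by (simp add: nn_integral_eq_p_integral p_norm_powr)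
  finally show "v \<in> L" "p_norm M p v \<le> p_norm M p u"
    using L_if_nn_integral_le[OF v] p_norm_nonneg by blast+
qed

lemma L_add:
  assumes u: "u \<in> L" and v: "v \<in> L"
  shows "u + v \<in> L" and "p_norm M p (u + v) \<le> p_norm M p u + p_norm M p v"
proof -
  have [measurable]: "u \<in> borel_measurable M" "v \<in> borel_measurable M" using u v by (auto simp: L_iff)
  have meas: "u + v \<in> borel_measurable M" unfolding plus_fun_def by measurable
  have fib: "(u + v) x \<in> E x" if "x \<in> space M" for x
    using that subspace_add[OF fibre_subspace] u v by (auto simp: L_iff)
  \<comment> \<open>Strict bounds keep \<open>r\<close> and \<open>s\<close> positive and hence
    \<open>\<mu>\<close> strictly between 0 and 1; the norms themselves are reached in the
    limit.\<close>
  have main: "u + v \<in> L \<and> p_norm M p (u + v) \<le> r + s"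
    if r: "p_norm M p u < r" and s: "p_norm M p v < s" for r s
  proof -
    have pos: "0 < r" "0 < s" using r s p_norm_nonneg le_less_trans by blast+
    \<comment> \<open>With this weight the two terms of the integrated bound add up to
      \<open>(r + s) powr p\<close>.\<close>
    define \<mu> where "\<mu> = s / (r + s)"
    have \<mu>: "0 < \<mu>" "\<mu> < 1" "1 - \<mu> = r / (r + s)" using pos by (auto simp: \<mu>_def field_simps)
    have int: "integrable M (\<lambda>x. (1 - \<mu>) powr (1 - p) * norm (u x) powr p + \<mu> powr (1 - p) * norm (v x) powr p)"
      using u v by (auto simp: L_iff)
    have "(\<integral>\<^sup>+x. ennreal (norm ((u + v) x) powr p) \<partial>M)
      \<le> (\<integral>\<^sup>+x. ennreal ((1 - \<mu>) powr (1 - p) * norm (u x) powr p + \<mu> powr (1 - p) * norm (v x) powr p) \<partial>M)"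
    proof (intro nn_integral_mono ennreal_leI)
      fix x
      have "norm ((u + v) x) powr p \<le> (norm (u x) + norm (v x)) powr p"
        using p by (intro powr_mono2) (auto simp: norm_triangle_ineq)
      also have "\<dots> \<le> (1 - \<mu>) powr (1 - p) * norm (u x) powr p + \<mu> powr (1 - p) * norm (v x) powr p"
        using \<mu> p by (intro powr_add_le) auto
      finally show "norm ((u + v) x) powr p \<le> \<dots>" .
    qed
    also have "\<dots> = ennreal ((1 - \<mu>) powr (1 - p) * p_integral M p u + \<mu> powr (1 - p) * p_integral M p v)"
      using u v by (subst nn_integral_eq_integral[OF int]) (auto simp: p_integral_def L_iff)
    also have "\<dots> \<le> ennreal ((1 - \<mu>) powr (1 - p) * r powr p + \<mu> powr (1 - p) * s powr p)"
      using p_norm_le_iff[of r u] p_norm_le_iff[of s v] r s pos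
      by (intro ennreal_leI add_mono mult_left_mono) auto
    also have "(1 - \<mu>) powr (1 - p) * r powr p + \<mu> powr (1 - p) * s powr p = (r + s) powr p"
    proof -
      have *: "(t / (r + s)) powr (1 - p) * t powr p = t * (r + s) powr (p - 1)" if "0 < t" for t
        using that pos by (simp add: powr_divide powr_diff)
      have "(r + s) powr p = (r + s) * (r + s) powr (p - 1)" using pos by (simp add: powr_diff)
      then show ?thesis using pos unfolding \<mu>(3) by (simp add: \<mu>_def * distrib_right)
    qed
    finally show ?thesis
      using L_if_nn_integral_le[OF meas fib, of "r + s"] add_nonneg_nonneg[of r s] pos by (simp del: plus_fun_apply)
  qed
  show "u + v \<in> L" using main[of "p_norm M p u + 1" "p_norm M p v + 1"] by auto
  show "p_norm M p (u + v) \<le> p_norm M p u + p_norm M p v"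
  proof (rule field_le_epsilon)
    fix e :: real assume "0 < e"
    then show "p_norm M p (u + v) \<le> p_norm M p u + p_norm M p v + e"
      using main[of "p_norm M p u + e / 2" "p_norm M p v + e / 2"] by simp
  qed
qed

lemma L_scale:
  assumes u: "u \<in> L"
  shows "c *\<^sub>R u \<in> L" and "p_norm M p (c *\<^sub>R u) = \<bar>c\<bar> * p_norm M p u"
proof -
  have [measurable]: "u \<in> borel_measurable M" using u by (auto simp: L_iff)
  have eq: "norm ((c *\<^sub>R u) x) powr p = \<bar>c\<bar> powr p * norm (u x) powr p" for x
    by (simp add: powr_mult)
  have "c *\<^sub>R u \<in> borel_measurable M" unfolding scaleR_fun_def by measurable
  then show "c *\<^sub>R u \<in> L"
    unfolding L_iff eq using u subspace_scale[OF fibre_subspace] by (auto simp: L_iff)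
  have "p_integral M p (c *\<^sub>R u) = \<bar>c\<bar> powr p * p_integral M p u"
    unfolding p_integral_def eq by simp
  then show "p_norm M p (c *\<^sub>R u) = \<bar>c\<bar> * p_norm M p u"
    using p by (simp add: p_norm_def powr_mult p_integral_nonneg powr_powr)
qed

lemma subspace_L: "subspace L"
proof (rule subspaceI)
  have "(\<lambda>x. 0) \<in> L" using subspace_0[OF fibre_subspace] by (auto simp: L_iff)
  then show "0 \<in> L" by (simp add: zero_fun_def)
qed (blast intro: L_add L_scale)+

lemma p_norm_AE_cong: "u \<in> L \<Longrightarrow> v \<in> L \<Longrightarrow> AE x in M. u x = v x \<Longrightarrow> p_norm M p u = p_norm M p v"
proof (rule antisym)
  assume u: "u \<in> L" and v: "v \<in> L" and eq: "AE x in M. u x = v x"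
  have le: "AE x in M. norm (u x) \<le> norm (v x)" "AE x in M. norm (v x) \<le> norm (u x)"
    using eq by (eventually_elim, simp)+
  show "p_norm M p u \<le> p_norm M p v"
    by (rule L_dominated(2)[OF v _ _ le(1)]) (use u in \<open>auto simp: L_iff\<close>)
  show "p_norm M p v \<le> p_norm M p u"
    by (rule L_dominated(2)[OF u _ _ le(2)]) (use v in \<open>auto simp: L_iff\<close>)
qed

lemma ex_measurable_limit:
  assumes f: "\<And>i. f i \<in> borel_measurable M" "\<And>i x. x \<in> space M \<Longrightarrow> f i x \<in> E x"
    and conv: "AE x in M. convergent (\<lambda>i. f i x)"
  obtains v where "v \<in> borel_measurable M" "\<And>x. x \<in> space M \<Longrightarrow> v x \<in> E x" "AE x in M. (\<lambda>i. f i x) \<longlonglongrightarrow> v x"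
proof -
  note f(1)[measurable]
  define G where "G = {x \<in> space M. Cauchy (\<lambda>i. f i x)}"
  have [measurable]: "G \<in> sets M" unfolding G_def by (rule sets_Collect_Cauchy) (rule f(1))
  \<comment> \<open>Off the set of convergence the value is 0, which lies in every fibre.\<close>
  define v where "v x = lim (\<lambda>i. if x \<in> G then f i x else 0)" for x
  have "(\<lambda>x. lim (\<lambda>i. if x \<in> G then f i x else 0)) \<in> borel_measurable M"
    by (rule borel_measurable_lim_metric) measurable
  then have "v \<in> borel_measurable M" by (simp add: v_def[abs_def])
  moreover have lim: "(\<lambda>i. f i x) \<longlonglongrightarrow> v x" if "x \<in> G" for x
    using that by (simp add: v_def G_def Cauchy_convergent_iff convergent_LIMSEQ_iff)
  moreover have "v x \<in> E x" if x: "x \<in> space M" for x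
  proof (cases "x \<in> G")
    case True
    show ?thesis
      using closed_sequentially[OF fibre_closed[OF x] _ lim[OF True]] f(2)[OF x] by blast
  next
    case False
    then show ?thesis using subspace_0[OF fibre_subspace[OF x]] by (simp add: v_def limI)
  qed
  moreover have "AE x in M. (\<lambda>i. f i x) \<longlonglongrightarrow> v x"
    using conv AE_space by eventually_elim (auto intro!: lim simp: G_def convergent_Cauchy)
  ultimately show ?thesis using that by blast
qed

lemma L_fatou:
  assumes f: "\<And>i. f i \<in> L" "\<And>i. p_norm M p (f i) \<le> r"
    and v: "v \<in> borel_measurable M" "\<And>x. x \<in> space M \<Longrightarrow> v x \<in> E x" and lim: "AE x in M. (\<lambda>i. f i x) \<longlonglongrightarrow> v x"
  shows "v \<in> L" "p_norm M p v \<le> r"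
proof -
  have [measurable]: "\<And>i. f i \<in> borel_measurable M" using f(1) by (simp add: L_iff)
  have r: "0 \<le> r" using f(2)[of 0] p_norm_nonneg order_trans by blast
  have "(\<integral>\<^sup>+x. ennreal (norm (v x) powr p) \<partial>M) = (\<integral>\<^sup>+x. liminf (\<lambda>i. ennreal (norm (f i x) powr p)) \<partial>M)"
  proof (rule nn_integral_cong_AE, use lim in eventually_elim)
    case (elim x)
    have "(\<lambda>i. ennreal (norm (f i x) powr p)) \<longlonglongrightarrow> ennreal (norm (v x) powr p)"
      using p by (intro tendsto_ennrealI tendsto_powr' tendsto_norm elim tendsto_const) auto
    then show ?case by (rule lim_imp_Liminf[OF sequentially_bot, symmetric])
  qed
  also have "\<dots> \<le> liminf (\<lambda>i. \<integral>\<^sup>+x. ennreal (norm (f i x) powr p) \<partial>M)"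
    by (rule nn_integral_liminf) measurable
  also have "\<dots> \<le> liminf (\<lambda>i::nat. ennreal (r powr p))"
  proof (intro Liminf_mono always_eventually allI)
    fix i
    show "(\<integral>\<^sup>+x. ennreal (norm (f i x) powr p) \<partial>M) \<le> ennreal (r powr p)"
      using p_norm_le_iff[OF r, of "f i"] f(2)[of i] by (simp add: nn_integral_eq_p_integral[OF f(1)] ennreal_leI)
  qed
  also have "\<dots> = ennreal (r powr p)" by (simp add: Liminf_const)
  finally show "v \<in> L" "p_norm M p v \<le> r" using L_if_nn_integral_le[OF v] r by auto
qed

lemma L_complete:
  assumes u: "\<And>n. u n \<in> L" and Cauchy: "\<And>e. 0 < e \<Longrightarrow> \<exists>N. \<forall>m\<ge>N. \<forall>n\<ge>N. p_norm M p (u m - u n) < e"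
  obtains v where "v \<in> L" "(\<lambda>n. p_norm M p (u n - v)) \<longlonglongrightarrow> 0"
proof -
  have uu: "u m - u n \<in> L" for m n using u by (intro subspace_diff[OF subspace_L])
  have [measurable]: "u n \<in> borel_measurable M" for n using u by (simp add: L_iff)
  have "\<forall>i. \<exists>N. \<forall>m\<ge>N. \<forall>n\<ge>N. p_norm M p (u m - u n) < (1/4) ^ i" using Cauchy by simp
  from choice[OF this] obtain N where N: "\<And>i m n. N i \<le> m \<Longrightarrow> N i \<le> n \<Longrightarrow> p_norm M p (u m - u n) < (1/4) ^ i"
    by blast
  \<comment> \<open>Adding up the \<open>N j\<close> makes the indices nondecreasing while
    \<open>N i \<le> r i\<close>; the summand \<open>i\<close> makes them tend to infinity.\<close>
  define r where "r i = (\<Sum>j\<le>i. N j) + i" for i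
  have r: "N i \<le> r i" "r i \<le> r (Suc i)" "i \<le> r i" for i
    using member_le_sum[of i "{..i}" N] by (auto simp: r_def)
  define \<Delta> where "\<Delta> i = u (r (Suc i)) - u (r i)" for i
  have \<Delta>: "\<Delta> i \<in> L" "p_norm M p (\<Delta> i) \<le> (1/4) ^ i" for i
    using uu N[of i "r (Suc i)" "r i"] r[of i] by (auto simp: \<Delta>_def)
  have [measurable]: "\<Delta> i \<in> borel_measurable M" for i using \<Delta> by (simp add: L_iff)
  \<comment> \<open>The increments have \<open>p\<close>-norm at most \<open>(1/4) ^ i\<close>. The
    weight \<open>2 ^ i\<close> still leaves a summable bound and yields pointwise decay of order
    \<open>(1/2) ^ i\<close>.\<close>
  have "AE x in M. \<exists>C. \<forall>i. (2 ^ i) powr p * norm (\<Delta> i x) powr p \<le> C"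
  proof (rule AE_bounded_if_integrals_summable)
    fix i
    have "(\<integral>\<^sup>+x. ennreal ((2 ^ i) powr p * norm (\<Delta> i x) powr p) \<partial>M)
      = ennreal ((2 ^ i) powr p) * (\<integral>\<^sup>+x. ennreal (norm (\<Delta> i x) powr p) \<partial>M)"
      by (simp add: ennreal_mult nn_integral_cmult)
    also have "\<dots> = ennreal ((2 ^ i) powr p * p_integral M p (\<Delta> i))"
      by (simp add: nn_integral_eq_p_integral[OF \<Delta>(1)] ennreal_mult p_integral_nonneg)
    also have "\<dots> \<le> ennreal ((2 ^ i) powr p * ((1/4) ^ i) powr p)"
      using \<Delta>(2)[of i] p_norm_le_iff[of "(1/4) ^ i" "\<Delta> i"] by (intro ennreal_leI mult_left_mono) auto
    also have "(2 ^ i) powr p * ((1/4) ^ i) powr p = ((1/2::real) ^ i) powr p"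
    proof -
      have "(2 ^ i) powr p * ((1/4) ^ i) powr p = (2 ^ i * (1/4::real) ^ i) powr p" by (simp only: powr_mult)
      also have "2 ^ i * (1/4::real) ^ i = (2 * (1/4)) ^ i" by (rule power_mult_distrib[symmetric])
      finally show ?thesis by simp
    qed
    also have "ennreal (((1/2::real) ^ i) powr p) \<le> ennreal (((1/2) ^ i) powr 1)"
      using p by (intro ennreal_leI powr_mono') (auto simp: power_le_one)
    finally show "(\<integral>\<^sup>+x. ennreal ((2 ^ i) powr p * norm (\<Delta> i x) powr p) \<partial>M) \<le> ennreal ((1/2) ^ i)" by simp
  qed measurable
  then have "AE x in M. convergent (\<lambda>i. u (r i) x)"
  proof eventually_elim
    case (elim x)
    then obtain C where "\<And>i. (2 ^ i) powr p * norm (\<Delta> i x) powr p \<le> C" by blast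
    then have C: "(2 ^ i * norm (\<Delta> i x)) powr p \<le> C" for i by (simp only: powr_mult)
    have "norm (\<Delta> i x) \<le> \<bar>C\<bar> powr (1 / p) * (1/2) ^ i" for i
    proof -
      have "2 ^ i * norm (\<Delta> i x) = ((2 ^ i * norm (\<Delta> i x)) powr p) powr (1 / p)"
        using p by (simp add: powr_powr)
      also have "\<dots> \<le> \<bar>C\<bar> powr (1 / p)" using C[of i] p by (intro powr_mono2) auto
      finally have "(1/2) ^ i * (2 ^ i * norm (\<Delta> i x)) \<le> (1/2) ^ i * (\<bar>C\<bar> powr (1 / p))"
        by (rule mult_left_mono) simp
      moreover have "(1/2::real) ^ i * 2 ^ i = (1/2 * 2) ^ i" by (rule power_mult_distrib[symmetric])
      ultimately show ?thesis by (simp only: mult.assoc[symmetric]) (simp add: mult.commute)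
    qed
    then have "summable (\<lambda>i. \<Delta> i x)"
      by (intro summable_comparison_test[OF _ summable_mult[OF summable_geometric[of "1/2::real"]], of _ "\<bar>C\<bar> powr (1 / p)"])
        auto
    then have "convergent (\<lambda>n. \<Sum>i<n. \<Delta> i x)" by (simp add: summable_iff_convergent)
    moreover have "(\<Sum>i<n. \<Delta> i x) = u (r n) x - u (r 0) x" for n
      using sum_lessThan_telescope[of "\<lambda>i. u (r i) x" n] by (simp add: \<Delta>_def)
    ultimately have "convergent (\<lambda>n. u (r n) x - u (r 0) x + u (r 0) x)"
      by (intro convergent_add convergent_const) simp
    then show ?case by simp
  qed
  then obtain v where v: "v \<in> borel_measurable M" "\<And>x. x \<in> space M \<Longrightarrow> v x \<in> E x"
    and lim: "AE x in M. (\<lambda>i. u (r i) x) \<longlonglongrightarrow> v x"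
    using ex_measurable_limit[of "\<lambda>i. u (r i)"] u by (auto simp: L_iff)
  \<comment> \<open>Fatou applied to \<open>u n - u (r (i + K))\<close> as \<open>i\<close> grows;
    the shift by \<open>K\<close> keeps the second index past \<open>K\<close>.\<close>
  have close: "u n - v \<in> L \<and> p_norm M p (u n - v) \<le> e" if K: "\<And>m n. K \<le> m \<Longrightarrow> K \<le> n \<Longrightarrow> p_norm M p (u m - u n) < e" and n: "K \<le> n" for K n e
  proof -
    have sub: "p_norm M p (u n - u (r (i + K))) \<le> e" for i
      using K[OF n, of "r (i + K)"] r(3)[of "i + K"] by simp
    have "AE x in M. (\<lambda>i. (u n - u (r (i + K))) x) \<longlonglongrightarrow> (u n - v) x"
      using lim
    proof eventually_elim
      case (elim x)
      from LIMSEQ_ignore_initial_segment[OF elim, of K] show ?case by (auto intro!: tendsto_diff)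
    qed
    moreover have "u n - v \<in> borel_measurable M" unfolding fun_diff_def using v(1) by measurable
    moreover have "(u n - v) x \<in> E x" if "x \<in> space M" for x
      using that v(2) u subspace_diff[OF fibre_subspace] by (auto simp: L_iff)
    ultimately show ?thesis
      using L_fatou[of "\<lambda>i. u n - u (r (i + K))" e "u n - v", OF uu sub] by blast
  qed
  obtain K where K: "\<And>m n. K \<le> m \<Longrightarrow> K \<le> n \<Longrightarrow> p_norm M p (u m - u n) < 1"
    using Cauchy[OF zero_less_one] by blast
  have "u K - v \<in> L" using close[of K 1 K] K by simp
  then have "u K - (u K - v) \<in> L" by (rule subspace_diff[OF subspace_L u])
  then have "v \<in> L" by simp
  moreover have "(\<lambda>n. p_norm M p (u n - v)) \<longlonglongrightarrow> 0"
  proof (rule LIMSEQ_I)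
    fix e :: real assume e: "0 < e"
    then obtain K where K: "\<And>m n. K \<le> m \<Longrightarrow> K \<le> n \<Longrightarrow> p_norm M p (u m - u n) < e / 2"
      using Cauchy[OF half_gt_zero[OF e]] by blast
    have "norm (p_norm M p (u n - v) - 0) < e" if "K \<le> n" for n
      using close[OF K that] e p_norm_nonneg[of "u n - v"] by simp
    then show "\<exists>K. \<forall>n\<ge>K. norm (p_norm M p (u n - v) - 0) < e" by blast
  qed
  ultimately show ?thesis using that by blast
qed

section \<open>The section space as a seminorm on all functions\<close>

definition section_proj :: "('a \<Rightarrow> 'b) \<Rightarrow> 'a \<Rightarrow> 'b" where
  "section_proj = (SOME P. linear P \<and> range P = L \<and> (\<forall>v\<in>L. P v = v))"

lemma section_proj: "linear section_proj" "range section_proj = L" "\<And>v. v \<in> L \<Longrightarrow> section_proj v = v"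
proof -
  obtain P where "linear P" "range P = L" "\<And>v. v \<in> L \<Longrightarrow> P v = v"
    using linear_projection_onto[OF subspace_L] by blast
  then have "linear P \<and> range P = L \<and> (\<forall>v\<in>L. P v = v)" by simp
  then have *: "linear section_proj \<and> range section_proj = L \<and> (\<forall>v\<in>L. section_proj v = v)"
    unfolding section_proj_def by (rule someI[of "\<lambda>P. linear P \<and> range P = L \<and> (\<forall>v\<in>L. P v = v)"])
  show "linear section_proj" by (rule conjunct1[OF *])
  show "range section_proj = L" by (rule conjunct1[OF conjunct2[OF *]])
  show "section_proj v = v" if "v \<in> L" for v
    by (rule bspec[OF conjunct2[OF conjunct2[OF *]] that])
qed

lemma section_proj_L: "section_proj u \<in> L"
  using section_proj(2) by blast

definition section_seminorm :: "('a \<Rightarrow> 'b) \<Rightarrow> real" where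
  "section_seminorm u = p_norm M p (section_proj u)"

lemma section_seminorm_L: "u \<in> L \<Longrightarrow> section_seminorm u = p_norm M p u"
  by (simp add: section_seminorm_def section_proj(3))

lemma seminorm_section_seminorm: "seminorm section_seminorm"
  unfolding seminorm_def section_seminorm_def linear_add[OF section_proj(1)] linear_scale[OF section_proj(1)]
  by (simp add: L_add(2) L_scale(2) section_proj_L)

lemma complete_section_seminorm: "complete_seminorm section_seminorm"
  unfolding complete_seminorm_def
proof (intro allI impI)
  fix u :: "nat \<Rightarrow> 'a \<Rightarrow> 'b"
  assume "\<forall>e>0. \<exists>N. \<forall>m\<ge>N. \<forall>n\<ge>N. section_seminorm (u m - u n) < e"
  then have "\<exists>N. \<forall>m\<ge>N. \<forall>n\<ge>N. p_norm M p (section_proj (u m) - section_proj (u n)) < e" if "0 < e" for e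
    using that unfolding section_seminorm_def linear_diff[OF section_proj(1)] by blast
  then obtain v where v: "v \<in> L" "(\<lambda>n. p_norm M p (section_proj (u n) - v)) \<longlonglongrightarrow> 0"
    using L_complete[of "\<lambda>n. section_proj (u n)", OF section_proj_L] by blast
  then show "\<exists>x. (\<lambda>n. section_seminorm (u n - x)) \<longlonglongrightarrow> 0"
    unfolding section_seminorm_def linear_diff[OF section_proj(1)] using section_proj(3)[OF v(1)]
    by (intro exI[of _ v]) simp
qed

lemma section_class_eq:
  assumes "u \<in> L" "v \<in> L" "AE x in M. u x = v x"
  shows "ae_rel M E p `` {u} = ae_rel M E p `` {v}"
proof -
  have "(AE x in M. u x = w x) \<longleftrightarrow> (AE x in M. v x = w x)" for w
  proof
    show "AE x in M. v x = w x" if "AE x in M. u x = w x"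
      using assms(3) that by eventually_elim simp
    show "AE x in M. u x = w x" if "AE x in M. v x = w x"
      using assms(3) that by eventually_elim simp
  qed
  then show ?thesis using assms(1,2) unfolding ae_rel_def by blast
qed

lemma section_class_self: "u \<in> L \<Longrightarrow> u \<in> ae_rel M E p `` {u}"
  by (simp add: ae_rel_def)

lemma section_classD: "u' \<in> ae_rel M E p `` {u} \<Longrightarrow> u' \<in> L \<and> (AE x in M. u x = u' x)"
  by (simp add: ae_rel_def)

text \<open>All representatives yield the same class, so each union defining an operation collapses
  to one class, and the set under \<open>the_elem\<close> to a singleton.\<close>

lemma reflexive_section_space_iff:
  "reflexive (section_space M E p) \<longleftrightarrow> reflexive_seminorm section_seminorm"
proof (rule reflexive_iff_reflexive_seminorm[OF seminorm_section_seminorm])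
  let ?T = "\<lambda>u. ae_rel M E p `` {section_proj u}"
  show "range ?T = points (section_space M E p)"
  proof -
    have "range ?T = (\<lambda>u. ae_rel M E p `` {u}) ` range section_proj" by (simp add: image_image)
    then show ?thesis unfolding section_proj(2) by (auto simp: section_space_def quotient_def)
  qed
  show "nadd (section_space M E p) (?T u) (?T v) = ?T (u + v)" for u v
  proof -
    let ?u = "section_proj u" and ?v = "section_proj v"
    have "ae_rel M E p `` {\<lambda>x. u' x + v' x} = ae_rel M E p `` {?u + ?v}" if "u' \<in> ?T u" "v' \<in> ?T v" for u' v'
    proof (rule section_class_eq)
      have u': "u' \<in> L" "AE x in M. ?u x = u' x" and v': "v' \<in> L" "AE x in M. ?v x = v' x"
        using section_classD[OF that(1)] section_classD[OF that(2)] by blast+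
      show "(\<lambda>x. u' x + v' x) \<in> L" using L_add(1)[OF u'(1) v'(1)] by (simp add: plus_fun_def)
      show "?u + ?v \<in> L" by (intro L_add section_proj_L)
      show "AE x in M. u' x + v' x = (?u + ?v) x" using u'(2) v'(2) by eventually_elim simp
    qed
    then have "(\<Union>u'\<in>?T u. \<Union>v'\<in>?T v. ae_rel M E p `` {\<lambda>x. u' x + v' x}) = ae_rel M E p `` {?u + ?v}"
      using section_class_self[OF section_proj_L] by blast
    then show ?thesis by (simp add: section_space_def linear_add[OF section_proj(1)])
  qed
  show "nscale (section_space M E p) c (?T u) = ?T (c *\<^sub>R u)" for c u
  proof -
    let ?u = "section_proj u"
    have "ae_rel M E p `` {\<lambda>x. c *\<^sub>R u' x} = ae_rel M E p `` {c *\<^sub>R ?u}" if "u' \<in> ?T u" for u'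
    proof (rule section_class_eq)
      have u': "u' \<in> L" "AE x in M. ?u x = u' x" using section_classD[OF that] by blast+
      show "(\<lambda>x. c *\<^sub>R u' x) \<in> L" using L_scale(1)[OF u'(1)] by (simp add: scaleR_fun_def)
      show "c *\<^sub>R ?u \<in> L" by (intro L_scale section_proj_L)
      show "AE x in M. c *\<^sub>R u' x = (c *\<^sub>R ?u) x" using u'(2) by eventually_elim simp
    qed
    then have "(\<Union>u'\<in>?T u. ae_rel M E p `` {\<lambda>x. c *\<^sub>R u' x}) = ae_rel M E p `` {c *\<^sub>R ?u}"
      using section_class_self[OF section_proj_L] by blast
    then show ?thesis by (simp add: section_space_def linear_scale[OF section_proj(1)])
  qed
  show "nnorm (section_space M E p) (?T u) = section_seminorm u" for u
  proof -
    have "p_norm M p u' = section_seminorm u" if "u' \<in> ?T u" for u'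
      using section_classD[OF that] p_norm_AE_cong[OF section_proj_L, of u' u] unfolding section_seminorm_def by simp
    then have "p_norm M p ` ?T u \<subseteq> {section_seminorm u}" by (intro image_subsetI) simp
    moreover have "p_norm M p ` ?T u \<noteq> {}" using section_class_self[OF section_proj_L[of u]] by force
    ultimately have "p_norm M p ` ?T u = {section_seminorm u}" by (simp only: subset_singleton_iff) simp
    then have "the_elem (p_norm M p ` ?T u) = section_seminorm u" by simp
    then show ?thesis by (simp add: section_space_def p_norm_def[abs_def] p_integral_def)
  qed
qed

end

section \<open>Reflexive fibres\<close>

lemma reflexive_subspace_space_iff:
  assumes P: "linear P" "range P = S" "\<And>x. x \<in> S \<Longrightarrow> P x = x"
  shows "reflexive (subspace_space S) \<longleftrightarrow> reflexive_seminorm (\<lambda>x. norm (P x))"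
  by (rule reflexive_iff_reflexive_seminorm[OF seminorm_norm_comp[OF P(1)], of P])
    (auto simp: subspace_space_def P(2) linear_add[OF P(1)] linear_scale[OF P(1)])

text \<open>Convergence along one norming sequence of the ambient space propagates to all
  functionals by reflexivity; composing with \<open>P\<close> restricts ambient functionals to
  \<open>S\<close>.\<close>

lemma reflexive_subspace_weak_limit:
  fixes z :: "nat \<Rightarrow> 'b::real_normed_vector" and \<omega> :: "nat \<Rightarrow> 'b \<Rightarrow> real"
  assumes S: "subspace S" and refl: "reflexive (subspace_space S)"
    and z: "\<And>n. z n \<in> S" "\<And>n. norm (z n) \<le> R"
    and \<omega>: "\<And>k. bounded_linear (\<omega> k)" "\<And>k b. \<bar>\<omega> k b\<bar> \<le> norm b" "\<And>b e. 0 < e \<Longrightarrow> \<exists>k. norm b - e < \<omega> k b"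
    and conv: "\<And>k. convergent (\<lambda>n. \<omega> k (z n))"
  obtains y where "y \<in> S" "\<And>f :: 'b \<Rightarrow> real. bounded_linear f \<Longrightarrow> (\<lambda>n. f (z n)) \<longlonglongrightarrow> f y"
proof -
  obtain P where P: "linear P" "range P = S" "\<And>x. x \<in> S \<Longrightarrow> P x = x"
    using linear_projection_onto[OF S] by blast
  let ?Q = "\<lambda>x. norm (P x)"
  have bf: "f \<circ> P \<in> bounded_functionals ?Q" if f: "bounded_linear f" for f :: "'b \<Rightarrow> real"
  proof -
    obtain K where K: "0 \<le> K" "\<And>x. norm (f x) \<le> norm x * K" using bounded_linear.nonneg_bounded[OF f] by blast
    show ?thesis
      using K by (intro bounded_functionalsI[of _ K] linear_compose P(1) bounded_linear.linear f)
        (auto simp: mult.commute)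
  qed
  have sep: "norm (P x) = 0" if "\<And>k. (\<omega> k \<circ> P) x = 0" for x
  proof (rule ccontr)
    assume "norm (P x) \<noteq> 0"
    then obtain k where "norm (P x) - norm (P x) < \<omega> k (P x)" using \<omega>(3)[of "norm (P x)" "P x"] by auto
    then show False using that[of k] by simp
  qed
  have zP: "P (z n) = z n" for n using z(1) P(3) by blast
  have "\<exists>x. \<forall>f\<in>bounded_functionals ?Q. (\<lambda>n. f (z n)) \<longlonglongrightarrow> f x"
  proof (rule reflexive_seminorm_weak_limit[OF seminorm_norm_comp[OF P(1)], of z R "\<lambda>k. \<omega> k \<circ> P"])
    show "reflexive_seminorm ?Q" using refl reflexive_subspace_space_iff[OF P] by simp
    show "norm (P (z n)) \<le> R" for n using z(2) zP by simp
    show "\<omega> k \<circ> P \<in> bounded_functionals ?Q" for k by (rule bf[OF \<omega>(1)])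
    show "convergent (\<lambda>n. (\<omega> k \<circ> P) (z n))" for k using conv zP by simp
    show "norm (P x) = 0" if "\<And>k. (\<omega> k \<circ> P) x = 0" for x using that by (rule sep)
  qed blast
  then obtain x where x: "\<And>f. f \<in> bounded_functionals ?Q \<Longrightarrow> (\<lambda>n. f (z n)) \<longlonglongrightarrow> f x"
    by blast
  have "(\<lambda>n. f (z n)) \<longlonglongrightarrow> f (P x)" if "bounded_linear f" for f :: "'b \<Rightarrow> real"
    using x[OF bf[OF that]] zP by simp
  moreover have "P x \<in> S" using P(2) by blast
  ultimately show ?thesis using that by blast
qed

lemma not_reflexive_subspace_james_sequence:
  fixes S :: "'b::banach set"
  assumes S: "subspace S" "closed S" and nr: "\<not> reflexive (subspace_space S)"
  obtains w \<theta> C where "0 < \<theta>" "\<And>k. w k \<in> S" "james_sequence norm \<theta> w" "\<And>k. norm (w k) \<le> C"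
proof -
  obtain P where P: "linear P" "range P = S" "\<And>x. x \<in> S \<Longrightarrow> P x = x"
    using linear_projection_onto[OF S(1)] by blast
  let ?Q = "\<lambda>x. norm (P x)"
  have compl: "complete_seminorm ?Q"
    unfolding complete_seminorm_def
  proof (intro allI impI)
    fix u :: "nat \<Rightarrow> 'b" assume *: "\<forall>e>0. \<exists>N. \<forall>m\<ge>N. \<forall>n\<ge>N. norm (P (u m - u n)) < e"
    have "Cauchy (\<lambda>n. P (u n))"
      using * unfolding linear_diff[OF P(1)] by (intro CauchyI) blast
    then obtain y where y: "(\<lambda>n. P (u n)) \<longlonglongrightarrow> y"
      using Cauchy_convergent unfolding convergent_def by blast
    have "y \<in> S" using closed_sequentially[OF S(2) _ y] P(2) by blast
    moreover have "(\<lambda>n. norm (P (u n) - y)) \<longlonglongrightarrow> 0"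
      by (rule tendsto_norm_zero[OF LIM_zero[OF y]])
    ultimately show "\<exists>x. (\<lambda>n. norm (P (u n - x))) \<longlonglongrightarrow> 0"
      by (intro exI[of _ y]) (simp add: linear_diff[OF P(1)] P(3))
  qed
  have "\<not> reflexive_seminorm ?Q" using nr reflexive_subspace_space_iff[OF P] by simp
  then show ?thesis
  proof (rule not_reflexive_imp_james_sequence[OF seminorm_norm_comp[OF P(1)] compl])
    fix w \<theta> C assume w: "0 < \<theta>" "james_sequence ?Q \<theta> w" "\<And>k. norm (P (w k)) \<le> C"
    have "james_sequence norm \<theta> (\<lambda>k. P (w k))"
      using w(2) unfolding james_sequence_def linear_diff[OF P(1)] linear_sum[OF P(1)] linear_scale[OF P(1)] .
    moreover have "P (w k) \<in> S" for k using P(2) by blast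
    ultimately show thesis using that[OF w(1), of "\<lambda>k. P (w k)" C] w(3) by simp
  qed
qed

section \<open>Convex blocks converging almost everywhere\<close>

lemma tail_combination_induct [consumes 1, case_names sum]:
  assumes "h \<in> tail_combinations g n"
    and "\<And>a m. (\<And>k. 0 \<le> a k) \<Longrightarrow> sum a {n..<m} = 1 \<Longrightarrow> P (\<Sum>k=n..<m. a k *\<^sub>R g k)"
  shows "P h"
  using assms by (auto simp: tail_combinations_def)

lemma convergent_if_geometric_steps:
  fixes f :: "nat \<Rightarrow> 'b::banach"
  assumes "\<And>i. norm (f (Suc i) - f i) \<le> C * (1/2) ^ i"
  shows "convergent f"
proof -
  have "summable (\<lambda>i. f (Suc i) - f i)"
    using assms by (intro summable_comparison_test[OF _ summable_mult[OF summable_geometric[of "1/2::real"]], of _ C]) auto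
  then have "convergent (\<lambda>n. \<Sum>i<n. f (Suc i) - f i)" by (simp add: summable_iff_convergent)
  then have "convergent (\<lambda>n. f n - f 0 + f 0)"
    unfolding sum_lessThan_telescope by (intro convergent_add convergent_const)
  then show ?thesis by simp
qed

lemma exp_midpoint_identity:
  "(exp (- t / 2) - exp (- s / 2))\<^sup>2 = exp (- s) + exp (- t) - 2 * exp (- (s / 2 + t / 2 :: real))"
proof -
  have sq: "exp (- r) = exp (- r / 2) * exp (- r / 2)" for r :: real
    unfolding exp_add[symmetric] by simp
  have mid: "exp (- (s / 2 + t / 2)) = exp (- s / 2) * exp (- t / 2)"
    unfolding exp_add[symmetric] by simp
  show ?thesis unfolding mid sq[of s] sq[of t] by (simp add: power2_eq_square algebra_simps)
qed

text \<open>
  The blocks nearly minimise the strictly convex functional \<open>\<integral> exp (- h)\<close>; midpoints quantify the strict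
  convexity because \<open>(exp (- s / 2) - exp (- t / 2))\<^sup>2\<close> is \<open>exp (- s) + exp (- t) - 2 exp (- (s + t) / 2)\<close>.
\<close>

lemma convex_block_limit:
  fixes g :: "nat \<Rightarrow> 'c \<Rightarrow> real"
  assumes fin: "finite_measure N" and meas [measurable]: "\<And>k. g k \<in> borel_measurable N"
    and nonneg: "\<And>k x. 0 \<le> g k x" and bound: "\<And>k. (\<integral>\<^sup>+x. ennreal (g k x) \<partial>N) \<le> ennreal C"
  obtains h where "\<And>n. h n \<in> tail_combinations g n" "AE x in N. convergent (\<lambda>n. h n x)"
proof -
  interpret finite_measure N by fact
  have comb: "h \<in> borel_measurable N \<and> (\<forall>x. 0 \<le> h x) \<and> (\<integral>\<^sup>+x. ennreal (h x) \<partial>N) \<le> ennreal C"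
    if "h \<in> tail_combinations g n" for h n
    using that
  proof (induction rule: tail_combination_induct)
    case (sum a m)
    have eq: "(\<Sum>k=n..<m. a k *\<^sub>R g k) = (\<lambda>x. \<Sum>k=n..<m. a k * g k x)" by (simp add: fun_eq_iff)
    have "(\<integral>\<^sup>+x. ennreal (\<Sum>k=n..<m. a k * g k x) \<partial>N) = (\<Sum>k=n..<m. ennreal (a k) * (\<integral>\<^sup>+x. ennreal (g k x) \<partial>N))"
      using sum nonneg by (simp add: sum_ennreal[symmetric] nn_integral_sum ennreal_mult nn_integral_cmult)
    also have "\<dots> \<le> (\<Sum>k=n..<m. ennreal (a k) * ennreal C)" by (intro sum_mono mult_left_mono bound) simp
    also have "\<dots> = ennreal C"
      using sum by (simp add: sum_distrib_right[symmetric] sum_ennreal)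
    finally show ?case unfolding eq using sum nonneg by (auto intro!: sum_nonneg)
  qed
  define J where "J h = (\<integral>x. exp (- h x) \<partial>N)" for h :: "'c \<Rightarrow> real"
  define K where "K = measure N (space N)"
  have int: "integrable N (\<lambda>x. exp (- h x))" and J_bounds: "0 \<le> J h" "J h \<le> K" if "h \<in> tail_combinations g n" for h n
  proof -
    have [measurable]: "h \<in> borel_measurable N" and h0: "\<And>x. 0 \<le> h x" using comb[OF that] by auto
    show int: "integrable N (\<lambda>x. exp (- h x))" using h0 by (intro integrable_const_bound[of _ 1]) auto
    show "0 \<le> J h" by (simp add: J_def)
    have "J h \<le> (\<integral>x. 1 \<partial>N)" unfolding J_def using h0 int by (intro integral_mono) auto
    then show "J h \<le> K" by (simp add: K_def)
  qed
  define d where "d n = (INF h\<in>tail_combinations g n. J h)" for n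
  have ne: "tail_combinations g n \<noteq> {}" for n using mem_tail_combinations[of n n g] by auto
  have bdd: "bdd_below (J ` tail_combinations g n)" for n using J_bounds(1) by (intro bdd_belowI2[of _ 0])
  have d_le: "d n \<le> J h" if "h \<in> tail_combinations g n" for n h
    unfolding d_def using bdd that by (rule cINF_lower)
  have d_mono: "d n \<le> d m" if "n \<le> m" for n m
    unfolding d_def by (rule cINF_superset_mono[OF ne bdd tail_combinations_antimono[OF that] order_refl])
  have dK: "d n \<le> K" for n using d_le[of _ n] J_bounds(2)[of _ n] ne[of n] order_trans by blast
  define D where "D = (SUP n. d n)"
  have bddD: "bdd_above (range d)" using dK by (intro bdd_aboveI2)
  have dD: "d n \<le> D" for n unfolding D_def using bddD by (intro cSUP_upper) auto
  \<comment> \<open>Three errors of size \<open>e i\<close> bound the integral of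
    \<open>\<Delta> i\<close> by \<open>(1/8) ^ i\<close>; the weight \<open>4 ^ i\<close>, the
    square of \<open>2 ^ i\<close>, then leaves \<open>(1/2) ^ i\<close>.\<close>
  define e :: "nat \<Rightarrow> real" where "e i = (1/8) ^ i / 3" for i
  have e: "0 < e i" "e (Suc i) \<le> e i" for i by (auto simp: e_def)
  have "\<exists>n. D - e i < d n" for i
    using less_cSUP_iff[OF _ bddD, of "D - e i"] e(1)[of i] unfolding D_def by auto
  then have "\<forall>i. \<exists>n. D - e i < d n" by blast
  from choice[OF this] obtain s where s: "\<And>i. D - e i < d (s i)" by blast
  define r where "r i = (\<Sum>j\<le>i. s j) + i" for i
  have r: "s i \<le> r i" "r i \<le> r (Suc i)" "i \<le> r i" for i
    using member_le_sum[of i "{..i}" s] by (auto simp: r_def)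
  have Dr: "D - e i < d (r i)" for i using s[of i] d_mono[OF r(1)[of i]] by simp
  have "\<exists>h\<in>tail_combinations g (r i). J h < d (r i) + e i" for i
    using cINF_less_iff[OF ne bdd, of "r i" "d (r i) + e i"] e(1)[of i] unfolding d_def by simp
  then have "\<forall>i. \<exists>h. h \<in> tail_combinations g (r i) \<and> J h < d (r i) + e i" by blast
  from choice[OF this] obtain h where h: "\<And>i. h i \<in> tail_combinations g (r i)" "\<And>i. J (h i) < d (r i) + e i"
    by blast
  have [measurable]: "h i \<in> borel_measurable N" and h0: "0 \<le> h i x"
    and hC: "(\<integral>\<^sup>+x. ennreal (h i x) \<partial>N) \<le> ennreal C" for i x
    using comb[OF h(1)] by auto
  define \<Delta> where "\<Delta> i x = (exp (- h (Suc i) x / 2) - exp (- h i x / 2))\<^sup>2" for i x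
  have "AE x in N. \<exists>B. \<forall>i. 4 ^ i * \<Delta> i x \<le> B"
  proof (rule AE_bounded_if_integrals_summable)
    show "(\<lambda>x. 4 ^ i * \<Delta> i x) \<in> borel_measurable N" for i unfolding \<Delta>_def by measurable
    fix i
    let ?m = "(1/2) *\<^sub>R h i + (1/2) *\<^sub>R h (Suc i)"
    have hS: "h (Suc i) \<in> tail_combinations g (r i)" using h(1) tail_combinations_antimono[OF r(2)] by blast
    have m: "?m \<in> tail_combinations g (r i)"
      using h(1)[of i] hS by (intro convexD[OF convex_tail_combinations]) auto
    have eq: "\<Delta> i x = exp (- h i x) + exp (- h (Suc i) x) - 2 * exp (- ?m x)" for x
      using exp_midpoint_identity[of "h (Suc i) x" "h i x"] by (simp add: \<Delta>_def add_divide_distrib)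
    have int\<Delta>: "integrable N (\<Delta> i)"
      unfolding eq[abs_def] using int[OF h(1)[of i]] int[OF hS] int[OF m] by simp
    have "(\<integral>x. \<Delta> i x \<partial>N) = J (h i) + J (h (Suc i)) - 2 * J ?m"
      unfolding eq J_def using int[OF h(1)[of i]] int[OF hS] int[OF m] by simp
    also have "\<dots> \<le> (d (r i) + e i) + (D + e i) - 2 * d (r i)"
      using h(2)[of i] h(2)[of "Suc i"] dD[of "r (Suc i)"] e(2)[of i] d_le[OF m] by linarith
    also have "\<dots> \<le> 3 * e i" using Dr[of i] by simp
    finally have "(\<integral>x. \<Delta> i x \<partial>N) \<le> (1/8) ^ i" by (simp add: e_def)
    then have "(\<integral>x. 4 ^ i * \<Delta> i x \<partial>N) \<le> 4 ^ i * (1/8) ^ i" by simp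
    also have "(4::real) ^ i * (1/8) ^ i = (4 * (1/8)) ^ i" by (rule power_mult_distrib[symmetric])
    finally have "(\<integral>x. 4 ^ i * \<Delta> i x \<partial>N) \<le> (1/2) ^ i" by simp
    moreover have "(\<integral>\<^sup>+x. ennreal (4 ^ i * \<Delta> i x) \<partial>N) = ennreal (\<integral>x. 4 ^ i * \<Delta> i x \<partial>N)"
      by (rule nn_integral_eq_integral[OF integrable_mult_right[OF int\<Delta>]]) (simp add: \<Delta>_def)
    ultimately show "(\<integral>\<^sup>+x. ennreal (4 ^ i * \<Delta> i x) \<partial>N) \<le> ennreal ((1/2) ^ i)" by (simp add: ennreal_leI)
  qed
  \<comment> \<open>Fatou keeps \<open>h i x\<close> from tending to infinity. That is the case in
    which \<open>exp (- h i x / 2)\<close> tends to 0, the only limit whose logarithm cannot be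
    taken.\<close>
  moreover have "AE x in N. liminf (\<lambda>i. ennreal (h i x)) \<noteq> \<infinity>"
  proof (rule nn_integral_PInf_AE)
    have "(\<integral>\<^sup>+x. liminf (\<lambda>i. ennreal (h i x)) \<partial>N) \<le> liminf (\<lambda>i. \<integral>\<^sup>+x. ennreal (h i x) \<partial>N)"
      by (rule nn_integral_liminf) measurable
    also have "\<dots> \<le> liminf (\<lambda>i::nat. ennreal C)"
      using hC by (intro Liminf_mono always_eventually allI)
    also have "\<dots> = ennreal C" by (simp add: Liminf_const)
    finally show "(\<integral>\<^sup>+x. liminf (\<lambda>i. ennreal (h i x)) \<partial>N) \<noteq> \<infinity>"
      using ennreal_less_top[of C] by (auto simp: top_unique)
  qed measurable
  ultimately have "AE x in N. convergent (\<lambda>n. h n x)"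
  proof eventually_elim
    case (elim x)
    then obtain B where B: "\<And>i. 4 ^ i * \<Delta> i x \<le> B" by blast
    have "norm (exp (- h (Suc i) x / 2) - exp (- h i x / 2)) \<le> sqrt B * (1/2) ^ i" for i
    proof -
      have "(2 ^ i * \<bar>exp (- h (Suc i) x / 2) - exp (- h i x / 2)\<bar>)\<^sup>2 = 4 ^ i * \<Delta> i x"
        by (simp add: \<Delta>_def power_mult_distrib power_mult[symmetric] mult.commute[of i] power_mult)
      then have "2 ^ i * \<bar>exp (- h (Suc i) x / 2) - exp (- h i x / 2)\<bar> \<le> sqrt B"
        using B[of i] by (intro real_le_rsqrt) simp
      then show ?thesis by (simp add: power_one_over field_simps)
    qed
    then have "convergent (\<lambda>i. exp (- h i x / 2))" by (rule convergent_if_geometric_steps)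
    then obtain l where l: "(\<lambda>i. exp (- h i x / 2)) \<longlonglongrightarrow> l" by (auto simp: convergent_def)
    have "l \<noteq> 0"
    proof
      assume "l = 0"
      have "filterlim (\<lambda>i. h i x) at_top sequentially"
        unfolding filterlim_at_top
      proof
        fix Z :: real
        have "eventually (\<lambda>i. exp (- h i x / 2) < exp (- Z / 2)) sequentially"
          using l \<open>l = 0\<close> by (intro order_tendstoD(2)) auto
        then show "eventually (\<lambda>i. Z \<le> h i x) sequentially" by eventually_elim simp
      qed
      then have "(\<lambda>i. ennreal (h i x)) \<longlonglongrightarrow> \<infinity>"
        by (rule ennreal_tendsto_top_eq_at_top[THEN iffD2, simplified infinity_ennreal_def[symmetric]])
      then show False using elim(2) lim_imp_Liminf[OF sequentially_bot] by blast
    qed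
    then have "(\<lambda>i. - 2 * ln (exp (- h i x / 2))) \<longlonglongrightarrow> - 2 * ln l"
      by (intro tendsto_intros l)
    then show "convergent (\<lambda>n. h n x)" by (auto simp: convergent_def)
  qed
  moreover have "h n \<in> tail_combinations g n" for n using h(1)[of n] tail_combinations_antimono[OF r(3)] by blast
  ultimately show ?thesis using that by blast
qed

section \<open>Densities of absolutely continuous signed set functions\<close>

context sigma_finite_measure
begin

text \<open>Domination by \<open>kap\<close> makes \<open>lam\<close> continuous at the empty set,
  hence a finite measure, and lets it vanish on null sets; Radon-Nikodym applies.\<close>

lemma positive_set_function_density:
  fixes lam kap :: "'a set \<Rightarrow> real"
  assumes add: "\<And>A B. A \<in> sets M \<Longrightarrow> B \<in> sets M \<Longrightarrow> A \<inter> B = {} \<Longrightarrow> lam (A \<union> B) = lam A + lam B"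
    and bounds: "\<And>A. A \<in> sets M \<Longrightarrow> 0 \<le> lam A" "\<And>A. A \<in> sets M \<Longrightarrow> lam A \<le> kap A"
    and cont: "\<And>A. range A \<subseteq> sets M \<Longrightarrow> decseq A \<Longrightarrow> (\<Inter>i. A i) = {} \<Longrightarrow> (\<lambda>i::nat. kap (A i)) \<longlonglongrightarrow> 0"
    and null: "\<And>A. A \<in> null_sets M \<Longrightarrow> kap A = 0"
  obtains \<rho> where "integrable M \<rho>" "\<And>A. A \<in> sets M \<Longrightarrow> lam A = (\<integral>x. indicator A x * \<rho> x \<partial>M)"
proof -
  have empty: "lam {} = 0" using add[of "{}" "{}"] by simp
  define N where "N = measure_of (space M) (sets M) (\<lambda>A. ennreal (lam A))"
  have pos: "positive (sets M) (\<lambda>A. ennreal (lam A))" by (simp add: positive_def empty)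
  have ca: "countably_additive (sets M) (\<lambda>A. ennreal (lam A))"
  proof (rule sets.empty_continuous_imp_countably_additive[OF pos])
    show "additive (sets M) (\<lambda>A. ennreal (lam A))"
      unfolding additive_def using add bounds by (auto simp: ennreal_plus)
    fix A :: "nat \<Rightarrow> 'a set" assume A: "range A \<subseteq> sets M" "decseq A" "(\<Inter>i. A i) = {}"
    have "(\<lambda>i. lam (A i)) \<longlonglongrightarrow> 0"
      using A(1) bounds by (intro tendsto_sandwich[OF _ _ tendsto_const cont[OF A]]) auto
    then show "(\<lambda>i. ennreal (lam (A i))) \<longlonglongrightarrow> 0" using tendsto_ennrealI by fastforce
  qed auto
  have sets_N: "sets N = sets M" and space_N: "space N = space M" by (auto simp: N_def)
  have em: "emeasure N A = ennreal (lam A)" if "A \<in> sets M" for A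
    unfolding N_def by (rule emeasure_measure_of_sigma[OF sets.sigma_algebra_axioms pos ca that])
  have "finite_measure N" by (rule finite_measureI) (simp add: space_N em)
  moreover have ac: "absolutely_continuous M N"
    unfolding absolutely_continuous_def
  proof
    fix A assume A: "A \<in> null_sets M"
    then have "lam A = 0" using null[OF A] bounds[of A] by (auto simp: null_sets_def)
    then show "A \<in> null_sets N" using A em[of A] by (auto simp: null_sets_def sets_N)
  qed
  ultimately obtain \<rho> where \<rho>: "\<rho> \<in> borel_measurable M" "AE x in M. RN_deriv M N x = ennreal (\<rho> x)" "\<And>x. 0 \<le> \<rho> x"
    using real_RN_deriv[OF _ _ sets_N] by metis
  note \<rho>(1)[measurable]
  have nn: "(\<integral>\<^sup>+x. ennreal (indicator A x * \<rho> x) \<partial>M) = ennreal (lam A)" if A: "A \<in> sets M" for A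
  proof -
    have "ennreal (lam A) = emeasure (density M (RN_deriv M N)) A"
      using density_RN_deriv[OF ac sets_N] em[OF A] by simp
    also have "\<dots> = (\<integral>\<^sup>+x. RN_deriv M N x * indicator A x \<partial>M)"
      using A by (intro emeasure_density) auto
    also have "\<dots> = (\<integral>\<^sup>+x. ennreal (indicator A x * \<rho> x) \<partial>M)"
      by (rule nn_integral_cong_AE, use \<rho>(2) in eventually_elim) (auto split: split_indicator)
    finally show ?thesis by simp
  qed
  show ?thesis
  proof (rule that[of \<rho>])
    have "(\<integral>\<^sup>+x. ennreal (\<rho> x) \<partial>M) = (\<integral>\<^sup>+x. ennreal (indicator (space M) x * \<rho> x) \<partial>M)"
      by (intro nn_integral_cong) simp
    also have "\<dots> < \<infinity>" by (simp add: nn)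
    finally show "integrable M \<rho>" using \<rho> by (intro integrableI_nonneg) auto
    show "lam A = (\<integral>x. indicator A x * \<rho> x \<partial>M)" if A: "A \<in> sets M" for A
    proof -
      have "(\<integral>x. indicator A x * \<rho> x \<partial>M) = enn2real (\<integral>\<^sup>+x. ennreal (indicator A x * \<rho> x) \<partial>M)"
        using \<rho> A by (intro integral_eq_nn_integral) auto
      then show ?thesis using bounds(1)[OF A] by (simp add: nn[OF A])
    qed
  qed
qed

text \<open>The signed set function is the difference of its positive variation and a nonnegative remainder.\<close>

lemma signed_set_function_density:
  fixes lam kap :: "'a set \<Rightarrow> real"
  assumes add: "\<And>A B. A \<in> sets M \<Longrightarrow> B \<in> sets M \<Longrightarrow> A \<inter> B = {} \<Longrightarrow> lam (A \<union> B) = lam A + lam B"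
    and bound: "\<And>A. A \<in> sets M \<Longrightarrow> \<bar>lam A\<bar> \<le> kap A"
    and mono: "\<And>A B. A \<in> sets M \<Longrightarrow> B \<in> sets M \<Longrightarrow> A \<subseteq> B \<Longrightarrow> kap A \<le> kap B"
    and cont: "\<And>A. range A \<subseteq> sets M \<Longrightarrow> decseq A \<Longrightarrow> (\<Inter>i. A i) = {} \<Longrightarrow> (\<lambda>i::nat. kap (A i)) \<longlonglongrightarrow> 0"
    and null: "\<And>A. A \<in> null_sets M \<Longrightarrow> kap A = 0"
  obtains \<rho> where "integrable M \<rho>" "\<And>A. A \<in> sets M \<Longrightarrow> lam A = (\<integral>x. indicator A x * \<rho> x \<partial>M)"
proof -
  define S where "S A = {B \<in> sets M. B \<subseteq> A}" for A
  define pos where "pos A = (SUP B\<in>S A. lam B)" for A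
  have le_kap: "lam B \<le> kap A" if "A \<in> sets M" "B \<in> S A" for A B
    using bound[of B] mono[of B A] that by (auto simp: S_def abs_le_iff)
  have ne: "{} \<in> S A" for A by (simp add: S_def)
  have bdd: "bdd_above (lam ` S A)" if "A \<in> sets M" for A
    using le_kap[OF that] by (intro bdd_aboveI2)
  have upper: "lam B \<le> pos A" if "A \<in> sets M" "B \<in> S A" for A B
    unfolding pos_def using bdd[OF that(1)] that(2) by (intro cSUP_upper)
  have empty: "lam {} = 0" using add[of "{}" "{}"] by simp
  have pos0: "0 \<le> pos A" if "A \<in> sets M" for A using upper[OF that ne] empty by simp
  have pos_kap: "pos A \<le> kap A" if "A \<in> sets M" for A
    unfolding pos_def using ne le_kap[OF that] by (intro cSUP_least) auto
  have pos_add: "pos (A \<union> B) = pos A + pos B" if A: "A \<in> sets M" and B: "B \<in> sets M" and disj: "A \<inter> B = {}" for A B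
  proof (rule antisym)
    show "pos (A \<union> B) \<le> pos A + pos B"
      unfolding pos_def[of "A \<union> B"]
    proof (rule cSUP_least)
      show "S (A \<union> B) \<noteq> {}" using ne by blast
      fix C assume C: "C \<in> S (A \<union> B)"
      then have C': "C \<in> sets M" "C = (C \<inter> A) \<union> (C \<inter> B)" by (auto simp: S_def)
      have "lam ((C \<inter> A) \<union> (C \<inter> B)) = lam (C \<inter> A) + lam (C \<inter> B)"
        using C'(1) A B disj by (intro add) auto
      also have "\<dots> \<le> pos A + pos B"
        using C'(1) A B by (intro add_mono upper) (auto simp: S_def)
      finally show "lam C \<le> pos A + pos B" using C'(2) by simp
    qed
    have *: "lam C + lam D \<le> pos (A \<union> B)" if "C \<in> S A" "D \<in> S B" for C D
    proof -
      have "lam (C \<union> D) = lam C + lam D" using that disj by (intro add) (auto simp: S_def)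
      moreover have "lam (C \<union> D) \<le> pos (A \<union> B)" using that A B by (intro upper) (auto simp: S_def)
      ultimately show ?thesis by simp
    qed
    have "pos A \<le> pos (A \<union> B) - lam D" if "D \<in> S B" for D
      unfolding pos_def[of A] using ne *[OF _ that] by (intro cSUP_least) (auto simp: algebra_simps)
    then have "lam D \<le> pos (A \<union> B) - pos A" if "D \<in> S B" for D using that by (simp add: algebra_simps)
    then have "pos B \<le> pos (A \<union> B) - pos A"
      unfolding pos_def[of B] using ne by (intro cSUP_least) auto
    then show "pos A + pos B \<le> pos (A \<union> B)" by simp
  qed
  \<comment> \<open>The remainder \<open>pos A - lam A\<close> is dominated by
    \<open>2 * kap A\<close>.\<close>
  have cont2: "(\<lambda>i. 2 * kap (A i)) \<longlonglongrightarrow> 0" if "range A \<subseteq> sets M" "decseq A" "(\<Inter>i::nat. A i) = {}" for A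
    using tendsto_mult_right_zero[OF cont[OF that]] .
  obtain \<rho>1 where \<rho>1: "integrable M \<rho>1" "\<And>A. A \<in> sets M \<Longrightarrow> pos A = (\<integral>x. indicator A x * \<rho>1 x \<partial>M)"
    using positive_set_function_density[of pos kap, OF pos_add pos0 pos_kap cont null] by blast
  have "pos A - lam A \<le> 2 * kap A" if "A \<in> sets M" for A
    using pos_kap[OF that] bound[OF that] by (simp add: abs_le_iff)
  moreover have "0 \<le> pos A - lam A" if "A \<in> sets M" for A
    using upper[OF that, of A] that by (simp add: S_def)
  ultimately obtain \<rho>2 where \<rho>2: "integrable M \<rho>2" "\<And>A. A \<in> sets M \<Longrightarrow> pos A - lam A = (\<integral>x. indicator A x * \<rho>2 x \<partial>M)"
    using positive_set_function_density[of "\<lambda>A. pos A - lam A" "\<lambda>A. 2 * kap A", OF _ _ _ cont2] add pos_add null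
    by (smt (verit, best))
  show ?thesis
  proof (rule that[of "\<lambda>x. \<rho>1 x - \<rho>2 x"])
    show "integrable M (\<lambda>x. \<rho>1 x - \<rho>2 x)" using \<rho>1 \<rho>2 by simp
    fix A assume A: "A \<in> sets M"
    have "lam A = (\<integral>x. indicator A x * \<rho>1 x \<partial>M) - (\<integral>x. indicator A x * \<rho>2 x \<partial>M)"
      using \<rho>1(2)[OF A] \<rho>2(2)[OF A] by linarith
    also have "\<dots> = (\<integral>x. indicator A x * (\<rho>1 x - \<rho>2 x) \<partial>M)"
      using integrable_mult_indicator[OF A \<rho>1(1)] integrable_mult_indicator[OF A \<rho>2(1)]
      by (simp add: right_diff_distrib)
    finally show "lam A = (\<integral>x. indicator A x * (\<rho>1 x - \<rho>2 x) \<partial>M)" .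
  qed
qed

end

section \<open>Averages over lists\<close>

text \<open>Averages over nonempty lists are the convex combinations with rational weights, a
  repeated index carrying more weight. There are countably many lists, so conditions on all averages
  stay measurable and countable unions can range over them.\<close>

definition list_average :: "(nat \<Rightarrow> 'v::real_vector) \<Rightarrow> nat list \<Rightarrow> 'v" where
  "list_average u l = (1 / real (length l)) *\<^sub>R (\<Sum>k\<leftarrow>l. u k)"

lemma linear_list_average: "linear f \<Longrightarrow> f (list_average u l) = list_average (\<lambda>k. f (u k)) l"
proof -
  assume f: "linear f"
  have "f (\<Sum>k\<leftarrow>l. u k) = (\<Sum>k\<leftarrow>l. f (u k))"
    by (induction l) (simp_all add: linear_0[OF f] linear_add[OF f])
  then show ?thesis unfolding list_average_def by (simp add: linear_scale[OF f])
qed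

lemma list_average_apply: "list_average u l x = list_average (\<lambda>k. u k x) l"
  unfolding list_average_def by (simp, induction l) auto

lemma list_average_ge:
  fixes u :: "nat \<Rightarrow> real"
  assumes "l \<noteq> []" "\<And>k. k \<in> set l \<Longrightarrow> \<eta> \<le> u k"
  shows "\<eta> \<le> list_average u l"
proof -
  have "real (length l) * \<eta> \<le> (\<Sum>k\<leftarrow>l. u k)"
    using assms(2) by (induction l) (auto simp: algebra_simps intro!: add_mono)
  then show ?thesis using assms(1) by (simp add: list_average_def field_simps)
qed

text \<open>Convex coefficients \<open>a\<close> are replaced by \<open>\<lfloor>N a\<rfloor>\<close> repetitions of each index.\<close>

lemma convex_combination_approx_list_average:
  fixes w :: "nat \<Rightarrow> 'b::real_normed_vector"
  assumes a: "\<And>k. 0 \<le> a k" "sum a {n..<m} = (1::real)" and e: "0 < e"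
  obtains l where "l \<noteq> []" "set l \<subseteq> {n..<m}" "norm ((\<Sum>k=n..<m. a k *\<^sub>R w k) - list_average w l) < e"
proof -
  define c where "c N k = nat \<lfloor>real N * a k\<rfloor>" for N k
  have c_lim: "(\<lambda>N. real (c N k) / real N) \<longlonglongrightarrow> a k" for k
  proof -
    have "real N * a k - 1 \<le> real (c N k)" "real (c N k) \<le> real N * a k" for N
      using a(1)[of k] by (auto simp: c_def)
    then have *: "(real N * a k - 1) / real N \<le> real (c N k) / real N" "real (c N k) / real N \<le> (real N * a k) / real N" for N
      by (intro divide_right_mono; simp)+
    have **: "a k - 1 / real N \<le> real (c N k) / real N" "real (c N k) / real N \<le> a k" if "0 < N" for N
      using *[of N] that by (simp_all add: diff_divide_distrib)
    have lower: "(\<lambda>N. a k - 1 / real N) \<longlonglongrightarrow> a k"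
      using tendsto_diff[OF tendsto_const lim_1_over_n, of "a k"] by simp
    show ?thesis
    proof (rule tendsto_sandwich[OF _ _ lower tendsto_const])
      show "eventually (\<lambda>N. a k - 1 / real N \<le> real (c N k) / real N) sequentially"
        using eventually_gt_at_top[of "0::nat"] by eventually_elim (rule **(1))
      show "eventually (\<lambda>N. real (c N k) / real N \<le> a k) sequentially"
        using eventually_gt_at_top[of "0::nat"] by eventually_elim (rule **(2))
    qed
  qed
  define s where "s N = (\<Sum>k=n..<m. real (c N k))" for N
  have s_lim: "(\<lambda>N. s N / real N) \<longlonglongrightarrow> 1"
    using tendsto_sum[of "{n..<m}" "\<lambda>k N. real (c N k) / real N" a sequentially] c_lim a(2)
    by (simp add: s_def sum_divide_distrib)
  \<comment> \<open>Rounding makes the length \<open>s N\<close> of the list differ from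
    \<open>N\<close>; the factor \<open>1 / (s N / real N)\<close>, which tends to 1, corrects
    this.\<close>
  have "(\<lambda>N. (1 / (s N / real N)) *\<^sub>R (\<Sum>k=n..<m. (real (c N k) / real N) *\<^sub>R w k))
    \<longlonglongrightarrow> (1 / 1) *\<^sub>R (\<Sum>k=n..<m. a k *\<^sub>R w k)"
    by (intro tendsto_intros c_lim s_lim) auto
  then have "eventually (\<lambda>N. dist ((1 / (s N / real N)) *\<^sub>R (\<Sum>k=n..<m. (real (c N k) / real N) *\<^sub>R w k))
      (\<Sum>k=n..<m. a k *\<^sub>R w k) < e) sequentially"
    using e by (auto dest: tendstoD)
  moreover have "eventually (\<lambda>N. 0 < s N / real N) sequentially"
    using s_lim by (intro order_tendstoD(1)) auto
  ultimately have "eventually (\<lambda>N. 0 < N \<and> 0 < s N / real N \<and>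
      dist ((1 / (s N / real N)) *\<^sub>R (\<Sum>k=n..<m. (real (c N k) / real N) *\<^sub>R w k))
      (\<Sum>k=n..<m. a k *\<^sub>R w k) < e) sequentially"
    using eventually_gt_at_top[of "0::nat"] by eventually_elim auto
  then obtain N where N: "0 < N" "0 < s N / real N"
    and close: "dist ((1 / (s N / real N)) *\<^sub>R (\<Sum>k=n..<m. (real (c N k) / real N) *\<^sub>R w k)) (\<Sum>k=n..<m. a k *\<^sub>R w k) < e"
    using eventually_happens'[OF sequentially_bot] by blast
  define l where "l = concat (map (\<lambda>k. replicate (c N k) k) [n..<m])"
  have sum_l: "(\<Sum>k\<leftarrow>l. f k) = (\<Sum>k=n..<m. real (c N k) *\<^sub>R f k)" for f :: "nat \<Rightarrow> 'c::real_vector"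
  proof -
    have rep: "sum_list (replicate j v) = real j *\<^sub>R v" for j and v :: 'c
      by (induction j) (auto simp: scaleR_add_left)
    have "(\<Sum>k\<leftarrow>concat (map (\<lambda>k. replicate (c N k) k) ks). f k) = (\<Sum>k\<leftarrow>ks. real (c N k) *\<^sub>R f k)" for ks
      by (induction ks) (auto simp: rep)
    then show ?thesis unfolding l_def by (simp add: interv_sum_list_conv_sum_set_nat)
  qed
  have len: "real (length l) = s N"
    using sum_l[of "\<lambda>k. 1::real"] by (simp add: s_def sum_list_triv)
  have "list_average w l = (1 / (s N / real N)) *\<^sub>R (\<Sum>k=n..<m. (real (c N k) / real N) *\<^sub>R w k)"
    unfolding list_average_def len sum_l using N
    by (simp add: scaleR_right.sum)
  then have "norm ((\<Sum>k=n..<m. a k *\<^sub>R w k) - list_average w l) < e"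
    using close by (simp add: dist_norm norm_minus_commute)
  moreover have "l \<noteq> []" using len N by (auto simp: zero_less_divide_iff)
  moreover have "set l \<subseteq> {n..<m}" by (auto simp: l_def)
  ultimately show ?thesis using that by blast
qed

text \<open>Mazur's lemma along the indices in \<open>J\<close>: if the convex combinations of the
  subsequence stayed away from 0, a separating functional would contradict weak convergence. Lists
  then replace the real weights.\<close>

lemma weakly_null_small_average:
  fixes z :: "nat \<Rightarrow> 'b::real_normed_vector"
  assumes weak: "\<And>f :: 'b \<Rightarrow> real. bounded_linear f \<Longrightarrow> (\<lambda>n. f (z n)) \<longlonglongrightarrow> 0"
    and J: "infinite J" and e: "0 < e"
  obtains l where "l \<noteq> []" "set l \<subseteq> J" "norm (list_average z l) < e"
proof -
  define z' where "z' n = z (enumerate J n)" for n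
  have "\<exists>b\<in>tail_combinations z' 0. norm b < e / 2"
  proof (rule ccontr)
    assume "\<not> ?thesis"
    then have "\<And>b. b \<in> tail_combinations z' 0 \<Longrightarrow> e / 2 \<le> norm b" by (auto simp: not_less)
    from seminorm_separation[OF seminorm_norm convex_tail_combinations this]
    obtain f where f: "linear f" "\<And>x. \<bar>f x\<bar> \<le> norm x" "\<And>b. b \<in> tail_combinations z' 0 \<Longrightarrow> e / 2 \<le> f b"
      by blast
    have "bounded_linear f" using f by (intro bounded_linear_intro[where K=1] linear_add linear_scale) auto
    then have "(\<lambda>n. f (z (enumerate J n))) \<longlonglongrightarrow> 0"
      using LIMSEQ_subseq_LIMSEQ[OF weak strict_mono_enumerate[OF J], of f] by (simp add: o_def)
    then have "e / 2 \<le> 0"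
      using f(3)[OF mem_tail_combinations] by (intro LIMSEQ_le_const) (auto simp: z'_def)
    then show False using e by simp
  qed
  then obtain b where b: "b \<in> tail_combinations z' 0" "norm b < e / 2" by blast
  obtain a m where a: "\<And>k. 0 \<le> a k" "sum a {0..<m} = 1" "b = (\<Sum>k=0..<m. a k *\<^sub>R z' k)"
    using b(1) by (blast elim: tail_combinationsE)
  obtain l where l: "l \<noteq> []" "set l \<subseteq> {0..<m}" "norm (b - list_average z' l) < e / 2"
    using convex_combination_approx_list_average[OF a(1,2) half_gt_zero[OF e], of z'] unfolding a(3) by blast
  have "list_average z' l = list_average z (map (enumerate J) l)"
    by (simp add: list_average_def z'_def o_def)
  then have "norm (list_average z (map (enumerate J) l)) < e"
    using b(2) l(3) norm_triangle_ineq4[of b "b - list_average z' l"] by simp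
  moreover have "set (map (enumerate J) l) \<subseteq> J" using enumerate_in_set[OF J] by auto
  ultimately show ?thesis using that[of "map (enumerate J) l"] l(1) by simp
qed

section \<open>Functionals on the section space\<close>

context Lp_bundle
begin

definition cut :: "'a set \<Rightarrow> ('a \<Rightarrow> 'b) \<Rightarrow> 'a \<Rightarrow> 'b" where
  "cut A u = (\<lambda>x. if x \<in> A then u x else 0)"

lemma cut_L:
  assumes "u \<in> L" and [measurable]: "A \<in> sets M"
  shows "cut A u \<in> L"
proof -
  have [measurable]: "u \<in> borel_measurable M" using assms(1) by (simp add: L_iff)
  show ?thesis
    by (rule L_dominated(1)[OF assms(1)])
      (use assms(1) subspace_0[OF fibre_subspace] in \<open>auto simp: cut_def L_iff\<close>)
qed

lemma p_norm_cut_mono: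
  assumes u: "u \<in> L" and A: "A \<in> sets M" and B: "B \<in> sets M" and AB: "A \<subseteq> B"
  shows "p_norm M p (cut A u) \<le> p_norm M p (cut B u)"
  by (rule L_dominated(2)[OF cut_L[OF u B]])
    (use cut_L[OF u A] AB in \<open>auto simp: cut_def L_iff\<close>)

lemma p_norm_cut_le:
  assumes u: "u \<in> L" and A: "A \<in> sets M"
  shows "p_norm M p (cut A u) \<le> p_norm M p u"
  by (rule L_dominated(2)[OF u])
    (use cut_L[OF u A] in \<open>auto simp: cut_def L_iff\<close>)

lemma p_norm_cut_tendsto_0:
  assumes u: "u \<in> L" and A: "\<And>n. A n \<in> sets M" and ev: "AE x in M. eventually (\<lambda>n. x \<notin> A n) sequentially"
  shows "(\<lambda>n. p_norm M p (cut (A n) u)) \<longlonglongrightarrow> 0"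
proof -
  have [measurable]: "u \<in> borel_measurable M" "\<And>n. A n \<in> sets M" using u A by (auto simp: L_iff)
  have "(\<lambda>n. p_integral M p (cut (A n) u)) \<longlonglongrightarrow> (\<integral>x. 0 \<partial>M)"
    unfolding p_integral_def
  proof (rule integral_dominated_convergence[OF _ _ L_integrable[OF u]])
    show "(\<lambda>x. norm (cut (A n) u x) powr p) \<in> borel_measurable M" for n unfolding cut_def by measurable
    show "AE x in M. (\<lambda>n. norm (cut (A n) u x) powr p) \<longlonglongrightarrow> 0"
      using ev
    proof eventually_elim
      case (elim x)
      then have "eventually (\<lambda>n. norm (cut (A n) u x) powr p = 0) sequentially"
        by eventually_elim (simp add: cut_def)
      then show ?case by (rule tendsto_eventually)
    qed
    show "AE x in M. norm (norm (cut (A n) u x) powr p) \<le> norm (u x) powr p" for n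
      by (simp add: cut_def)
  qed simp
  then show ?thesis
    using p unfolding p_norm_def by (intro tendsto_zero_powrI[where b = "1/p"]) (auto simp: p_integral_nonneg)
qed

lemma cut_add_disjoint: "A \<inter> B = {} \<Longrightarrow> cut (A \<union> B) u = cut A u + cut B u"
  by (auto simp: cut_def fun_eq_iff)

context
  fixes F :: "('a \<Rightarrow> 'b) \<Rightarrow> real"
  assumes F: "linear F" and F_le: "\<And>u. u \<in> L \<Longrightarrow> \<bar>F u\<bar> \<le> p_norm M p u"
begin

text \<open>The majorant of the set function is the \<open>p\<close>-norm of \<open>cut A u\<close>,
  continuous at the empty set by dominated convergence.\<close>

lemma functional_density:
  assumes u: "u \<in> L"
  obtains \<rho> where "integrable M \<rho>" "\<And>A. A \<in> sets M \<Longrightarrow> F (cut A u) = (\<integral>x. indicator A x * \<rho> x \<partial>M)"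
proof (rule signed_set_function_density[of "\<lambda>A. F (cut A u)" "\<lambda>A. p_norm M p (cut A u)"])
  show "F (cut (A \<union> B) u) = F (cut A u) + F (cut B u)" if "A \<inter> B = {}" for A B
    by (simp only: cut_add_disjoint[OF that] linear_add[OF F])
  show "\<bar>F (cut A u)\<bar> \<le> p_norm M p (cut A u)" if "A \<in> sets M" for A by (intro F_le cut_L u that)
  show "p_norm M p (cut A u) \<le> p_norm M p (cut B u)" if "A \<in> sets M" "B \<in> sets M" "A \<subseteq> B" for A B
    by (rule p_norm_cut_mono[OF u that])
  show "(\<lambda>i. p_norm M p (cut (A i) u)) \<longlonglongrightarrow> 0" if A: "range A \<subseteq> sets M" "decseq A" "(\<Inter>i::nat. A i) = {}" for A
  proof (rule p_norm_cut_tendsto_0[OF u])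
    have "eventually (\<lambda>n. x \<notin> A n) sequentially" for x
    proof -
      obtain n where "x \<notin> A n" using A(3) by blast
      then have "\<forall>m\<ge>n. x \<notin> A m" using decseqD[OF A(2)] by blast
      then show ?thesis by (auto simp: eventually_sequentially)
    qed
    then show "AE x in M. eventually (\<lambda>n. x \<notin> A n) sequentially" by simp
  qed (use A in auto)
  show "p_norm M p (cut A u) = 0" if A: "A \<in> null_sets M" for A
  proof -
    have "(\<lambda>n::nat. p_norm M p (cut A u)) \<longlonglongrightarrow> 0"
      using A AE_not_in[OF A] by (intro p_norm_cut_tendsto_0 u) (auto elim: eventually_mono)
    then show ?thesis by (simp add: LIMSEQ_const_iff)
  qed
qed (rule that)

text \<open>
  Otherwise \<open>m\<close> pieces with disjoint supports, each of norm at most \<open>R\<close>, would add up to a section of norm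
  \<open>O(m powr (1 / p))\<close> on which \<open>F\<close> grows linearly in \<open>m\<close>. This is where \<open>p > 1\<close> enters.
\<close>

lemma functional_order_continuous:
  assumes B: "\<And>n. B n \<in> sets M" "decseq B" and ev: "AE x in M. eventually (\<lambda>n. x \<notin> B n) sequentially"
    and \<delta>: "0 < \<delta>" and R: "0 \<le> R"
  shows "\<exists>n::nat. \<forall>v\<in>L. p_norm M p v \<le> R \<longrightarrow> \<bar>F (cut (B n) v)\<bar> \<le> \<delta>"
proof (rule ccontr)
  assume "\<not> ?thesis"
  then have ex: "\<exists>v\<in>L. p_norm M p v \<le> R \<and> \<delta> < \<bar>F (cut (B n) v)\<bar>" for n by (auto simp: not_le)
  have pos: "\<exists>v\<in>L. p_norm M p v \<le> R \<and> \<delta> < F (cut (B n) v)" for n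
  proof -
    obtain v where v: "v \<in> L" "p_norm M p v \<le> R" "\<delta> < \<bar>F (cut (B n) v)\<bar>" using ex by blast
    show ?thesis
    proof (cases "0 \<le> F (cut (B n) v)")
      case True
      then show ?thesis using v by auto
    next
      case False
      have "cut (B n) ((-1) *\<^sub>R v) = (-1) *\<^sub>R cut (B n) v" by (auto simp: cut_def fun_eq_iff)
      then have "F (cut (B n) ((-1) *\<^sub>R v)) = - F (cut (B n) v)"
        using linear_scale[OF F, of "-1" "cut (B n) v"] by (simp only:) simp
      then show ?thesis using v False L_scale[OF v(1), of "-1"] by (intro bexI[of _ "(-1) *\<^sub>R v"]) auto
    qed
  qed
  \<comment> \<open>The sum \<open>z\<close> built so far vanishes on \<open>B N\<close>, so a
    further piece supported in \<open>B N\<close> is disjoint from it and the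
    \<open>p\<close>-integrals add.\<close>
  have grow: "\<exists>N\<ge>n0. \<exists>z\<in>L. (\<forall>x. x \<in> B N \<longrightarrow> z x = 0) \<and> p_integral M p z \<le> real m * R powr p \<and> real m * (\<delta> / 2) \<le> F z"
    for m n0
  proof (induction m)
    case 0
    have "p_integral M p (0 :: 'a \<Rightarrow> 'b) = 0" using p by (simp add: p_integral_def)
    then show ?case
      using subspace_0[OF subspace_L] linear_0[OF F] unfolding zero_fun_def
      by (intro exI[of _ n0] conjI bexI[of _ "\<lambda>x. 0"]) auto
  next
    case (Suc m)
    then obtain N z where N: "n0 \<le> N" and z: "z \<in> L" "\<And>x. x \<in> B N \<Longrightarrow> z x = 0"
        "p_integral M p z \<le> real m * R powr p" "real m * (\<delta> / 2) \<le> F z"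
      by blast
    obtain v where v: "v \<in> L" "p_norm M p v \<le> R" "\<delta> < F (cut (B N) v)" using pos by blast
    have "(\<lambda>n. p_norm M p (cut (B n) v)) \<longlonglongrightarrow> 0" by (rule p_norm_cut_tendsto_0[OF v(1) B(1) ev])
    then have "eventually (\<lambda>n. p_norm M p (cut (B n) v) < \<delta> / 2) sequentially"
      using \<delta> by (intro order_tendstoD) auto
    then obtain n1 where n1: "\<And>n. n1 \<le> n \<Longrightarrow> p_norm M p (cut (B n) v) < \<delta> / 2" by (auto simp: eventually_sequentially)
    \<comment> \<open>Removing the part of \<open>v\<close> on \<open>B N'\<close> costs at most
      half of \<open>\<delta>\<close> and leaves \<open>B N'\<close> free for the next
      piece.\<close>
    define N' where "N' = max N n1"
    have BB: "B N' \<subseteq> B N" using decseqD[OF B(2)] by (auto simp: N'_def)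
    let ?v = "cut (B N - B N') v"
    have vL: "?v \<in> L" using B(1) by (intro cut_L v(1)) auto
    have "cut (B N) v = ?v + cut (B N') v" using BB by (auto simp: cut_def fun_eq_iff)
    then have "F ?v = F (cut (B N) v) - F (cut (B N') v)" by (simp add: linear_add[OF F] del: plus_fun_apply)
    moreover have "F (cut (B N') v) \<le> \<delta> / 2"
      using F_le[OF cut_L[OF v(1) B(1)], of N'] n1[of N'] by (auto simp: N'_def abs_le_iff)
    ultimately have Fv: "\<delta> / 2 \<le> F ?v" using v(3) by simp
    have "p_integral M p (z + ?v) = p_integral M p z + p_integral M p ?v"
    proof -
      have "norm ((z + ?v) x) powr p = norm (z x) powr p + norm (?v x) powr p" for x
        using z(2)[of x] p by (auto simp: cut_def)
      then show ?thesis
        unfolding p_integral_def using L_integrable[OF z(1)] L_integrable[OF vL] by simp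
    qed
    moreover have "p_integral M p ?v \<le> R powr p"
      using p_norm_cut_le[OF v(1), of "B N - B N'"] v(2) B(1) p_norm_le_iff[OF R, of ?v] by auto
    moreover define z' where "z' = z + ?v"
    moreover have "z + ?v \<in> L" using z(1) vL by (rule L_add)
    moreover have "z' x = 0" if "x \<in> B N'" for x using that z(2) BB by (auto simp: cut_def z'_def)
    moreover have "F (z + ?v) = F z + F ?v" by (rule linear_add[OF F])
    moreover have "n0 \<le> N'" using N by (simp add: N'_def)
    ultimately show ?case
      using z(3,4) Fv unfolding z'_def[symmetric]
      by (intro exI[of _ N'] conjI bexI[of _ z']) (auto simp: algebra_simps)
  qed
  have bound: "real m powr (1 - 1 / p) * (\<delta> / 2) \<le> R" if m: "0 < m" for m :: nat
  proof -
    obtain z where z: "z \<in> L" "p_integral M p z \<le> real m * R powr p" "real m * (\<delta> / 2) \<le> F z"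
      using grow[of 0 m] by blast
    have "p_norm M p z \<le> real m powr (1 / p) * R"
      using z(2) R p by (subst p_norm_le_iff) (auto simp: powr_mult powr_powr)
    then have "real m * (\<delta> / 2) \<le> real m powr (1 / p) * R"
      using z(3) F_le[OF z(1)] by (auto simp: abs_le_iff)
    then have "real m * (\<delta> / 2) / real m powr (1 / p) \<le> R" using m by (simp add: field_simps)
    then show ?thesis using m by (simp add: powr_diff field_simps)
  qed
  \<comment> \<open>Once \<open>m powr (1 - 1 / p)\<close> reaches \<open>?t\<close>, the bound
    reads \<open>R + \<delta> / 2 \<le> R\<close>.\<close>
  let ?t = "2 * R / \<delta> + 1" and ?s = "1 - 1 / p"
  have t: "0 < ?t" using R \<delta> by (simp add: add_nonneg_pos)
  have s: "0 < ?s" using p by simp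
  obtain m :: nat where m: "?t powr (1 / ?s) \<le> real m" using real_arch_simple by blast
  have "?t = (?t powr (1 / ?s)) powr ?s" using t s p by (simp add: powr_powr)
  also have "\<dots> \<le> real m powr ?s" using m s by (intro powr_mono2) auto
  finally have m2: "?t \<le> real m powr ?s" .
  then have m0: "0 < m" using t by (cases "m = 0") auto
  have "(2 * R / \<delta> + 1) * (\<delta> / 2) \<le> real m powr (1 - 1 / p) * (\<delta> / 2)"
    using m2 \<delta> by (intro mult_right_mono) auto
  then have "R + \<delta> / 2 \<le> R" using bound[OF m0] \<delta> by (simp add: algebra_simps)
  then show False using \<delta> by simp
qed

end

end

section \<open>Reflexive fibres imply a reflexive section space\<close>

lemma tail_combinations_family:
  assumes "\<And>n. y n \<in> tail_combinations w n"
  obtains a m where "\<And>n k. 0 \<le> a n k" "\<And>n. sum (a n) {n..<m n} = 1" "\<And>n. y n = (\<Sum>k=n..<m n. a n k *\<^sub>R w k)"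
proof -
  have "\<forall>n. \<exists>a m. (\<forall>k. 0 \<le> a k) \<and> sum a {n..<m} = 1 \<and> y n = (\<Sum>k=n..<m. a k *\<^sub>R w k)"
    using assms unfolding tail_combinations_def by blast
  from choice[OF this] obtain a where "\<forall>n. \<exists>m. (\<forall>k. 0 \<le> a n k) \<and> sum (a n) {n..<m} = 1 \<and> y n = (\<Sum>k=n..<m. a n k *\<^sub>R w k)"
    by (rule exE)
  from choice[OF this] show ?thesis using that by blast
qed

text \<open>Convex blocks and measurable hulls are available for finite measures; passing to this
  one changes no null sets.\<close>

lemma (in sigma_finite_measure) ex_equivalent_finite_measure:
  obtains f :: "'a \<Rightarrow> real" where "f \<in> borel_measurable M" "\<And>x. 0 < f x" "\<And>x. f x \<le> 1" "integrable M f"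
    "finite_measure (density M (\<lambda>x. ennreal (f x)))"
    "\<And>P. (AE x in density M (\<lambda>x. ennreal (f x)). P x) \<longleftrightarrow> (AE x in M. P x)"
proof -
  obtain f :: "'a \<Rightarrow> real" where f [measurable]: "f \<in> borel_measurable M"
    and f': "\<And>x. 0 < f x" "\<And>x. f x \<le> 1" "integrable M f"
    using obtain_positive_integrable_function by blast
  have "emeasure (density M (\<lambda>x. ennreal (f x))) (space M) = (\<integral>\<^sup>+x. ennreal (f x) \<partial>M)"
    by (simp add: emeasure_density cong: nn_integral_cong)
  also have "\<dots> = ennreal (\<integral>x. f x \<partial>M)" using f' by (intro nn_integral_eq_integral) (auto intro: less_imp_le)
  finally have fin: "finite_measure (density M (\<lambda>x. ennreal (f x)))" by (intro finite_measureI) simp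
  have AE: "(AE x in density M (\<lambda>x. ennreal (f x)). P x) \<longleftrightarrow> (AE x in M. P x)" for P
    by (subst AE_density) (simp_all add: f')
  show ?thesis by (rule that[OF f f' fin AE])
qed

context Lp_bundle
begin

lemma tail_combination_L:
  assumes w: "\<And>k. w k \<in> L" "\<And>k. p_norm M p (w k) \<le> R" and y: "y \<in> tail_combinations w n"
  shows "y \<in> L" "p_norm M p y \<le> R"
proof -
  obtain a m where a: "\<And>k. 0 \<le> a k" "sum a {n..<m} = 1" "y = (\<Sum>k=n..<m. a k *\<^sub>R w k)"
    using y by (blast elim: tail_combinationsE)
  show yL: "y \<in> L" unfolding a(3) by (intro subspace_sum subspace_scale subspace_L w)
  have "section_seminorm y \<le> (\<Sum>k=n..<m. section_seminorm (a k *\<^sub>R w k))"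
    unfolding a(3) by (rule seminorm_sum[OF seminorm_section_seminorm])
  also have "\<dots> \<le> (\<Sum>k=n..<m. a k * R)"
  proof (rule sum_mono)
    fix k
    show "section_seminorm (a k *\<^sub>R w k) \<le> a k * R"
      using mult_left_mono[OF w(2)[of k] a(1)[of k]] a(1)[of k]
      by (simp add: seminorm_scale[OF seminorm_section_seminorm] section_seminorm_L[OF w(1)])
  qed
  also have "\<dots> = R" by (simp add: sum_distrib_right[symmetric] a(2))
  finally show "p_norm M p y \<le> R" by (simp add: section_seminorm_L[OF yL])
qed

text \<open>
  All functionals \<open>\<omega> j\<close> are treated at once by convex blocks over the product of the base, with an equivalent
  finite measure, and a finite measure on \<open>\<nat>\<close>; adding the norm makes the scalar functions nonnegative.
\<close>

lemma ex_pointwise_convergent_blocks: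
  fixes \<omega> :: "nat \<Rightarrow> 'b \<Rightarrow> real"
  assumes w: "\<And>k. w k \<in> L" "\<And>k. p_norm M p (w k) \<le> R"
    and \<omega>: "\<And>k. bounded_linear (\<omega> k)" "\<And>k b. \<bar>\<omega> k b\<bar> \<le> norm b"
  obtains y where "\<And>n. y n \<in> tail_combinations w n"
    and "AE x in M. (\<forall>j. convergent (\<lambda>n. \<omega> j (y n x))) \<and> (\<exists>B. \<forall>n. norm (y n x) \<le> B)"
proof -
  have [measurable]: "w k \<in> borel_measurable M" for k using w(1) by (simp add: L_iff)
  have [measurable]: "\<omega> k \<in> borel_measurable borel" for k
    by (intro borel_measurable_continuous_onI linear_continuous_on \<omega>)
  have R: "0 \<le> R" using w(2)[of 0] p_norm_nonneg order_trans by blast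
  obtain f :: "'a \<Rightarrow> real" where f [measurable]: "f \<in> borel_measurable M"
    and f': "\<And>x. 0 < f x" "\<And>x. f x \<le> 1" "integrable M f"
    and fin1': "finite_measure (density M (\<lambda>x. ennreal (f x)))"
    and AE1': "\<And>P. (AE x in density M (\<lambda>x. ennreal (f x)). P x) \<longleftrightarrow> (AE x in M. P x)"
    by (rule ex_equivalent_finite_measure) (rule that)
  define N1 where "N1 = density M (\<lambda>x. ennreal (f x))"
  \<comment> \<open>The weights make this a measure of total mass 2 in which a property holding
    almost everywhere holds at every \<open>j\<close>.\<close>
  define N2 where "N2 = density (count_space UNIV) (\<lambda>j::nat. ennreal ((1/2) ^ j))"
  have AE2: "(AE j in N2. Pr j) \<longleftrightarrow> (\<forall>j. Pr j)" for Pr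
    unfolding N2_def by (subst AE_density) (simp_all add: AE_count_space)
  have AE1: "(AE x in N1. Pr x) \<longleftrightarrow> (AE x in M. Pr x)" for Pr unfolding N1_def by (rule AE1')
  have fin1: "finite_measure N1" unfolding N1_def by (rule fin1')
  have em2: "emeasure N2 UNIV = 2"
  proof -
    have "emeasure N2 UNIV = (\<Sum>j. ennreal ((1/2) ^ j))"
      by (simp add: N2_def emeasure_density nn_integral_count_space_nat)
    also have "\<dots> = ennreal (\<Sum>j. (1/2) ^ j)" by (intro suminf_ennreal2) (auto simp: summable_geometric)
    finally show ?thesis using suminf_geometric[of "1/2::real"] by simp
  qed
  have fin2: "finite_measure N2" by (rule finite_measureI) (simp add: N2_def em2[unfolded N2_def])
  interpret N1: finite_measure N1 by fact
  interpret N2: finite_measure N2 by fact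
  interpret pair_sigma_finite N1 N2 ..
  have fin: "finite_measure (N1 \<Otimes>\<^sub>M N2)" by (rule finite_measure_pair_measure[OF fin2 fin1])
  have sets1 [measurable_cong]: "sets N1 = sets M" by (simp add: N1_def)
  have sets2 [measurable_cong]: "sets N2 = sets (count_space UNIV)" by (simp add: N2_def)
  \<comment> \<open>The index 0 records the norm alone; subtracting its blocks from those at
    \<open>Suc i\<close> isolates \<open>\<omega> i\<close>.\<close>
  define G where "G k j x = norm (w k x) + (case j of 0 \<Rightarrow> 0 | Suc i \<Rightarrow> \<omega> i (w k x))" for k j x
  define g where "g k z = G k (snd z) (fst z)" for k z
  have Gm: "G k j \<in> borel_measurable M" for k j unfolding G_def by (cases j) simp_all
  have gm: "g k \<in> borel_measurable (N1 \<Otimes>\<^sub>M N2)" for k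
    unfolding g_def[abs_def]
  proof (rule measurable_compose_countable)
    show "(\<lambda>z. G k j (fst z)) \<in> borel_measurable (N1 \<Otimes>\<^sub>M N2)" for j
      using Gm[of k j] by measurable
  qed measurable
  have G0: "0 \<le> G k j x" and G2: "G k j x \<le> 2 * norm (w k x)" for k j x
    using \<omega>(2)[of "j - 1" "w k x"] by (cases j; auto simp: G_def abs_le_iff)+
  have g0: "0 \<le> g k z" for k z by (simp add: g_def G0)
  \<comment> \<open>The constant 4 is the factor 2 from \<open>G2\<close> times the mass 2 of
    \<open>N2\<close>; the rest is
    \<open>f x * norm (w k x) \<le> f x + norm (w k x) powr p\<close>.\<close>
  have bound: "(\<integral>\<^sup>+z. ennreal (g k z) \<partial>(N1 \<Otimes>\<^sub>M N2)) \<le> ennreal (4 * ((\<integral>x. f x \<partial>M) + R powr p))" for k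
  proof -
    have "(\<integral>\<^sup>+z. ennreal (g k z) \<partial>(N1 \<Otimes>\<^sub>M N2)) \<le> (\<integral>\<^sup>+z. ennreal (2 * norm (w k (fst z))) \<partial>(N1 \<Otimes>\<^sub>M N2))"
      by (intro nn_integral_mono ennreal_leI) (simp add: g_def G2)
    also have "\<dots> = (\<integral>\<^sup>+x. \<integral>\<^sup>+j. ennreal (2 * norm (w k x)) \<partial>N2 \<partial>N1)"
      by (subst N2.nn_integral_fst[symmetric]) simp_all
    also have "\<dots> = (\<integral>\<^sup>+x. ennreal (4 * norm (w k x)) \<partial>N1)"
    proof (rule nn_integral_cong)
      fix x
      have "space N2 = UNIV" by (simp add: N2_def)
      then have "(\<integral>\<^sup>+j. ennreal (2 * norm (w k x)) \<partial>N2) = ennreal (2 * norm (w k x)) * ennreal 2"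
        by (simp add: em2)
      then show "(\<integral>\<^sup>+j. ennreal (2 * norm (w k x)) \<partial>N2) = ennreal (4 * norm (w k x))"
        by (simp add: ennreal_mult[symmetric] del: ennreal_numeral)
    qed
    also have "\<dots> = (\<integral>\<^sup>+x. ennreal (f x) * ennreal (4 * norm (w k x)) \<partial>M)"
      by (simp add: N1_def nn_integral_density)
    also have "\<dots> \<le> (\<integral>\<^sup>+x. ennreal (4 * (f x + norm (w k x) powr p)) \<partial>M)"
    proof (rule nn_integral_mono)
      fix x
      have "f x * norm (w k x) \<le> f x + norm (w k x) powr p"
      proof (cases "norm (w k x) \<le> 1")
        case True
        then have "f x * norm (w k x) \<le> f x * 1" using f'(1)[of x] by (intro mult_left_mono) auto
        then show ?thesis by (simp add: add_increasing2)
      next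
        case False
        then have "norm (w k x) powr 1 \<le> norm (w k x) powr p" using p by (intro powr_mono) auto
        then have "norm (w k x) \<le> norm (w k x) powr p" using False by simp
        moreover have "f x * norm (w k x) \<le> 1 * norm (w k x)" using f'(2)[of x] by (intro mult_right_mono) auto
        ultimately show ?thesis using f'(1)[of x] by simp
      qed
      then have "f x * (4 * norm (w k x)) \<le> 4 * (f x + norm (w k x) powr p)" by simp
      moreover have "ennreal (f x) * ennreal (4 * norm (w k x)) = ennreal (f x * (4 * norm (w k x)))"
        using f'(1)[of x] by (simp add: ennreal_mult)
      ultimately show "ennreal (f x) * ennreal (4 * norm (w k x)) \<le> ennreal (4 * (f x + norm (w k x) powr p))"
        by (simp only: ennreal_leI)
    qed
    also have "\<dots> = ennreal (4 * ((\<integral>x. f x \<partial>M) + p_integral M p (w k)))"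
    proof -
      have "integrable M (\<lambda>x. 4 * (f x + norm (w k x) powr p))" using f'(3) L_integrable[OF w(1)] by simp
      moreover have "(\<integral>x. 4 * (f x + norm (w k x) powr p) \<partial>M) = 4 * ((\<integral>x. f x \<partial>M) + p_integral M p (w k))"
        using f'(3) L_integrable[OF w(1)] by (simp add: p_integral_def)
      moreover have "0 \<le> 4 * (f x + norm (w k x) powr p)" for x using f'(1)[of x] by (simp add: less_imp_le)
      ultimately show ?thesis by (simp only: nn_integral_eq_integral AE_I2)
    qed
    also have "\<dots> \<le> ennreal (4 * ((\<integral>x. f x \<partial>M) + R powr p))"
      using w(2)[of k] p_norm_le_iff[OF R, of "w k"] by (intro ennreal_leI) simp
    finally show ?thesis .
  qed
  obtain h where h: "\<And>n. h n \<in> tail_combinations g n" and lim: "AE z in (N1 \<Otimes>\<^sub>M N2). convergent (\<lambda>n. h n z)"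
    by (rule convex_block_limit[OF fin gm g0 bound]) (rule that)
  obtain a m where am: "\<And>n k. 0 \<le> a n k" "\<And>n. sum (a n) {n..<m n} = 1" "\<And>n. h n = (\<Sum>k=n..<m n. a n k *\<^sub>R g k)"
    by (rule tail_combinations_family[OF h]) (rule that)
  define y where "y n = (\<Sum>k=n..<m n. a n k *\<^sub>R w k)" for n
  have "y n \<in> tail_combinations w n" for n
    unfolding tail_combinations_def y_def using am(1,2)[of n] by (intro CollectI exI[of _ "a n"] exI[of _ "m n"]) simp
  moreover have "AE x in M. (\<forall>j. convergent (\<lambda>n. \<omega> j (y n x))) \<and> (\<exists>B. \<forall>n. norm (y n x) \<le> B)"
  proof -
    have "AE x in N1. AE j in N2. convergent (\<lambda>n. h n (x, j))" by (rule AE_pair[OF lim])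
    then have "AE x in N1. \<forall>j. convergent (\<lambda>n. h n (x, j))" by (simp only: AE2)
    then have "AE x in M. \<forall>j. convergent (\<lambda>n. h n (x, j))"
      by (simp only: AE1)
    then show ?thesis
    proof eventually_elim
      case (elim x)
      define s where "s n = (\<Sum>k=n..<m n. a n k * norm (w k x))" for n
      have h0: "h n (x, 0) = s n" for n by (simp add: am(3) s_def g_def G_def)
      have hS: "h n (x, Suc j) = s n + \<omega> j (y n x)" for n j
      proof -
        have "\<omega> j (y n x) = (\<Sum>k=n..<m n. a n k * \<omega> j (w k x))"
          by (simp add: y_def linear_sum[OF bounded_linear.linear[OF \<omega>(1)]] linear_scale[OF bounded_linear.linear[OF \<omega>(1)]])
        then show ?thesis by (simp add: am(3) s_def g_def G_def sum.distrib distrib_left)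
      qed
      have s: "convergent s" using elim[rule_format, of 0] by (simp add: h0)
      have "convergent (\<lambda>n. \<omega> j (y n x))" for j
        using convergent_diff[OF elim[rule_format, of "Suc j"] s] by (simp add: hS)
      moreover obtain B where "\<And>n. norm (s n) \<le> B" using convergent_imp_Bseq[OF s] by (auto simp: Bseq_def)
      moreover have "norm (y n x) \<le> s n" for n
        unfolding y_def s_def using am(1)[of n] by (auto intro!: order_trans[OF norm_sum] sum_mono)
      ultimately show ?case by (metis order_trans norm_ge_zero abs_of_nonneg real_norm_def)
    qed
  qed
  ultimately show ?thesis using that by blast
qed

text \<open>The weak limits are chosen point by point. Measurability is recovered because each
  \<open>\<omega> k (v x)\<close> is a limit of measurable functions, and integrability from weak
  lower semicontinuity of the norm together with Fatou.\<close>

lemma ex_weak_limit_section: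
  fixes \<omega> :: "nat \<Rightarrow> 'b \<Rightarrow> real"
  assumes refl: "reflexive_bundle M E" and y: "\<And>n. y n \<in> L" "\<And>n. p_norm M p (y n) \<le> R"
    and \<omega>: "\<And>k. bounded_linear (\<omega> k)" "\<And>k b. \<bar>\<omega> k b\<bar> \<le> norm b" "\<And>b e. 0 < e \<Longrightarrow> \<exists>k. norm b - e < \<omega> k b"
    and conv: "AE x in M. (\<forall>j. convergent (\<lambda>n. \<omega> j (y n x))) \<and> (\<exists>B. \<forall>n. norm (y n x) \<le> B)"
  obtains v where "v \<in> L" "AE x in M. \<forall>f :: 'b \<Rightarrow> real. bounded_linear f \<longrightarrow> (\<lambda>n. f (y n x)) \<longlonglongrightarrow> f (v x)"
proof -
  have [measurable]: "y k \<in> borel_measurable M" for k using y(1) by (simp add: L_iff)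
  have [measurable]: "\<omega> k \<in> borel_measurable borel" for k
    by (intro borel_measurable_continuous_onI linear_continuous_on \<omega>)
  have R: "0 \<le> R" using y(2)[of 0] p_norm_nonneg order_trans by blast
  let ?W = "\<lambda>x z. z \<in> E x \<and> (\<forall>f :: 'b \<Rightarrow> real. bounded_linear f \<longrightarrow> (\<lambda>n. f (y n x)) \<longlonglongrightarrow> f z)"
  have "AE x in M. \<exists>z. ?W x z"
    using conv refl[unfolded reflexive_bundle_def] AE_space
  proof eventually_elim
    case (elim x)
    then obtain B where B: "\<And>n. norm (y n x) \<le> B" by blast
    obtain z where "z \<in> E x" "\<And>f :: 'b \<Rightarrow> real. bounded_linear f \<Longrightarrow> (\<lambda>n. f (y n x)) \<longlonglongrightarrow> f z"
      using reflexive_subspace_weak_limit[OF fibre_subspace[OF elim(3)] elim(2), of "\<lambda>n. y n x" B \<omega>]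
        L_fibre[OF y(1) elim(3)] B \<omega> elim(1) by blast
    then show ?case by blast
  qed
  then obtain N where N: "{x \<in> space M. \<not> (\<exists>z. ?W x z)} \<subseteq> N" "emeasure M N = 0" "N \<in> sets M"
    by (rule AE_E)
  define v where "v x = (if x \<in> space M - N then SOME z. ?W x z else 0)" for x
  have v: "?W x (v x)" if "x \<in> space M - N" for x
  proof -
    have ex: "\<exists>z. ?W x z" using N(1) that by blast
    have vx: "v x = (SOME z. ?W x z)" using that by (simp add: v_def)
    show ?thesis unfolding vx by (rule someI_ex[OF ex])
  qed
  have vE: "v x \<in> E x" if x: "x \<in> space M" for x
  proof (cases "x \<in> N")
    case True
    then show ?thesis using subspace_0[OF fibre_subspace[OF x]] by (simp add: v_def)
  next
    case False
    then show ?thesis using v[of x] x by simp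
  qed
  have vm [measurable]: "v \<in> borel_measurable M"
  proof (rule borel_measurable_norming[OF \<omega>])
    fix k
    have [measurable]: "space M - N \<in> sets M" using N(3) by simp
    have "\<omega> k (v x) = lim (\<lambda>n. if x \<in> space M - N then \<omega> k (y n x) else 0)" for x
    proof (cases "x \<in> space M - N")
      case True
      then have "(\<lambda>n. \<omega> k (y n x)) \<longlonglongrightarrow> \<omega> k (v x)" using v[OF True] \<omega>(1) by blast
      then show ?thesis using True by (simp add: limI)
    next
      case False
      have "\<omega> k 0 = 0" by (rule linear_0[OF bounded_linear.linear[OF \<omega>(1)]])
      then show ?thesis using False by (auto simp: v_def limI)
    qed
    moreover have "(\<lambda>x. lim (\<lambda>n. if x \<in> space M - N then \<omega> k (y n x) else 0)) \<in> borel_measurable M"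
      by (rule borel_measurable_lim_metric) measurable
    ultimately show "(\<lambda>x. \<omega> k (v x)) \<in> borel_measurable M" by simp
  qed
  have AE_v: "AE x in M. ?W x (v x)"
    using v N by (intro AE_I'[of N]) (auto simp: null_sets_def)
  have "(\<integral>\<^sup>+x. ennreal (norm (v x) powr p) \<partial>M) \<le> (\<integral>\<^sup>+x. liminf (\<lambda>n. ennreal (norm (y n x) powr p)) \<partial>M)"
  proof (rule nn_integral_mono_AE, use AE_v in eventually_elim)
    case (elim x)
    show ?case
      unfolding le_Liminf_iff
    proof (intro allI impI)
      \<comment> \<open>Weak lower semicontinuity through the norming sequence: with
        \<open>c = ennreal r\<close>, some \<open>\<omega> k (v x)\<close> exceeds
        \<open>r powr (1/p)\<close>, and eventually so does \<open>\<omega> k (y n x)\<close>, which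
        the norm of \<open>y n x\<close> dominates.\<close>
      fix c assume c: "c < ennreal (norm (v x) powr p)"
      obtain r where r: "0 \<le> r" "c = ennreal r" using c by (cases c) auto
      then have "r < norm (v x) powr p" using c by (simp add: ennreal_less_iff)
      then have "r powr (1/p) < (norm (v x) powr p) powr (1/p)" using r p by (intro powr_less_mono2) auto
      then have rp: "r powr (1/p) < norm (v x)" using p by (simp add: powr_powr)
      obtain k where k: "r powr (1/p) < \<omega> k (v x)"
        using \<omega>(3)[of "norm (v x) - r powr (1/p)" "v x"] rp by auto
      have "(\<lambda>n. \<omega> k (y n x)) \<longlonglongrightarrow> \<omega> k (v x)" using elim \<omega>(1) by blast
      from order_tendstoD(1)[OF this k]
      show "eventually (\<lambda>n. c < ennreal (norm (y n x) powr p)) sequentially"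
      proof eventually_elim
        case (elim n)
        then have "r powr (1/p) < norm (y n x)" using \<omega>(2)[of k "y n x"] by (simp add: abs_le_iff)
        then have "(r powr (1/p)) powr p < norm (y n x) powr p" using p by (intro powr_less_mono2) auto
        then show ?case using r p by (simp add: powr_powr ennreal_less_iff)
      qed
    qed
  qed
  also have "\<dots> \<le> liminf (\<lambda>n. \<integral>\<^sup>+x. ennreal (norm (y n x) powr p) \<partial>M)"
    by (rule nn_integral_liminf) measurable
  also have "\<dots> \<le> liminf (\<lambda>n::nat. ennreal (R powr p))"
  proof (intro Liminf_mono always_eventually allI)
    fix n
    show "(\<integral>\<^sup>+x. ennreal (norm (y n x) powr p) \<partial>M) \<le> ennreal (R powr p)"
      using p_norm_le_iff[OF R, of "y n"] y(2)[of n] by (simp add: nn_integral_eq_p_integral[OF y(1)] ennreal_leI)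
  qed
  also have "\<dots> = ennreal (R powr p)" by (simp add: Liminf_const)
  finally have "v \<in> L" using L_if_nn_integral_le(1)[OF vm vE _ R] by blast
  moreover have "AE x in M. \<forall>f :: 'b \<Rightarrow> real. bounded_linear f \<longrightarrow> (\<lambda>n. f (y n x)) \<longlonglongrightarrow> f (v x)"
    using AE_v by eventually_elim blast
  ultimately show ?thesis using that by blast
qed

context
  fixes F :: "('a \<Rightarrow> 'b) \<Rightarrow> real"
  assumes F: "linear F" and F_le: "\<And>u. u \<in> L \<Longrightarrow> \<bar>F u\<bar> \<le> p_norm M p u"
begin

lemma functional_cut_list_average:
  assumes \<rho>: "\<And>k. integrable M (\<rho> k)" "\<And>k A. A \<in> sets M \<Longrightarrow> F (cut A (u k)) = (\<integral>x. indicator A x * \<rho> k x \<partial>M)"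
    and A: "A \<in> sets M"
  shows "integrable M (\<lambda>x. indicator A x * list_average (\<lambda>k. \<rho> k x) l)"
    and "F (cut A (list_average u l)) = (\<integral>x. indicator A x * list_average (\<lambda>k. \<rho> k x) l \<partial>M)"
proof -
  have int: "integrable M (\<lambda>x. indicator A x * \<rho> k x)" for k
    using integrable_mult_indicator[OF A \<rho>(1)] by simp
  have sums: "integrable M (\<lambda>x. \<Sum>k\<leftarrow>l. indicator A x * \<rho> k x) \<and>
      (\<integral>x. (\<Sum>k\<leftarrow>l. indicator A x * \<rho> k x) \<partial>M) = (\<Sum>k\<leftarrow>l. \<integral>x. indicator A x * \<rho> k x \<partial>M)"
    using int by (induction l) auto
  have eq: "indicator A x * list_average (\<lambda>k. \<rho> k x) l = (1 / real (length l)) * (\<Sum>k\<leftarrow>l. indicator A x * \<rho> k x)" for x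
    by (simp add: list_average_def sum_list_const_mult)
  show "integrable M (\<lambda>x. indicator A x * list_average (\<lambda>k. \<rho> k x) l)"
    unfolding eq using sums by (intro integrable_mult_right) simp
  have lin: "linear (\<lambda>u. F (cut A u))"
  proof (rule linearI)
    have "cut A (u + v) = cut A u + cut A v" for u v :: "'a \<Rightarrow> 'b" by (auto simp: cut_def fun_eq_iff)
    then show "F (cut A (u + v)) = F (cut A u) + F (cut A v)" for u v by (simp only: linear_add[OF F])
    have "cut A (c *\<^sub>R u) = c *\<^sub>R cut A u" for c and u :: "'a \<Rightarrow> 'b" by (auto simp: cut_def fun_eq_iff)
    then show "F (cut A (c *\<^sub>R u)) = c *\<^sub>R F (cut A u)" for c u by (simp only: linear_scale[OF F])
  qed
  have "F (cut A (list_average u l)) = list_average (\<lambda>k. F (cut A (u k))) l"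
    by (rule linear_list_average[OF lin])
  also have "\<dots> = (1 / real (length l)) * (\<integral>x. (\<Sum>k\<leftarrow>l. indicator A x * \<rho> k x) \<partial>M)"
    using sums by (simp add: list_average_def \<rho>(2)[OF A])
  also have "\<dots> = (\<integral>x. indicator A x * list_average (\<lambda>k. \<rho> k x) l \<partial>M)"
    unfolding eq by simp
  finally show "F (cut A (list_average u l)) = (\<integral>x. indicator A x * list_average (\<lambda>k. \<rho> k x) l \<partial>M)" .
qed

text \<open>
  Where \<open>\<rho> n x \<ge> \<eta>\<close> infinitely often, averages over those indices \<open>n\<close> are small in norm while their density
  stays above \<open>\<eta>\<close>. Glueing countably many averages contradicts the boundedness of \<open>F\<close> unless that set is null.
\<close>

lemma density_eventually_less:
  assumes u: "\<And>n. u n \<in> L" and weak: "AE x in M. \<forall>f :: 'b \<Rightarrow> real. bounded_linear f \<longrightarrow> (\<lambda>n. f (u n x)) \<longlonglongrightarrow> 0"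
    and \<rho>: "\<And>k. integrable M (\<rho> k)" "\<And>k A. A \<in> sets M \<Longrightarrow> F (cut A (u k)) = (\<integral>x. indicator A x * \<rho> k x \<partial>M)"
    and \<eta>: "0 < \<eta>"
  shows "AE x in M. eventually (\<lambda>n. \<rho> n x < \<eta>) sequentially"
proof -
  have [measurable]: "u k \<in> borel_measurable M" "\<rho> k \<in> borel_measurable M" for k using u \<rho>(1) by (auto simp: L_iff)
  have [measurable]: "(\<lambda>x. list_average (\<lambda>k. \<rho> k x) l) \<in> borel_measurable M"
      "(\<lambda>x. list_average (\<lambda>k. u k x) l) \<in> borel_measurable M" for l
  proof -
    have "(\<lambda>x. \<Sum>k\<leftarrow>l. \<rho> k x) \<in> borel_measurable M" "(\<lambda>x. \<Sum>k\<leftarrow>l. u k x) \<in> borel_measurable M"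
      by (induction l) auto
    then show "(\<lambda>x. list_average (\<lambda>k. \<rho> k x) l) \<in> borel_measurable M" "(\<lambda>x. list_average (\<lambda>k. u k x) l) \<in> borel_measurable M"
      unfolding list_average_def by auto
  qed
  have avg_L: "list_average u l \<in> L" for l
  proof -
    have "(\<Sum>k\<leftarrow>l. u k) \<in> L"
    proof (induction l)
      case Nil
      show ?case unfolding list.map sum_list.Nil by (rule subspace_0[OF subspace_L])
    next
      case (Cons k l)
      show ?case unfolding list.map sum_list.Cons by (rule subspace_add[OF subspace_L u Cons])
    qed
    then show ?thesis unfolding list_average_def by (rule subspace_scale[OF subspace_L])
  qed
  obtain N where N: "{x \<in> space M. \<not> (\<forall>f :: 'b \<Rightarrow> real. bounded_linear f \<longrightarrow> (\<lambda>n. f (u n x)) \<longlonglongrightarrow> 0)} \<subseteq> N"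
      "emeasure M N = 0" "N \<in> sets M"
    using weak by (rule AE_E)
  define B where "B = {x \<in> space M - N. \<forall>n. \<exists>m\<ge>n. \<eta> \<le> \<rho> m x}"
  have B [measurable]: "B \<in> sets M"
  proof -
    have "B = {x \<in> space M. \<forall>n. \<exists>m\<ge>n. \<eta> \<le> \<rho> m x} - N" by (auto simp: B_def)
    then show ?thesis using N(3) by simp
  qed
  have small: "measure M A = 0" if A [measurable]: "A \<in> sets M" and AB: "A \<subseteq> B" and fin: "emeasure M A \<noteq> \<infinity>" for A
  proof (rule ccontr)
    assume "measure M A \<noteq> 0"
    then have mA: "0 < measure M A" using measure_nonneg[of M A] by linarith
    \<comment> \<open>Glued averages are bounded by \<open>\<epsilon>\<close> in norm while their
      density is at least \<open>\<eta>\<close>; comparing the two estimates of \<open>F\<close>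
      gives the inequality, which fails for small \<open>\<epsilon>\<close>.\<close>
    have main: "\<eta> * measure M A \<le> \<epsilon> * measure M A powr (1 / p)" if \<epsilon>: "0 < \<epsilon>" for \<epsilon>
    proof -
      let ?l = "from_nat :: nat \<Rightarrow> nat list"
      define S where "S i = {x \<in> A. ?l i \<noteq> [] \<and> norm (list_average (\<lambda>k. u k x) (?l i)) < \<epsilon> \<and>
          \<eta> \<le> list_average (\<lambda>k. \<rho> k x) (?l i)}" for i
      have S [measurable]: "S i \<in> sets M" for i
      proof -
        have "S i = A \<inter> {x \<in> space M. ?l i \<noteq> [] \<and> norm (list_average (\<lambda>k. u k x) (?l i)) < \<epsilon> \<and>
          \<eta> \<le> list_average (\<lambda>k. \<rho> k x) (?l i)}"
          using sets.sets_into_space[OF A] by (auto simp: S_def)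
        then show ?thesis by simp
      qed
      have cover: "(\<Union>i. S i) = A"
      proof (intro equalityI subsetI)
        fix x assume x: "x \<in> A"
        then have xB: "x \<in> B" using AB by blast
        let ?J = "{m. \<eta> \<le> \<rho> m x}"
        have inf: "infinite ?J" unfolding infinite_nat_iff_unbounded_le using xB by (auto simp: B_def)
        have weak_x: "(\<lambda>n. f (u n x)) \<longlonglongrightarrow> 0" if "bounded_linear f" for f :: "'b \<Rightarrow> real"
          using N(1) xB that by (auto simp: B_def)
        obtain l where l: "l \<noteq> []" "set l \<subseteq> ?J" "norm (list_average (\<lambda>k. u k x) l) < \<epsilon>"
          by (rule weakly_null_small_average[of "\<lambda>n. u n x" ?J \<epsilon>, OF weak_x inf \<epsilon>]) (assumption | rule that)+
        have "\<eta> \<le> list_average (\<lambda>k. \<rho> k x) l" using l(2) by (intro list_average_ge[OF l(1)]) auto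
        then have "x \<in> S (to_nat l)" using x l by (simp add: S_def)
        then show "x \<in> (\<Union>i. S i)" by blast
      qed (auto simp: S_def)
      define T where "T = disjointed S"
      have T [measurable]: "T i \<in> sets M" for i
      proof -
        have "range S \<subseteq> sets M" using S by blast
        then show ?thesis using sets.range_disjointed_sets[of S M] unfolding T_def by blast
      qed
      have TS: "T i \<subseteq> S i" for i by (simp add: T_def disjointed_subset)
      have disj: "disjoint_family T" by (simp add: T_def disjoint_family_disjointed)
      have UT: "(\<Union>i. T i) = A" by (simp add: T_def UN_disjointed_eq cover)
      have TA: "T i \<subseteq> A" for i using UT by blast
      have finT: "emeasure M (T i) < \<infinity>" for i
      proof (rule le_less_trans[OF emeasure_mono[OF TA A]])
        show "emeasure M A < \<infinity>" using fin by (simp add: less_top)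
      qed
      have "\<eta> * (\<Sum>i<J. measure M (T i)) \<le> \<epsilon> * measure M A powr (1 / p)" for J
      proof -
        \<comment> \<open>Finitely many pieces at a time, since \<open>F\<close> is merely linear;
          \<open>J\<close> tends to infinity in the resulting inequality.\<close>
        define v where "v = (\<Sum>i<J. cut (T i) (list_average u (?l i)))"
        have vL: "v \<in> L" unfolding v_def by (intro subspace_sum subspace_L cut_L avg_L T)
        have v_le: "norm (v x) \<le> \<epsilon> * indicator A x" for x
        proof (cases "\<exists>i<J. x \<in> T i")
          case True
          then obtain i where i: "i < J" "x \<in> T i" by blast
          have "cut (T j) (list_average u (?l j)) x = 0" if "j \<noteq> i" for j
            using disj i(2) that by (auto simp: cut_def disjoint_family_on_def)
          then have "v x = cut (T i) (list_average u (?l i)) x"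
            unfolding v_def sum_fun_apply using i(1) by (subst sum.remove[of _ i]) auto
          then show ?thesis
            using i(2) TS[of i] by (auto simp: cut_def S_def list_average_apply)
        next
          case False
          then have "v x = 0" unfolding v_def by (auto simp: cut_def)
          then show ?thesis using \<epsilon> by simp
        qed
        have "p_integral M p v \<le> (\<integral>x. \<epsilon> powr p * indicator A x \<partial>M)"
          unfolding p_integral_def
        proof (rule integral_mono[OF L_integrable[OF vL]])
          show "integrable M (\<lambda>x. \<epsilon> powr p * indicator A x)" using fin by (simp add: less_top)
          fix x
          show "norm (v x) powr p \<le> \<epsilon> powr p * indicator A x"
            using v_le[of x] p by (cases "x \<in> A") (auto intro: powr_mono2)
        qed
        also have "\<dots> = \<epsilon> powr p * measure M A" using sets.sets_into_space[OF A] by (simp add: Int_absorb2)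
        also have "\<dots> = (\<epsilon> * measure M A powr (1 / p)) powr p" using \<epsilon> p by (simp add: powr_mult powr_powr)
        finally have "p_norm M p v \<le> \<epsilon> * measure M A powr (1 / p)" using \<epsilon> by (subst p_norm_le_iff) auto
        then have Fv: "F v \<le> \<epsilon> * measure M A powr (1 / p)" using F_le[OF vL] by (simp add: abs_le_iff)
        have "\<eta> * measure M (T i) \<le> F (cut (T i) (list_average u (?l i)))" for i
        proof -
          have "(\<integral>x. \<eta> * indicator (T i) x \<partial>M) \<le> (\<integral>x. indicator (T i) x * list_average (\<lambda>k. \<rho> k x) (?l i) \<partial>M)"
          proof (rule integral_mono)
            show "integrable M (\<lambda>x. \<eta> * indicator (T i) x)" using finT by simp
            show "integrable M (\<lambda>x. indicator (T i) x * list_average (\<lambda>k. \<rho> k x) (?l i))"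
              by (rule functional_cut_list_average(1)[where u = u and \<rho> = \<rho>, OF \<rho> T])
            show "\<eta> * indicator (T i) x \<le> indicator (T i) x * list_average (\<lambda>k. \<rho> k x) (?l i)" for x
              using TS[of i] by (auto simp: S_def split: split_indicator)
          qed
          also have "\<dots> = F (cut (T i) (list_average u (?l i)))"
            by (rule functional_cut_list_average(2)[where u = u and \<rho> = \<rho>, OF \<rho> T, symmetric])
          finally show ?thesis using sets.sets_into_space[OF T] by (simp add: Int_absorb2)
        qed
        then have "\<eta> * (\<Sum>i<J. measure M (T i)) \<le> F v"
          unfolding v_def linear_sum[OF F] by (simp add: sum_distrib_left sum_mono)
        then show ?thesis using Fv by simp
      qed
      moreover have "(\<lambda>J. \<eta> * (\<Sum>i<J. measure M (T i))) \<longlonglongrightarrow> \<eta> * measure M A"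
      proof (rule tendsto_mult_left)
        have "range T \<subseteq> sets M" using T by blast
        from measure_UNION[OF this disj] show "(\<lambda>J. \<Sum>i<J. measure M (T i)) \<longlonglongrightarrow> measure M A"
          using fin by (simp add: UT sums_def)
      qed
      ultimately show ?thesis by (intro LIMSEQ_le_const2) auto
    qed
    define K where "K = measure M A powr (1 / p)"
    have K: "0 < K" using mA by (simp add: K_def)
    have "\<eta> * measure M A \<le> (\<eta> * measure M A / (2 * K)) * K"
      using main[of "\<eta> * measure M A / (2 * K)"] \<eta> mA K by (simp add: K_def)
    also have "\<dots> = \<eta> * measure M A / 2" using K by simp
    finally show False using mult_pos_pos[OF \<eta> mA] by simp
  qed
  have "emeasure M B = 0"
  proof -
    obtain A :: "nat \<Rightarrow> 'a set" where A: "range A \<subseteq> sets M" "(\<Union>i. A i) = space M" "\<And>i. emeasure M (A i) \<noteq> \<infinity>"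
      using sigma_finite by auto
    have "emeasure M (B \<inter> A i) = 0" for i
    proof -
      have fin: "emeasure M (B \<inter> A i) \<noteq> \<infinity>"
        using emeasure_mono[of "B \<inter> A i" "A i" M] A by (auto simp: top_unique)
      then have "measure M (B \<inter> A i) = 0" using A(1) by (intro small) auto
      then show ?thesis using fin by (simp add: emeasure_eq_ennreal_measure)
    qed
    then have "emeasure M (\<Union>i. B \<inter> A i) = 0" using A(1) by (intro emeasure_UN_eq_0) auto
    moreover have "(\<Union>i. B \<inter> A i) = B" using A(2) sets.sets_into_space[OF B] by blast
    ultimately show ?thesis by simp
  qed
  then have "B \<union> N \<in> null_sets M" using N B by (intro null_sets.Un) (auto simp: null_sets_def)
  then show ?thesis
    by (rule AE_I') (auto simp: B_def eventually_sequentially not_less)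
qed

text \<open>A Vitali argument. On \<open>X i\<close>, of finite measure and with uniformly bounded
  densities, dominated convergence applies. The complements \<open>B i\<close> decrease and almost
  every point leaves them, so \<open>functional_order_continuous\<close> makes their contribution
  small uniformly in \<open>n\<close>.\<close>

lemma functional_weakly_null:
  assumes u: "\<And>n. u n \<in> L" "\<And>n. p_norm M p (u n) \<le> R"
    and weak: "AE x in M. \<forall>f :: 'b \<Rightarrow> real. bounded_linear f \<longrightarrow> (\<lambda>n. f (u n x)) \<longlonglongrightarrow> 0"
  shows "(\<lambda>n. F (u n)) \<longlonglongrightarrow> 0"
proof -
  have R: "0 \<le> R" using u(2)[of 0] p_norm_nonneg order_trans by blast
  have "\<forall>n. \<exists>\<rho>. integrable M \<rho> \<and> (\<forall>A\<in>sets M. F (cut A (u n)) = (\<integral>x. indicator A x * \<rho> x \<partial>M))"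
  proof
    fix n
    show "\<exists>\<rho>. integrable M \<rho> \<and> (\<forall>A\<in>sets M. F (cut A (u n)) = (\<integral>x. indicator A x * \<rho> x \<partial>M))"
      by (rule functional_density[OF F F_le u(1)[of n]]) blast+
  qed
  from choice[OF this] obtain \<rho> where \<rho>: "\<And>n. integrable M (\<rho> n)"
      "\<And>n A. A \<in> sets M \<Longrightarrow> F (cut A (u n)) = (\<integral>x. indicator A x * \<rho> n x \<partial>M)"
    by blast
  have [measurable]: "\<rho> n \<in> borel_measurable M" for n using \<rho>(1) by auto
  have neg: "- u n \<in> L" "cut A (- u n) = - cut A (u n)" for n A
    using subspace_neg[OF subspace_L u(1)] by (auto simp: cut_def fun_eq_iff)
  have up: "AE x in M. eventually (\<lambda>n. \<rho> n x < \<eta>) sequentially" if "0 < \<eta>" for \<eta>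
    by (rule density_eventually_less[OF u(1) weak \<rho> that])
  have down: "AE x in M. eventually (\<lambda>n. - \<rho> n x < \<eta>) sequentially" if "0 < \<eta>" for \<eta>
  proof (rule density_eventually_less[where u = "\<lambda>n. - u n" and \<rho> = "\<lambda>n x. - \<rho> n x", OF neg(1) _ _ _ that])
    show "AE x in M. \<forall>f :: 'b \<Rightarrow> real. bounded_linear f \<longrightarrow> (\<lambda>n. f ((- u n) x)) \<longlonglongrightarrow> 0"
      using weak
    proof eventually_elim
      case (elim x)
      then show ?case
        using tendsto_minus by (fastforce simp: linear_neg[OF bounded_linear.linear])
    qed
    show "integrable M (\<lambda>x. - \<rho> k x)" for k using \<rho>(1) by simp
    show "F (cut A (- u k)) = (\<integral>x. indicator A x * - \<rho> k x \<partial>M)" if "A \<in> sets M" for k A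
      unfolding neg(2) linear_neg[OF F] \<rho>(2)[OF that] by simp
  qed
  have \<rho>_lim: "AE x in M. (\<lambda>n. \<rho> n x) \<longlonglongrightarrow> 0"
  proof -
    have "AE x in M. \<forall>m. eventually (\<lambda>n. \<rho> n x < inverse (real (Suc m))) sequentially \<and>
        eventually (\<lambda>n. - \<rho> n x < inverse (real (Suc m))) sequentially"
      unfolding AE_all_countable AE_conj_iff using up down by simp
    then show ?thesis
    proof eventually_elim
      case (elim x)
      show ?case
      proof (rule tendstoI)
        fix e :: real assume "0 < e"
        then obtain m where m: "inverse (real (Suc m)) < e" using reals_Archimedean by blast
        show "eventually (\<lambda>n. dist (\<rho> n x) 0 < e) sequentially"
          using elim[rule_format, of m, THEN conjunct1] elim[rule_format, of m, THEN conjunct2]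
          by eventually_elim (use m in auto)
      qed
    qed
  qed
  obtain A :: "nat \<Rightarrow> 'a set" where A: "range A \<subseteq> sets M" "(\<Union>i. A i) = space M" "\<And>i. emeasure M (A i) \<noteq> \<infinity>" "incseq A"
    using sigma_finite_incseq by blast
  have [measurable]: "A i \<in> sets M" for i using A(1) by auto
  define X where "X i = {x \<in> A i. \<forall>n. \<bar>\<rho> n x\<bar> \<le> real i}" for i
  have X_sets [measurable]: "X i \<in> sets M" for i
  proof -
    have "X i = A i \<inter> {x \<in> space M. \<forall>n. \<bar>\<rho> n x\<bar> \<le> real i}" using A(2) by (auto simp: X_def)
    then show ?thesis by simp
  qed
  have X_mono: "X i \<subseteq> X j" if "i \<le> j" for i j
    using incseqD[OF A(4) that] that by (auto simp: X_def intro: order_trans)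
  define B where "B i = space M - X i" for i
  have B: "B i \<in> sets M" for i by (simp add: B_def)
  have B_dec: "decseq B" using X_mono by (auto simp: B_def decseq_def)
  have ev: "AE x in M. eventually (\<lambda>i. x \<notin> B i) sequentially"
    using \<rho>_lim AE_space
  proof eventually_elim
    case (elim x)
    obtain K where K: "\<And>n. norm (\<rho> n x) \<le> K" using convergent_imp_Bseq[of "\<lambda>n. \<rho> n x"] elim(1)
      by (auto simp: convergent_def Bseq_def)
    obtain i where i: "x \<in> A i" using A(2) elim(2) by blast
    obtain j where j: "K \<le> real j" using real_arch_simple by blast
    have "\<bar>\<rho> n x\<bar> \<le> real (max i j)" for n using K[of n] j by simp
    then have "x \<in> X (max i j)" using i incseqD[OF A(4), of i "max i j"] by (auto simp: X_def)
    then have "x \<notin> B k" if "max i j \<le> k" for k using X_mono[OF that] by (auto simp: B_def)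
    then show ?case unfolding eventually_sequentially by blast
  qed
  show ?thesis
  proof (rule tendstoI)
    fix e :: real assume e: "0 < e"
    obtain i where i: "\<And>v. v \<in> L \<Longrightarrow> p_norm M p v \<le> R \<Longrightarrow> \<bar>F (cut (B i) v)\<bar> \<le> e / 2"
      using functional_order_continuous[OF F F_le B B_dec ev half_gt_zero[OF e] R] by blast
    have "(\<lambda>n. \<integral>x. indicator (X i) x * \<rho> n x \<partial>M) \<longlonglongrightarrow> (\<integral>x. 0 \<partial>M)"
    proof (rule integral_dominated_convergence[where w = "\<lambda>x. real i * indicator (A i) x"])
      show "integrable M (\<lambda>x. real i * indicator (A i) x)" using A(3)[of i] by (simp add: less_top)
      show "AE x in M. (\<lambda>n. indicator (X i) x * \<rho> n x) \<longlonglongrightarrow> 0"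
        using \<rho>_lim by eventually_elim (rule tendsto_mult_right_zero)
      show "AE x in M. norm (indicator (X i) x * \<rho> n x) \<le> real i * indicator (A i) x" for n
        by (rule AE_I2) (auto simp: X_def split: split_indicator)
    qed simp_all
    then have "(\<lambda>n. F (cut (X i) (u n))) \<longlonglongrightarrow> 0" by (simp add: \<rho>(2))
    then have "eventually (\<lambda>n. \<bar>F (cut (X i) (u n))\<bar> < e / 2) sequentially"
      using e by (auto dest!: tendstoD[of _ _ _ "e / 2"])
    then show "eventually (\<lambda>n. dist (F (u n)) 0 < e) sequentially"
    proof eventually_elim
      case (elim n)
      \<comment> \<open>The two cut pieces recover \<open>u n\<close> on \<open>space M\<close>
        only. The difference may be nonzero elsewhere, but its \<open>p\<close>-norm is 0, so
        \<open>F\<close> does not see it.\<close>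
      define d where "d = u n - (cut (X i) (u n) + cut (B i) (u n))"
      have dL: "d \<in> L"
        unfolding d_def by (intro subspace_diff subspace_add subspace_L cut_L u(1) X_sets B)
      have "d x = 0" if "x \<in> space M" for x using that by (auto simp: d_def cut_def B_def)
      then have "p_integral M p d = (\<integral>x. 0 \<partial>M)"
        unfolding p_integral_def using p by (intro Bochner_Integration.integral_cong) auto
      then have "F d = 0" using F_le[OF dL] p by (simp add: p_norm_def)
      moreover have "F d = F (u n) - (F (cut (X i) (u n)) + F (cut (B i) (u n)))"
        unfolding d_def linear_diff[OF F] linear_add[OF F] ..
      ultimately have "F (u n) = F (cut (X i) (u n)) + F (cut (B i) (u n))" by simp
      then show ?case using elim i[OF u] by (simp add: abs_less_iff abs_le_iff) (smt (verit))
    qed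
  qed
qed

end

theorem reflexive_bundle_imp_reflexive_section_space:
  assumes refl: "reflexive_bundle M E"
  shows "reflexive (section_space M E p)"
proof (rule ccontr)
  assume "\<not> ?thesis"
  then have nr: "\<not> reflexive_seminorm section_seminorm" by (simp add: reflexive_section_space_iff)
  obtain w0 \<theta> R where \<theta>: "0 < \<theta>" and J0: "james_sequence section_seminorm \<theta> w0" and R0: "\<And>k. section_seminorm (w0 k) \<le> R"
    by (rule not_reflexive_imp_james_sequence[OF seminorm_section_seminorm complete_section_seminorm nr]) (rule that)
  \<comment> \<open>The \<open>w0 k\<close> are arbitrary functions; the projection turns them into
    sections without changing the seminorm of any combination.\<close>
  define w where "w k = section_proj (w0 k)" for k
  have w: "w k \<in> L" "p_norm M p (w k) \<le> R" for k
    using R0[of k] by (simp_all add: w_def section_proj_L section_seminorm_def)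
  have ww: "section_proj (w k) = w k" for k by (rule section_proj(3)[OF w(1)])
  have J: "james_sequence section_seminorm \<theta> w"
    using J0 unfolding james_sequence_def section_seminorm_def linear_diff[OF section_proj(1)]
      linear_sum[OF section_proj(1)] linear_scale[OF section_proj(1)] ww w_def[symmetric] .
  obtain \<omega> :: "nat \<Rightarrow> 'b \<Rightarrow> real" where \<omega>: "\<And>k. bounded_linear (\<omega> k)" "\<And>k b. \<bar>\<omega> k b\<bar> \<le> norm b"
      "\<And>b e. 0 < e \<Longrightarrow> \<exists>k. norm b - e < \<omega> k b"
    using obtain_norming_sequence by blast
  obtain y where y: "\<And>n. y n \<in> tail_combinations w n"
    and conv: "AE x in M. (\<forall>j. convergent (\<lambda>n. \<omega> j (y n x))) \<and> (\<exists>B. \<forall>n. norm (y n x) \<le> B)"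
    by (rule ex_pointwise_convergent_blocks[OF w \<omega>(1,2)]) (rule that)
  have yL: "y n \<in> L" "p_norm M p (y n) \<le> R" for n using tail_combination_L[OF w y] by auto
  obtain v where v: "v \<in> L" and lim: "AE x in M. \<forall>f :: 'b \<Rightarrow> real. bounded_linear f \<longrightarrow> (\<lambda>n. f (y n x)) \<longlonglongrightarrow> f (v x)"
    by (rule ex_weak_limit_section[OF refl yL \<omega> conv]) (assumption | rule that)+
  obtain F n where F: "linear F" "\<And>z. \<bar>F z\<bar> \<le> section_seminorm z"
    and sep: "\<And>b. b \<in> tail_combinations w n \<Longrightarrow> F b \<le> F v - \<theta> / 2"
    by (rule james_sequence_separation[OF seminorm_section_seminorm J \<theta>, of v]) (rule that)
  have "(\<lambda>m. F (y m - v)) \<longlonglongrightarrow> 0"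
  proof (rule functional_weakly_null[OF F(1)])
    show "\<bar>F z\<bar> \<le> p_norm M p z" if "z \<in> L" for z using F(2)[of z] section_seminorm_L[OF that] by simp
    show "y m - v \<in> L" for m by (rule subspace_diff[OF subspace_L yL(1) v])
    have bound: "section_seminorm (y m - v) \<le> R + p_norm M p v" for m
      using seminorm_diff[OF seminorm_section_seminorm, of "y m" v] yL(2)[of m]
      by (simp add: section_seminorm_L[OF yL(1)] section_seminorm_L[OF v])
    show "p_norm M p (y m - v) \<le> R + p_norm M p v" for m
      using bound[of m] section_seminorm_L[OF subspace_diff[OF subspace_L yL(1) v], of m] by simp
    show "AE x in M. \<forall>f :: 'b \<Rightarrow> real. bounded_linear f \<longrightarrow> (\<lambda>m. f ((y m - v) x)) \<longlonglongrightarrow> 0"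
      using lim
    proof eventually_elim
      case (elim x)
      show ?case
      proof (intro allI impI)
        fix f :: "'b \<Rightarrow> real" assume f: "bounded_linear f"
        then have "(\<lambda>m. f (y m x) - f (v x)) \<longlonglongrightarrow> 0" using elim by (simp add: LIM_zero_iff)
        then show "(\<lambda>m. f ((y m - v) x)) \<longlonglongrightarrow> 0" by (simp add: linear_diff[OF bounded_linear.linear[OF f]])
      qed
    qed
  qed
  moreover have "F (y m - v) \<le> - (\<theta> / 2)" if "n \<le> m" for m
  proof -
    have "y m \<in> tail_combinations w n" using y[of m] tail_combinations_antimono[OF that] by blast
    from sep[OF this] show ?thesis by (simp add: linear_diff[OF F(1)])
  qed
  ultimately have "0 \<le> - (\<theta> / 2)" by (intro LIMSEQ_le_const2) auto
  then show False using \<theta> by simp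
qed

end

section \<open>Measurable selection along a Suslin scheme\<close>

text \<open>The outer measure is attained by intersecting measurable supersets of nearly minimal
  measure, so cutting the hull down by another measurable superset removes only a null set.\<close>

lemma (in finite_measure) ex_measurable_hull:
  assumes A: "A \<subseteq> space M"
  obtains H where "H \<in> sets M" "A \<subseteq> H" "\<And>H'. H' \<in> sets M \<Longrightarrow> A \<subseteq> H' \<Longrightarrow> H - H' \<in> null_sets M"
proof -
  let ?\<H> = "{H \<in> sets M. A \<subseteq> H}"
  define i where "i = (INF H\<in>?\<H>. measure M H)"
  have ne: "?\<H> \<noteq> {}" using A by auto
  have bdd: "bdd_below (measure M ` ?\<H>)" by (rule bdd_belowI2[of _ 0]) simp
  have i_le: "i \<le> measure M H" if "H \<in> ?\<H>" for H unfolding i_def using bdd that by (rule cINF_lower)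
  have "\<exists>H\<in>?\<H>. measure M H < i + inverse (real (Suc n))" for n
    using cINF_less_iff[OF ne bdd, of "i + inverse (real (Suc n))"] unfolding i_def by simp
  then have "\<forall>n. \<exists>H. H \<in> ?\<H> \<and> measure M H < i + inverse (real (Suc n))" by blast
  from choice[OF this] obtain G where G: "\<And>n. G n \<in> ?\<H>" "\<And>n. measure M (G n) < i + inverse (real (Suc n))" by blast
  define H where "H = (\<Inter>n. G n)"
  have H: "H \<in> sets M" "A \<subseteq> H" using G(1) by (auto simp: H_def)
  have "measure M H \<le> i + inverse (real (Suc n))" for n
  proof -
    have "measure M H \<le> measure M (G n)" using G(1) by (intro finite_measure_mono) (auto simp: H_def)
    then show ?thesis using G(2)[of n] by simp
  qed
  moreover have "(\<lambda>n. i + inverse (real (Suc n))) \<longlonglongrightarrow> i + 0"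
    by (intro tendsto_add tendsto_const LIMSEQ_inverse_real_of_nat)
  ultimately have Hi: "measure M H \<le> i" by (intro LIMSEQ_le_const[of _ i]) auto
  have "H - H' \<in> null_sets M" if "H' \<in> sets M" "A \<subseteq> H'" for H'
  proof -
    have "i \<le> measure M (H \<inter> H')" using that H by (intro i_le) auto
    moreover have "measure M (H - H') = measure M H - measure M (H \<inter> H')"
      using H(1) that(1) by (rule finite_measure_Diff')
    ultimately have "measure M (H - H') = 0" using Hi measure_nonneg[of M "H - H'"] by simp
    then show ?thesis using H(1) that(1) by (simp add: null_sets_def emeasure_eq_measure)
  qed
  then show ?thesis using that H by blast
qed

text \<open>
  With measurable hulls \<open>H s\<close> of the sets of points having a branch through \<open>s\<close>, the set
  \<open>H s - (\<Union>j. H (s @ [j]))\<close> is null. Off these countably many null sets, following least indices stays in the hulls,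
  hence in the scheme.
\<close>

lemma (in finite_measure) suslin_selection:
  fixes F :: "nat list \<Rightarrow> 'a set"
  assumes F: "\<And>s. F s \<in> sets M"
    and nonnull: "\<And>N. N \<in> null_sets M \<Longrightarrow> \<not> {x. \<exists>\<sigma>. \<forall>m. x \<in> F (map \<sigma> [0..<m])} \<subseteq> N"
  obtains B \<sigma> where "B \<in> sets M" "B \<notin> null_sets M" "\<And>n. (\<lambda>x. \<sigma> x n) \<in> measurable M (count_space UNIV)"
    "\<And>x m. x \<in> B \<Longrightarrow> x \<in> F (map (\<sigma> x) [0..<m])"
proof -
  \<comment> \<open>Points with a branch through \<open>s\<close>. The union over uncountably many
    branches need not be measurable, hence the hulls.\<close>
  define A where "A s = {x. \<exists>\<sigma>. map \<sigma> [0..<length s] = s \<and> (\<forall>m. x \<in> F (map \<sigma> [0..<m]))}" for s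
  have AF: "A s \<subseteq> F s" for s
  proof
    fix x assume "x \<in> A s"
    then obtain \<sigma> where \<sigma>: "map \<sigma> [0..<length s] = s" "\<forall>m. x \<in> F (map \<sigma> [0..<m])" by (auto simp: A_def)
    from \<sigma>(2)[rule_format, of "length s"] show "x \<in> F s" unfolding \<sigma>(1) .
  qed
  then have A_space: "A s \<subseteq> space M" for s using sets.sets_into_space[OF F] by blast
  have "\<forall>s. \<exists>H. H \<in> sets M \<and> A s \<subseteq> H \<and> (\<forall>H'\<in>sets M. A s \<subseteq> H' \<longrightarrow> H - H' \<in> null_sets M)"
  proof
    fix s
    obtain H where "H \<in> sets M" "A s \<subseteq> H" "\<And>H'. H' \<in> sets M \<Longrightarrow> A s \<subseteq> H' \<Longrightarrow> H - H' \<in> null_sets M"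
      by (rule ex_measurable_hull[OF A_space[of s]]) (assumption | rule that)+
    then show "\<exists>H. H \<in> sets M \<and> A s \<subseteq> H \<and> (\<forall>H'\<in>sets M. A s \<subseteq> H' \<longrightarrow> H - H' \<in> null_sets M)"
      by (intro exI[of _ H]) simp
  qed
  from choice[OF this] obtain H0 where H0: "\<And>s. H0 s \<in> sets M" "\<And>s. A s \<subseteq> H0 s"
      "\<And>s H'. H' \<in> sets M \<Longrightarrow> A s \<subseteq> H' \<Longrightarrow> H0 s - H' \<in> null_sets M"
    by blast
  define H where "H s = H0 s \<inter> F s" for s
  have H [measurable]: "H s \<in> sets M" and AH: "A s \<subseteq> H s" for s
    using H0(1,2) F AF by (auto simp: H_def)
  have A_split: "A s \<subseteq> (\<Union>j. A (s @ [j]))" for s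
  proof
    fix x assume "x \<in> A s"
    then obtain \<sigma> where \<sigma>: "map \<sigma> [0..<length s] = s" "\<forall>m. x \<in> F (map \<sigma> [0..<m])" by (auto simp: A_def)
    then have "x \<in> A (s @ [\<sigma> (length s)])" by (auto simp: A_def)
    then show "x \<in> (\<Union>j. A (s @ [j]))" by blast
  qed
  define N where "N = (\<Union>s. H s - (\<Union>j. H (s @ [j])))"
  have N: "N \<in> null_sets M"
    unfolding N_def
  proof (rule null_sets_UN)
    fix s
    have "A s \<subseteq> (\<Union>j. H (s @ [j]))" using A_split AH by blast
    then have "H0 s - (\<Union>j. H (s @ [j])) \<in> null_sets M" by (intro H0(3)) auto
    moreover have "H s - (\<Union>j. H (s @ [j])) \<in> sets M" by measurable
    moreover have "H s - (\<Union>j. H (s @ [j])) \<subseteq> H0 s - (\<Union>j. H (s @ [j]))" by (auto simp: H_def)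
    ultimately show "H s - (\<Union>j. H (s @ [j])) \<in> null_sets M" by (rule null_sets_subset)
  qed
  define path where "path x = rec_nat [] (\<lambda>_ s. s @ [LEAST j. x \<in> H (s @ [j])])" for x
  have path_Suc: "path x (Suc n) = path x n @ [LEAST j. x \<in> H (path x n @ [j])]" and path_0: "path x 0 = []" for x n
    by (simp_all add: path_def)
  define \<sigma> where "\<sigma> x n = (LEAST j. x \<in> H (path x n @ [j]))" for x n
  have path_eq: "path x n = map (\<sigma> x) [0..<n]" for x n
    by (induction n) (simp_all add: path_0 path_Suc \<sigma>_def)
  have meas_Least: "(\<lambda>x. LEAST j. x \<in> H (s @ [j])) \<in> measurable M (count_space UNIV)" for s
    by measurable
  have meas_path: "(\<lambda>x. path x n) \<in> measurable M (count_space UNIV)" for n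
  proof (induction n)
    case (Suc n)
    show ?case
      unfolding path_Suc
      by (rule measurable_compose_countable[OF _ Suc, of "\<lambda>s x. s @ [LEAST j. x \<in> H (s @ [j])]"])
        (rule measurable_compose[OF meas_Least], simp)
  qed (simp add: path_0)
  have meas_\<sigma>: "(\<lambda>x. \<sigma> x n) \<in> measurable M (count_space UNIV)" for n
    unfolding \<sigma>_def
    by (rule measurable_compose_countable[OF meas_Least meas_path[of n], of "\<lambda>s. s"])
  have in_H: "x \<in> H (path x n)" if x: "x \<in> H [] - N" for x n
  proof (induction n)
    case 0
    then show ?case using x by (simp add: path_0)
  next
    case (Suc n)
    then have "\<exists>j. x \<in> H (path x n @ [j])" using x by (auto simp: N_def)
    then show ?case unfolding path_Suc by (rule LeastI_ex)
  qed
  show ?thesis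
  proof (rule that[of "H [] - N" \<sigma>])
    show "H [] - N \<in> sets M" using N by auto
    show "H [] - N \<notin> null_sets M"
    proof
      assume "H [] - N \<in> null_sets M"
      then have "(H [] - N) \<union> N \<in> null_sets M" using N by (rule null_sets.Un)
      moreover have "{x. \<exists>\<sigma>. \<forall>m. x \<in> F (map \<sigma> [0..<m])} \<subseteq> (H [] - N) \<union> N"
        using AH[of "[]"] by (auto simp: A_def)
      ultimately show False using nonnull by blast
    qed
    show "x \<in> F (map (\<sigma> x) [0..<m])" if "x \<in> H [] - N" for x m
      using in_H[OF that, of m] by (simp add: path_eq H_def)
  qed (rule meas_\<sigma>)
qed

section \<open>Dense sequences of measurable sections\<close>

context Lp_bundle
begin

lemma fibre_meets_open:
  assumes "open U" shows "{x \<in> space M. E x \<inter> U \<noteq> {}} \<in> sets M"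
  using is_bundle assms by (auto simp: banach_bundle_def weakly_measurable_def)

text \<open>A Kuratowski-Ryll-Nardzewski construction: each next index is the least one whose ball,
  of half the radius, meets the current ball inside the fibre. Weak measurability of the bundle
  makes the indices measurable, the centres converge geometrically, and the limit lies in the closed
  fibre.\<close>

lemma ex_section_near:
  fixes d :: "nat \<Rightarrow> 'b"
  assumes d: "\<And>b e. 0 < e \<Longrightarrow> \<exists>k. norm (b - d k) < e"
  obtains v where "v \<in> borel_measurable M" "\<And>x. x \<in> space M \<Longrightarrow> v x \<in> E x"
    "\<And>x. x \<in> space M \<Longrightarrow> E x \<inter> ball (d i) ((1/2) ^ r) \<noteq> {} \<Longrightarrow> norm (v x - d i) \<le> 4 * (1/2) ^ r"
proof -
  define D where "D = {x \<in> space M. E x \<inter> ball (d i) ((1/2) ^ r) \<noteq> {}}"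
  have [measurable]: "D \<in> sets M" unfolding D_def by (rule fibre_meets_open) simp
  \<comment> \<open>A common point of both balls in the fibre keeps consecutive centres close and
    makes the next ball meet the fibre again.\<close>
  let ?U = "\<lambda>m k j. ball (d m) ((1/2) ^ (r + k)) \<inter> ball (d j) ((1/2) ^ (r + Suc k))"
  define idx where "idx x = rec_nat i (\<lambda>k m. LEAST j. E x \<inter> ?U m k j \<noteq> {})" for x
  have idx_0: "idx x 0 = i" and idx_Suc: "idx x (Suc k) = (LEAST j. E x \<inter> ?U (idx x k) k j \<noteq> {})" for x k
    by (simp_all add: idx_def)
  have Least_meas: "(\<lambda>x. LEAST j. E x \<inter> ?U m k j \<noteq> {}) \<in> measurable M (count_space UNIV)" for m k
  proof (rule measurable_Least)
    show "Measurable.pred M (\<lambda>x. E x \<inter> ?U m k j \<noteq> {})" for j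
      unfolding pred_def by (rule fibre_meets_open) auto
  qed
  have idx_meas: "(\<lambda>x. idx x k) \<in> measurable M (count_space UNIV)" for k
  proof (induction k)
    case (Suc k)
    show ?case
      unfolding idx_Suc by (rule measurable_compose_countable[OF Least_meas Suc])
  qed (simp add: idx_0)
  have meets: "E x \<inter> ball (d (idx x k)) ((1/2) ^ (r + k)) \<noteq> {} \<and> E x \<inter> ?U (idx x k) k (idx x (Suc k)) \<noteq> {}" if x: "x \<in> D" for x k
  proof -
    have step: "E x \<inter> ?U m k (LEAST j. E x \<inter> ?U m k j \<noteq> {}) \<noteq> {}"
      if ne: "E x \<inter> ball (d m) ((1/2) ^ (r + k)) \<noteq> {}" for m k
    proof -
      obtain b where b: "b \<in> E x" "b \<in> ball (d m) ((1/2) ^ (r + k))" using ne by blast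
      obtain j where "norm (b - d j) < (1/2) ^ (r + Suc k)" using d[of "(1/2) ^ (r + Suc k)" b] by auto
      then have "b \<in> E x \<inter> ?U m k j" using b by (simp add: dist_norm norm_minus_commute)
      then have "\<exists>j. E x \<inter> ?U m k j \<noteq> {}" by blast
      then show ?thesis by (rule LeastI_ex)
    qed
    have ball: "E x \<inter> ball (d (idx x k)) ((1/2) ^ (r + k)) \<noteq> {}" for k
    proof (induction k)
      case 0
      then show ?case using x by (simp add: D_def idx_0)
    next
      case (Suc k)
      then show ?case using step[of "idx x k" k] unfolding idx_Suc by auto
    qed
    then show ?thesis using step[of "idx x k" k] unfolding idx_Suc by blast
  qed
  define f where "f k x = d (idx x k)" for k x
  have f_meas [measurable]: "f k \<in> borel_measurable M" for k
    unfolding f_def by (rule measurable_compose[OF idx_meas]) simp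
  have f_step: "norm (f (Suc k) x - f k x) \<le> 2 * (1/2) ^ r * (1/2) ^ k" if x: "x \<in> D" for x k
  proof -
    obtain b where "norm (d (idx x k) - b) < (1/2) ^ (r + k)" "norm (d (idx x (Suc k)) - b) < (1/2) ^ (r + Suc k)"
      using meets[OF x, of k] by (auto simp: dist_norm)
    moreover have "norm (f (Suc k) x - f k x) \<le> norm (d (idx x (Suc k)) - b) + norm (d (idx x k) - b)"
      unfolding f_def using norm_triangle_ineq4[of "d (idx x (Suc k)) - b" "d (idx x k) - b"] by simp
    moreover have "(1/2::real) ^ (r + Suc k) \<le> (1/2) ^ (r + k)" by simp
    moreover have "2 * (1/2) ^ r * (1/2) ^ k = 2 * (1/2::real) ^ (r + k)" by (simp add: power_add)
    ultimately show ?thesis by linarith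
  qed
  define v where "v x = lim (\<lambda>k. if x \<in> D then f k x else 0)" for x
  have lim: "(\<lambda>k. f k x) \<longlonglongrightarrow> v x" if x: "x \<in> D" for x
    using convergent_if_geometric_steps[of "\<lambda>k. f k x", OF f_step[OF x]] x by (simp add: v_def convergent_LIMSEQ_iff)
  have "(\<lambda>x. lim (\<lambda>k. if x \<in> D then f k x else 0)) \<in> borel_measurable M"
    by (rule borel_measurable_lim_metric) measurable
  then have "v \<in> borel_measurable M" by (simp add: v_def[abs_def])
  moreover have "v x \<in> E x" if xM: "x \<in> space M" for x
  proof (cases "x \<in> D")
    case True
    have "\<forall>k. \<exists>b. b \<in> E x \<and> norm (f k x - b) < (1/2) ^ (r + k)"
      using meets[OF True] by (fastforce simp: f_def dist_norm)
    from choice[OF this] obtain b where b: "\<And>k. b k \<in> E x" "\<And>k. norm (f k x - b k) < (1/2) ^ (r + k)" by blast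
    have "(\<lambda>k. f k x - b k) \<longlonglongrightarrow> 0"
    proof (rule Lim_null_comparison)
      show "eventually (\<lambda>k. norm (f k x - b k) \<le> (1/2) ^ r * (1/2) ^ k) sequentially"
        using b(2) by (intro always_eventually allI) (simp add: power_add[symmetric] less_imp_le)
      show "(\<lambda>k. (1/2) ^ r * (1/2::real) ^ k) \<longlonglongrightarrow> 0"
        by (intro tendsto_mult_right_zero LIMSEQ_realpow_zero) auto
    qed
    from tendsto_diff[OF lim[OF True] this] have "b \<longlonglongrightarrow> v x" by simp
    then show ?thesis using closed_sequentially[OF fibre_closed[OF xM]] b(1) by blast
  next
    case False
    then show ?thesis using subspace_0[OF fibre_subspace[OF xM]] by (simp add: v_def limI)
  qed
  moreover have "norm (v x - d i) \<le> 4 * (1/2) ^ r" if "x \<in> space M" "E x \<inter> ball (d i) ((1/2) ^ r) \<noteq> {}" for x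
  proof -
    have x: "x \<in> D" using that by (simp add: D_def)
    \<comment> \<open>The step bounds \<open>2 * (1/2) ^ r * (1/2) ^ k\<close> add up to this
      geometric partial sum, the source of the constant 4.\<close>
    have "norm (f k x - d i) \<le> 4 * (1/2) ^ r * (1 - (1/2) ^ k)" for k
    proof (induction k)
      case 0
      then show ?case by (simp add: f_def idx_0)
    next
      case (Suc k)
      have "norm (f (Suc k) x - d i) \<le> norm (f (Suc k) x - f k x) + norm (f k x - d i)"
        using norm_triangle_ineq[of "f (Suc k) x - f k x" "f k x - d i"] by simp
      also have "\<dots> \<le> 2 * (1/2) ^ r * (1/2) ^ k + 4 * (1/2) ^ r * (1 - (1/2) ^ k)"
        by (intro add_mono f_step[OF x] Suc)
      finally show ?case by (simp add: algebra_simps)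
    qed
    moreover have "4 * (1/2) ^ r * (1 - (1/2) ^ k) \<le> (4 * (1/2) ^ r :: real)" for k
      by (rule mult_left_le) auto
    ultimately have "norm (f k x - d i) \<le> 4 * (1/2) ^ r" for k using order_trans by blast
    then show ?thesis
      using tendsto_norm[OF tendsto_diff[OF lim[OF x] tendsto_const[of "d i"]]] by (intro LIMSEQ_le_const2) auto
  qed
  ultimately show ?thesis using that by blast
qed

text \<open>A Castaing representation: one section for each centre \<open>d i\<close> and each
  radius \<open>(1/2) ^ r\<close>, enumerated by pairs.\<close>

lemma ex_dense_sections:
  obtains v :: "nat \<Rightarrow> 'a \<Rightarrow> 'b" where "\<And>k. v k \<in> borel_measurable M" "\<And>k x. x \<in> space M \<Longrightarrow> v k x \<in> E x"
    "\<And>x b e. x \<in> space M \<Longrightarrow> b \<in> E x \<Longrightarrow> 0 < e \<Longrightarrow> \<exists>k. norm (b - v k x) < e"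
proof -
  obtain d :: "nat \<Rightarrow> 'b" where d: "\<And>b e. 0 < e \<Longrightarrow> \<exists>k. norm (b - d k) < e"
    using obtain_dense_sequence by blast
  have "\<forall>ir. \<exists>v. v \<in> borel_measurable M \<and> (\<forall>x\<in>space M. v x \<in> E x) \<and>
    (\<forall>x\<in>space M. E x \<inter> ball (d (fst ir)) ((1/2) ^ snd ir) \<noteq> {} \<longrightarrow> norm (v x - d (fst ir)) \<le> 4 * (1/2) ^ snd ir)"
  proof
    fix ir :: "nat \<times> nat"
    obtain v where "v \<in> borel_measurable M" "\<And>x. x \<in> space M \<Longrightarrow> v x \<in> E x"
      "\<And>x. x \<in> space M \<Longrightarrow> E x \<inter> ball (d (fst ir)) ((1/2) ^ snd ir) \<noteq> {} \<Longrightarrow> norm (v x - d (fst ir)) \<le> 4 * (1/2) ^ snd ir"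
      by (rule ex_section_near[OF d, of "fst ir" "snd ir"]) (assumption | rule that)+
    then show "\<exists>v. v \<in> borel_measurable M \<and> (\<forall>x\<in>space M. v x \<in> E x) \<and>
      (\<forall>x\<in>space M. E x \<inter> ball (d (fst ir)) ((1/2) ^ snd ir) \<noteq> {} \<longrightarrow> norm (v x - d (fst ir)) \<le> 4 * (1/2) ^ snd ir)"
      by (intro exI[of _ v]) simp
  qed
  from choice[OF this] obtain v where v: "\<And>ir. v ir \<in> borel_measurable M" "\<And>ir x. x \<in> space M \<Longrightarrow> v ir x \<in> E x"
    "\<And>ir x. x \<in> space M \<Longrightarrow> E x \<inter> ball (d (fst ir)) ((1/2) ^ snd ir) \<noteq> {} \<Longrightarrow> norm (v ir x - d (fst ir)) \<le> 4 * (1/2) ^ snd ir"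
    by blast
  show ?thesis
  proof (rule that[of "\<lambda>k. v (prod_decode k)"])
    fix x b and e :: real assume x: "x \<in> space M" and b: "b \<in> E x" and e: "0 < e"
    \<comment> \<open>\<open>b\<close> is within \<open>(1/2) ^ r\<close> of \<open>d i\<close>, and
      \<open>d i\<close> within \<open>4 * (1/2) ^ r\<close> of the section: five units in
      all.\<close>
    obtain r where r: "(1/2::real) ^ r < e / 5" using real_arch_pow_inv[of "e / 5" "1/2"] e by auto
    obtain i where i: "norm (b - d i) < (1/2) ^ r" using d[of "(1/2) ^ r" b] by auto
    have "b \<in> ball (d i) ((1/2) ^ r)" using i by (simp add: dist_norm norm_minus_commute)
    then have "E x \<inter> ball (d i) ((1/2) ^ r) \<noteq> {}" using b by blast
    then have "norm (v (i, r) x - d i) \<le> 4 * (1/2) ^ r" using v(3)[OF x, of "(i, r)"] by simp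
    moreover have "norm (b - v (i, r) x) \<le> norm (b - d i) + norm (v (i, r) x - d i)"
      using norm_triangle_ineq4[of "b - d i" "v (i, r) x - d i"] by simp
    ultimately have "norm (b - v (i, r) x) < e" using i r by simp
    then show "\<exists>k. norm (b - v (prod_decode k) x) < e" by (intro exI[of _ "prod_encode (i, r)"]) simp
  qed (use v in auto)
qed

end

section \<open>A reflexive section space has reflexive fibres\<close>

lemma norm_list_average_le:
  fixes u :: "nat \<Rightarrow> 'b::real_normed_vector"
  assumes "l \<noteq> []" "\<And>k. k \<in> set l \<Longrightarrow> norm (u k) \<le> \<delta>"
  shows "norm (list_average u l) \<le> \<delta>"
proof -
  have "norm (\<Sum>k\<leftarrow>l. u k) \<le> real (length l) * \<delta>"
    using assms(2)
  proof (induction l)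
    case (Cons k l)
    then have "norm (u k) \<le> \<delta>" "norm (\<Sum>k\<leftarrow>l. u k) \<le> real (length l) * \<delta>" by auto
    then show ?case using norm_triangle_ineq[of "u k" "\<Sum>k\<leftarrow>l. u k"] by (simp add: algebra_simps)
  qed simp
  then show ?thesis using assms(1) by (simp add: list_average_def field_simps)
qed

lemma list_average_diff: "list_average u l - list_average v l = list_average (\<lambda>k. u k - v k) l"
proof -
  have "(\<Sum>k\<leftarrow>l. u k) - (\<Sum>k\<leftarrow>l. v k) = (\<Sum>k\<leftarrow>l. u k - v k)"
    by (induction l) (simp_all add: algebra_simps)
  then show ?thesis unfolding list_average_def scaleR_diff_right[symmetric] by simp
qed

lemma sum_list_eq_sum_count_list:
  fixes w :: "nat \<Rightarrow> 'v::real_vector"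
  assumes "finite I" "set l \<subseteq> I"
  shows "(\<Sum>k\<leftarrow>l. w k) = (\<Sum>k\<in>I. real (count_list l k) *\<^sub>R w k)"
  using assms(2)
proof (induction l)
  case (Cons j l)
  have "(\<Sum>k\<in>I. real (count_list (j # l) k) *\<^sub>R w k) = (\<Sum>k\<in>I. (if k = j then w k else 0) + real (count_list l k) *\<^sub>R w k)"
    by (intro sum.cong) (auto simp: scaleR_add_left)
  also have "\<dots> = w j + (\<Sum>k\<in>I. real (count_list l k) *\<^sub>R w k)"
    using Cons.prems assms(1) by (simp add: sum.distrib sum.delta)
  finally show ?case using Cons by simp
qed simp

text \<open>Multiplicities divided by the length are convex weights, so the James condition covers
  list averages.\<close>

lemma james_sequence_list_average:
  assumes J: "james_sequence Q \<theta> w"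
    and l: "l1 \<noteq> []" "l2 \<noteq> []" "set l1 \<subseteq> {..<n}" "set l2 \<subseteq> {n..<m}"
  shows "\<theta> \<le> Q (list_average w l1 - list_average w l2)"
proof -
  let ?a = "\<lambda>k. if k < n then real (count_list l1 k) / length l1 else real (count_list l2 k) / length l2"
  have eq: "list_average u l1 = (\<Sum>k<n. ?a k *\<^sub>R u k)" "list_average u l2 = (\<Sum>k=n..<m. ?a k *\<^sub>R u k)"
    for u :: "nat \<Rightarrow> 'c::real_vector"
    unfolding list_average_def sum_list_eq_sum_count_list[OF finite_lessThan l(3)]
      sum_list_eq_sum_count_list[OF finite_atLeastLessThan l(4)]
    by (auto simp: scaleR_right.sum intro!: sum.cong)
  have one: "list_average (\<lambda>k. 1::real) l = 1" if "l \<noteq> []" for l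
    using that by (simp add: list_average_def sum_list_triv)
  have "sum ?a {..<n} = 1" "sum ?a {n..<m} = 1"
    using eq[of "\<lambda>k. 1::real"] one l(1,2) by simp_all
  then show ?thesis
    using J[unfolded james_sequence_def, rule_format, of ?a n m] by (simp only: eq) simp
qed

text \<open>Averages with rational weights detect the James condition, which makes it a countable condition.\<close>

lemma norm_diff_ge_if_list_averages:
  fixes w :: "nat \<Rightarrow> 'b::real_normed_vector"
  assumes avg: "\<And>l1 l2. l1 \<noteq> [] \<Longrightarrow> l2 \<noteq> [] \<Longrightarrow> set l1 \<subseteq> {..<n} \<Longrightarrow> set l2 \<subseteq> {n..<m} \<Longrightarrow>
      \<theta> \<le> norm (list_average w l1 - list_average w l2)"
    and a: "\<And>k. 0 \<le> a k" "sum a {..<n} = 1" "sum a {n..<m} = (1::real)"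
  shows "\<theta> \<le> norm ((\<Sum>k<n. a k *\<^sub>R w k) - (\<Sum>k=n..<m. a k *\<^sub>R w k))"
proof (rule field_le_epsilon)
  fix e :: real assume e: "0 < e"
  let ?x = "\<Sum>k<n. a k *\<^sub>R w k" and ?y = "\<Sum>k=n..<m. a k *\<^sub>R w k"
  have a0: "sum a {0..<n} = 1" using a(2) by (simp add: atLeast0LessThan)
  obtain l1 where l1: "l1 \<noteq> []" "set l1 \<subseteq> {0..<n}" "norm ((\<Sum>k=0..<n. a k *\<^sub>R w k) - list_average w l1) < e / 2"
    by (rule convex_combination_approx_list_average[OF a(1) a0 half_gt_zero[OF e]]) (rule that)
  obtain l2 where l2: "l2 \<noteq> []" "set l2 \<subseteq> {n..<m}" "norm (?y - list_average w l2) < e / 2"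
    by (rule convex_combination_approx_list_average[OF a(1,3) half_gt_zero[OF e]]) (rule that)
  have "\<theta> \<le> norm (list_average w l1 - list_average w l2)"
    using l1 l2 by (intro avg) (auto simp: atLeast0LessThan)
  also have "list_average w l1 - list_average w l2 = (?x - ?y) - ((?x - list_average w l1) - (?y - list_average w l2))"
    by simp
  also have "norm \<dots> \<le> norm (?x - ?y) + norm ((?x - list_average w l1) - (?y - list_average w l2))"
    by (rule norm_triangle_ineq4)
  also have "norm ((?x - list_average w l1) - (?y - list_average w l2)) \<le> norm (?x - list_average w l1) + norm (?y - list_average w l2)"
    by (rule norm_triangle_ineq4)
  also have "norm (?x - list_average w l1) + norm (?y - list_average w l2) \<le> e"
    using l1(3) l2(3) by (simp add: atLeast0LessThan)
  finally show "\<theta> \<le> norm (?x - ?y) + e" by simp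
qed

context Lp_bundle
begin

theorem reflexive_section_space_imp_reflexive_bundle:
  assumes section_refl: "reflexive (section_space M E p)"
  shows "reflexive_bundle M E"
proof (rule ccontr)
  assume not_refl: "\<not> reflexive_bundle M E"
  let ?C = "{x \<in> space M. \<not> reflexive (subspace_space (E x))}"
  have C: "\<not> ?C \<subseteq> N" if "N \<in> null_sets M" for N
  proof
    assume "?C \<subseteq> N"
    then have "AE x in M. reflexive (subspace_space (E x))" by (rule AE_I'[OF that])
    then show False using not_refl by (simp add: reflexive_bundle_def)
  qed
  obtain v :: "nat \<Rightarrow> 'a \<Rightarrow> 'b" where v [measurable]: "\<And>k. v k \<in> borel_measurable M"
    and vE: "\<And>k x. x \<in> space M \<Longrightarrow> v k x \<in> E x"
    and dense: "\<And>x b e. x \<in> space M \<Longrightarrow> b \<in> E x \<Longrightarrow> 0 < e \<Longrightarrow> \<exists>k. norm (b - v k x) < e"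
    by (rule ex_dense_sections) (assumption | rule that)+
  define seq where "seq s x k = v (s ! k) x" for s :: "nat list" and x k
  \<comment> \<open>The James condition for rational weights on the finite stretch \<open>s\<close>,
    with bound \<open>r\<close> and constant \<open>1 / (r + 1)\<close>: countably many measurable
    conditions. A nonempty \<open>l2\<close> forces \<open>n < length s\<close>, so only genuine
    entries of \<open>s\<close> are read.\<close>
  define F where "F r s = {x \<in> space M. (\<forall>k<length s. norm (seq s x k) \<le> real r) \<and>
      (\<forall>n l1 l2. l1 \<noteq> [] \<and> l2 \<noteq> [] \<and> set l1 \<subseteq> {..<n} \<and> set l2 \<subseteq> {n..<length s} \<longrightarrow>
        inverse (real (Suc r)) \<le> norm (list_average (seq s x) l1 - list_average (seq s x) l2))}" for r s
  have F_sets: "F r s \<in> sets M" for r s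
  proof -
    have [measurable]: "(\<lambda>x. seq s x k) \<in> borel_measurable M" for k unfolding seq_def by measurable
    have [measurable]: "(\<lambda>x. list_average (seq s x) l) \<in> borel_measurable M" for l
    proof -
      have "(\<lambda>x. \<Sum>k\<leftarrow>l. seq s x k) \<in> borel_measurable M" by (induction l) auto
      then show ?thesis unfolding list_average_def by auto
    qed
    show ?thesis unfolding F_def by measurable
  qed
  define A where "A r = {x. \<exists>\<sigma>. \<forall>m. x \<in> F r (map \<sigma> [0..<m])}" for r
  have cover: "?C \<subseteq> (\<Union>r. A r)"
  proof
    fix x assume "x \<in> ?C"
    then have x: "x \<in> space M" and nr: "\<not> reflexive (subspace_space (E x))" by auto
    obtain w \<theta> K where \<theta>: "0 < \<theta>" and wE: "\<And>k. w k \<in> E x" and J: "james_sequence norm \<theta> w" and K: "\<And>k. norm (w k) \<le> K"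
      by (rule not_reflexive_subspace_james_sequence[OF fibre_subspace[OF x] fibre_closed[OF x] nr])
        (assumption | rule that)+
    \<comment> \<open>Moving each \<open>w k\<close> by at most \<open>\<theta> / 4\<close> costs at
      most \<open>\<theta> / 2\<close> in the distance of two averages; the bound 1 keeps the norms
      below \<open>K + 1\<close>.\<close>
    define \<delta> where "\<delta> = min 1 (\<theta> / 4)"
    have \<delta>: "0 < \<delta>" "\<delta> \<le> 1" "\<delta> \<le> \<theta> / 4" using \<theta> by (auto simp: \<delta>_def)
    have "\<forall>k. \<exists>j. norm (w k - v j x) < \<delta>" using dense[OF x wE \<delta>(1)] by blast
    from choice[OF this] obtain \<sigma> where \<sigma>: "\<And>k. norm (w k - v (\<sigma> k) x) < \<delta>" by blast
    obtain r1 :: nat where r1: "inverse (real (Suc r1)) < \<theta> / 2" using reals_Archimedean[OF half_gt_zero[OF \<theta>]] by blast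
    obtain r2 :: nat where r2: "K + 1 \<le> real r2" using real_arch_simple by blast
    define r where "r = max r1 r2"
    have r: "inverse (real (Suc r)) \<le> \<theta> / 2" "K + 1 \<le> real r"
    proof -
      have "inverse (real (Suc r)) \<le> inverse (real (Suc r1))" by (intro le_imp_inverse_le) (auto simp: r_def)
      then show "inverse (real (Suc r)) \<le> \<theta> / 2" using r1 by linarith
      show "K + 1 \<le> real r" using r2 by (simp add: r_def)
    qed
    have "x \<in> F r (map \<sigma> [0..<m])" for m
      unfolding F_def
    proof (intro CollectI conjI x allI impI)
      let ?s = "map \<sigma> [0..<m]"
      have seq: "seq ?s x k = v (\<sigma> k) x" if "k < m" for k using that by (simp add: seq_def)
      show "norm (seq ?s x k) \<le> real r" if "k < length ?s" for k
      proof -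
        have "norm (v (\<sigma> k) x) \<le> norm (w k) + norm (w k - v (\<sigma> k) x)"
          using norm_triangle_ineq4[of "w k" "w k - v (\<sigma> k) x"] by simp
        then show ?thesis using K[of k] \<sigma>[of k] \<delta>(2) r(2) seq[of k] that by simp
      qed
      fix n l1 l2
      assume l: "l1 \<noteq> [] \<and> l2 \<noteq> [] \<and> set l1 \<subseteq> {..<n} \<and> set l2 \<subseteq> {n..<length ?s}"
      then have l': "l1 \<noteq> []" "l2 \<noteq> []" "set l1 \<subseteq> {..<n}" "set l2 \<subseteq> {n..<m}" by auto
      have nm: "n < m" using l'(2,4) by (cases l2) auto
      have close: "norm (list_average w l - list_average (seq ?s x) l) \<le> \<delta>" if "l \<noteq> []" "set l \<subseteq> {..<m}" for l
        unfolding list_average_diff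
      proof (rule norm_list_average_le[OF that(1)])
        fix k assume "k \<in> set l"
        then have "k < m" using that(2) by auto
        then show "norm (w k - seq ?s x k) \<le> \<delta>" using \<sigma>[of k] seq[of k] by simp
      qed
      have "\<theta> \<le> norm (list_average w l1 - list_average w l2)"
        by (rule james_sequence_list_average[OF J l'])
      moreover have "norm (list_average w l1 - list_average (seq ?s x) l1) \<le> \<delta>"
        using l' nm by (intro close) auto
      moreover have "norm (list_average w l2 - list_average (seq ?s x) l2) \<le> \<delta>"
        using l' by (intro close) auto
      moreover have "norm (list_average w l1 - list_average w l2) \<le> norm (list_average (seq ?s x) l1 - list_average (seq ?s x) l2)
          + norm ((list_average w l1 - list_average (seq ?s x) l1) - (list_average w l2 - list_average (seq ?s x) l2))"
        using norm_triangle_ineq[of "list_average (seq ?s x) l1 - list_average (seq ?s x) l2"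
          "(list_average w l1 - list_average (seq ?s x) l1) - (list_average w l2 - list_average (seq ?s x) l2)"]
        by (simp add: algebra_simps)
      moreover have "norm ((list_average w l1 - list_average (seq ?s x) l1) - (list_average w l2 - list_average (seq ?s x) l2))
          \<le> norm (list_average w l1 - list_average (seq ?s x) l1) + norm (list_average w l2 - list_average (seq ?s x) l2)"
        by (rule norm_triangle_ineq4)
      ultimately show "inverse (real (Suc r)) \<le> norm (list_average (seq ?s x) l1 - list_average (seq ?s x) l2)"
        using r(1) \<delta>(3) by linarith
    qed
    then show "x \<in> (\<Union>r. A r)" by (auto simp: A_def)
  qed
  \<comment> \<open>If each of the countably many \<open>A r\<close> lay in a null set, so would the
    set of nonreflexive base points.\<close>
  have "\<exists>r. \<forall>N\<in>null_sets M. \<not> A r \<subseteq> N"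
  proof (rule ccontr)
    assume "\<not> ?thesis"
    then have "\<forall>r. \<exists>N. N \<in> null_sets M \<and> A r \<subseteq> N" by blast
    from choice[OF this] obtain N where N: "\<And>r. N r \<in> null_sets M" "\<And>r. A r \<subseteq> N r" by blast
    have "(\<Union>r. A r) \<subseteq> (\<Union>r. N r)" using N(2) by (rule UN_mono[OF subset_refl])
    with cover have "?C \<subseteq> (\<Union>r. N r)" by (rule subset_trans)
    moreover have "(\<Union>r. N r) \<in> null_sets M" by (rule null_sets_UN) (rule N(1))
    ultimately show False using C by blast
  qed
  then obtain r where r: "\<And>N. N \<in> null_sets M \<Longrightarrow> \<not> A r \<subseteq> N" by blast
  obtain f :: "'a \<Rightarrow> real" where "finite_measure (density M (\<lambda>x. ennreal (f x)))"
    and AE1: "\<And>P. (AE x in density M (\<lambda>x. ennreal (f x)). P x) \<longleftrightarrow> (AE x in M. P x)"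
    by (rule ex_equivalent_finite_measure) (rule that)
  moreover define N1 where "N1 = density M (\<lambda>x. ennreal (f x))"
  ultimately interpret N1: finite_measure N1 by simp
  have sets1: "sets N1 = sets M" by (simp add: N1_def)
  have null1: "N \<in> null_sets N1 \<longleftrightarrow> N \<in> null_sets M" for N
  proof (cases "N \<in> sets M")
    case True
    then show ?thesis
      using AE1[of "\<lambda>x. x \<notin> N"] AE_iff_null_sets[of N M] AE_iff_null_sets[of N N1] unfolding N1_def[symmetric]
      by (simp add: sets1)
  next
    case False
    then show ?thesis using sets1 by (auto simp: null_sets_def)
  qed
  obtain B \<sigma> where B: "B \<in> sets N1" "B \<notin> null_sets N1"
    and \<sigma>: "\<And>n. (\<lambda>x. \<sigma> x n) \<in> measurable N1 (count_space UNIV)"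
    and B_F: "\<And>x m. x \<in> B \<Longrightarrow> x \<in> F r (map (\<sigma> x) [0..<m])"
  proof (rule N1.suslin_selection[of "F r"])
    show "F r s \<in> sets N1" for s by (simp add: sets1 F_sets)
    show "\<not> {x. \<exists>\<sigma>. \<forall>m. x \<in> F r (map \<sigma> [0..<m])} \<subseteq> N" if "N \<in> null_sets N1" for N
      using r[of N] that null1 by (simp add: A_def)
  qed (rule that)
  have B_sets: "B \<in> sets M" using B(1) sets1 by simp
  have \<sigma>_meas: "(\<lambda>x. \<sigma> x n) \<in> measurable M (count_space UNIV)" for n
    using \<sigma>[of n] by (simp add: measurable_cong_sets[OF sets1 refl])
  obtain A0 :: "nat \<Rightarrow> 'a set" where A0: "range A0 \<subseteq> sets M" "(\<Union>i. A0 i) = space M" "\<And>i. emeasure M (A0 i) \<noteq> \<infinity>"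
    using sigma_finite by auto
  \<comment> \<open>Bounded sections supported on a piece of finite measure are
    \<open>p\<close>-integrable.\<close>
  have "\<exists>i. B \<inter> A0 i \<notin> null_sets M"
  proof (rule ccontr)
    assume "\<not> ?thesis"
    then have "(\<Union>i. B \<inter> A0 i) \<in> null_sets M" by (intro null_sets_UN) auto
    moreover have "(\<Union>i. B \<inter> A0 i) = B" using A0(2) sets.sets_into_space[OF B_sets] by blast
    ultimately show False using B(2) null1 by simp
  qed
  then obtain i where i: "B \<inter> A0 i \<notin> null_sets M" by blast
  define D where "D = B \<inter> A0 i"
  have D [measurable]: "D \<in> sets M" using B_sets A0(1) by (auto simp: D_def)
  have D_fin: "emeasure M D \<noteq> \<infinity>"
    using emeasure_mono[of D "A0 i" M] A0 by (auto simp: D_def top_unique)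
  have D_pos: "0 < measure M D"
  proof -
    have "emeasure M D \<noteq> 0" using i D by (auto simp: D_def null_sets_def)
    then show ?thesis using D_fin by (simp add: emeasure_eq_ennreal_measure zero_less_measure_iff)
  qed
  have D_space: "D \<subseteq> space M" by (rule sets.sets_into_space[OF D])
  \<comment> \<open>The selected branch glues the dense sections together; the measurable index
    takes countably many values, so measurability survives.\<close>
  define z where "z k x = (if x \<in> D then v (\<sigma> x k) x else 0)" for k x
  have z_meas: "z k \<in> borel_measurable M" for k
  proof -
    have "(\<lambda>x. v (\<sigma> x k) x) \<in> borel_measurable M" by (rule measurable_compose_countable[OF v \<sigma>_meas])
    then show ?thesis unfolding z_def[abs_def] by measurable
  qed
  have z_fibre: "z k x \<in> E x" if "x \<in> space M" for k x
    using vE[OF that] subspace_0[OF fibre_subspace[OF that]] by (simp add: z_def)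
  have z_bound: "norm (z k x) \<le> real r * indicator D x" for k x
  proof (cases "x \<in> D")
    case True
    then have "x \<in> F r (map (\<sigma> x) [0..<Suc k])" by (intro B_F) (simp add: D_def)
    then have "norm (seq (map (\<sigma> x) [0..<Suc k]) x k) \<le> real r" unfolding F_def by (simp del: upt_Suc)
    then show ?thesis using True by (simp add: seq_def z_def del: upt_Suc)
  qed (simp add: z_def)
  have ind: "(\<integral>\<^sup>+x. ennreal (c powr p * indicator D x) \<partial>M) = ennreal ((c * measure M D powr (1 / p)) powr p)" if "0 \<le> c" for c
  proof -
    have "(\<integral>\<^sup>+x. ennreal (c powr p * indicator D x) \<partial>M) = ennreal (c powr p) * emeasure M D"
      by (simp add: ennreal_mult ennreal_indicator nn_integral_cmult_indicator)
    also have "\<dots> = ennreal ((c * measure M D powr (1 / p)) powr p)"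
      using D_fin p that by (simp add: emeasure_eq_ennreal_measure ennreal_mult powr_mult powr_powr)
    finally show ?thesis .
  qed
  let ?\<mu> = "measure M D powr (1 / p)"
  have zL: "z k \<in> L" and z_norm: "p_norm M p (z k) \<le> real r * ?\<mu>" for k
  proof -
    have "(\<integral>\<^sup>+x. ennreal (norm (z k x) powr p) \<partial>M) \<le> (\<integral>\<^sup>+x. ennreal (real r powr p * indicator D x) \<partial>M)"
    proof (intro nn_integral_mono ennreal_leI)
      fix x show "norm (z k x) powr p \<le> real r powr p * indicator D x"
        using z_bound[of k x] p by (cases "x \<in> D") (auto intro: powr_mono2)
    qed
    also have "\<dots> = ennreal ((real r * ?\<mu>) powr p)" by (rule ind) simp
    finally show "z k \<in> L" "p_norm M p (z k) \<le> real r * ?\<mu>"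
      using L_if_nn_integral_le[OF z_meas z_fibre, of k "real r * ?\<mu>"] by simp_all
  qed
  have "james_sequence section_seminorm (inverse (real (Suc r)) * ?\<mu>) z"
    unfolding james_sequence_def
  proof (intro allI impI)
    fix a :: "nat \<Rightarrow> real" and n m
    assume a: "\<forall>k. 0 \<le> a k" "sum a {..<n} = 1" "sum a {n..<m} = 1"
    let ?u = "(\<Sum>k<n. a k *\<^sub>R z k) - (\<Sum>k=n..<m. a k *\<^sub>R z k)"
    have uL: "?u \<in> L" by (intro subspace_diff subspace_sum subspace_scale subspace_L zL)
    have nm: "n < m" using a(3) by (cases "n < m") auto
    \<comment> \<open>The gap holds at every point of \<open>D\<close> for the same weights and the
      same sections, which is what allows it to be integrated.\<close>
    have point: "inverse (real (Suc r)) \<le> norm (?u x)" if x: "x \<in> D" for x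
    proof -
      let ?s = "map (\<sigma> x) [0..<m]"
      have "x \<in> F r ?s" using x by (intro B_F) (simp add: D_def)
      then have "\<And>l1 l2. l1 \<noteq> [] \<Longrightarrow> l2 \<noteq> [] \<Longrightarrow> set l1 \<subseteq> {..<n} \<Longrightarrow> set l2 \<subseteq> {n..<m} \<Longrightarrow>
          inverse (real (Suc r)) \<le> norm (list_average (seq ?s x) l1 - list_average (seq ?s x) l2)"
        by (simp add: F_def)
      from norm_diff_ge_if_list_averages[where a = a, OF this] a
      have "inverse (real (Suc r)) \<le> norm ((\<Sum>k<n. a k *\<^sub>R seq ?s x k) - (\<Sum>k=n..<m. a k *\<^sub>R seq ?s x k))" by simp
      moreover have "seq ?s x k = z k x" if "k < m" for k using that x by (simp add: seq_def z_def)
      ultimately show ?thesis using nm by simp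
    qed
    have "ennreal ((inverse (real (Suc r)) * ?\<mu>) powr p) = (\<integral>\<^sup>+x. ennreal (inverse (real (Suc r)) powr p * indicator D x) \<partial>M)"
      by (rule ind[symmetric]) simp
    also have "\<dots> \<le> (\<integral>\<^sup>+x. ennreal (norm (?u x) powr p) \<partial>M)"
    proof (intro nn_integral_mono ennreal_leI)
      fix x show "inverse (real (Suc r)) powr p * indicator D x \<le> norm (?u x) powr p"
        using point[of x] p by (cases "x \<in> D") (auto intro: powr_mono2)
    qed
    also have "\<dots> = ennreal (p_norm M p ?u powr p)"
      using uL by (simp only: nn_integral_eq_p_integral p_norm_powr)
    finally have "(inverse (real (Suc r)) * ?\<mu>) powr p \<le> p_norm M p ?u powr p"
      by (simp add: ennreal_le_iff del: minus_apply)
    then have "inverse (real (Suc r)) * ?\<mu> \<le> p_norm M p ?u"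
      using powr_less_mono2[of p "p_norm M p ?u" "inverse (real (Suc r)) * ?\<mu>"] p p_norm_nonneg[of ?u]
      by (meson less_trans not_le zero_less_one)
    then show "inverse (real (Suc r)) * ?\<mu> \<le> section_seminorm ?u"
      by (simp only: section_seminorm_L[OF uL])
  qed
  moreover have "0 < inverse (real (Suc r)) * ?\<mu>" using D_pos by simp
  moreover have "section_seminorm (z k) \<le> real r * ?\<mu>" for k using z_norm[of k] section_seminorm_L[OF zL] by simp
  ultimately have "\<not> reflexive_seminorm section_seminorm"
    by (rule james_sequence_imp_not_reflexive[OF seminorm_section_seminorm])
  then show False using section_refl by (simp add: reflexive_section_space_iff)
qed

end

theorem theorem3p13:
  fixes M :: "'a measure"
    and E :: "'a \<Rightarrow> 'b::{banach, second_countable_topology} set"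
  assumes "sigma_finite_measure M"
    and "banach_bundle M E"
  shows "(reflexive_bundle M E \<longleftrightarrow> (\<forall>p::real. 1 < p \<longrightarrow> reflexive (section_space M E p))) \<and>
         (reflexive_bundle M E \<longleftrightarrow> (\<exists>p::real. 1 < p \<and> reflexive (section_space M E p)))"
proof -
  have iff: "reflexive_bundle M E \<longleftrightarrow> reflexive (section_space M E p)" if "1 < p" for p
  proof -
    interpret Lp_bundle M E p
      using assms that by (intro Lp_bundle.intro Lp_bundle_axioms.intro)
    show ?thesis
      using reflexive_bundle_imp_reflexive_section_space reflexive_section_space_imp_reflexive_bundle by blast
  qed
  have "1 < (2::real)" by simp
  with iff show ?thesis by blast
qed

end
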